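(* Let $c>\pi$ be fixed. Then for all $\theta_0\in(0,\tfrac{\pi}{2})$, $\theta_1\in(\tfrac{\pi}{2},\pi)$ with $\theta_*=\min(\theta_0,\pi-\theta_1)$ sufficiently close to $\tfrac{\pi}{2}$ (i.e. there is $\varepsilon>0$, depending on $c$, such that this holds whenever $\tfrac{\pi}{2}-\varepsilon<\theta_*<\tfrac{\pi}{2}$), the first two Dirichlet eigenvalues $\lambda_1<\lambda_2$ of $-\Delta$ on $\Omega_{c,\theta_0,\theta_1}$ satisfy $$\lambda_2-\lambda_1>\frac{3\pi^2}{D^2},$$ where $D$ is the diameter of $\Omega_{c,\theta_0,\theta_1}$.
   Context: $\mathbb{H}^2$ is the Poincar\'e upper half-plane $\{(x,y):y>0\}=\{(r,\theta): r>0,\ \theta\in(0,\pi)\}$ (polar coordinates $x=r\cos\theta$, $y=r\sin\theta$) with metric $(dx^2+dy^2)/y^2$, and $\Delta$ is its Laplace--Beltrami operator. For $c>0$, $\theta_0\in(0,\tfrac{\pi}{2})$, $\theta_1\in(\tfrac{\pi}{2},\pi)$, $$\Omega_{c,\theta_0,\theta_1}=\{(r,\theta): 1<r<e^{\pi/c},\ \theta_0<\theta<\theta_1\}\subset\mathbb{H}^2.$$ Dirichlet eigenvalues of $-\Delta$ are listed in increasing order with multiplicity, $\lambda_1<\lambda_2\le\cdots$. The diameter is the supremum of hyperbolic distances between points of the domain. *)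

theory Defs
  imports "HOL-Analysis.Analysis" "HOL-Library.Function_Algebras" "HOL-Library.Extended_Nat"
begin

section \<open>Riemannian metrics on regions of the plane\<close>

text \<open>A metric is given in global coordinates by its Gram matrix at each point.
  Only its values on the region under consideration matter.\<close>

type_synonym plane = "real ^ 2"

definition partial :: "2 \<Rightarrow> (plane \<Rightarrow> real) \<Rightarrow> plane \<Rightarrow> real" where
  "partial i f p = frechet_derivative f (at p) (axis i 1)"

definition C2_on :: "plane set \<Rightarrow> (plane \<Rightarrow> real) \<Rightarrow> bool" where
  "C2_on S f \<longleftrightarrow>
     (\<forall>p\<in>S. f differentiable (at p)) \<and>
     (\<forall>i. \<forall>p\<in>S. partial i f differentiable (at p)) \<and>
     (\<forall>i j. continuous_on S (partial j (partial i f)))"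

definition laplace_beltrami ::
  "(plane \<Rightarrow> real ^ 2 ^ 2) \<Rightarrow> (plane \<Rightarrow> real) \<Rightarrow> plane \<Rightarrow> real" where
  "laplace_beltrami g u p =
     (1 / sqrt (det (g p))) *
     (\<Sum>i\<in>UNIV. partial i (\<lambda>q. sqrt (det (g q)) *
        (\<Sum>j\<in>UNIV. matrix_inv (g q) $ i $ j * partial j u q)) p)"

definition riemannian_speed :: "(plane \<Rightarrow> real ^ 2 ^ 2) \<Rightarrow> (real \<Rightarrow> plane) \<Rightarrow> real \<Rightarrow> real" where
  "riemannian_speed g \<gamma> t =
     (let v = vector_derivative \<gamma> (at t) in sqrt (v \<bullet> (g (\<gamma> t) *v v)))"

text \<open>The derivative of a \<^const>\<open>valid_path\<close> may be unbounded near its exceptional points, so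
  such a path can have infinite length. Lengths are therefore taken with
  \<^const>\<open>has_integral\<close>, which discards these paths, and not with the total function
  \<^const>\<open>integral\<close>, which would give them length zero.\<close>

definition riemannian_dist ::
  "(plane \<Rightarrow> real ^ 2 ^ 2) \<Rightarrow> plane set \<Rightarrow> plane \<Rightarrow> plane \<Rightarrow> real" where
  "riemannian_dist g M p q =
     Inf {L. \<exists>\<gamma>. valid_path \<gamma> \<and> path_image \<gamma> \<subseteq> M \<and>
                 pathstart \<gamma> = p \<and> pathfinish \<gamma> = q \<and>
                 (riemannian_speed g \<gamma> has_integral L) {0..1}}"


section \<open>The hyperbolic plane\<close>

definition half_plane :: "plane set" where
  "half_plane = {p. p $ 2 > 0}"

definition hyp_metric :: "plane \<Rightarrow> real ^ 2 ^ 2" where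
  "hyp_metric p = (1 / (p $ 2)\<^sup>2) *\<^sub>R mat 1"

abbreviation hyp_laplacian :: "(plane \<Rightarrow> real) \<Rightarrow> plane \<Rightarrow> real" where
  "hyp_laplacian \<equiv> laplace_beltrami hyp_metric"

abbreviation hyp_dist :: "plane \<Rightarrow> plane \<Rightarrow> real" where
  "hyp_dist \<equiv> riemannian_dist hyp_metric half_plane"

definition hyp_diameter :: "plane set \<Rightarrow> real" where
  "hyp_diameter \<Omega> = Sup {hyp_dist p q |p q. p \<in> \<Omega> \<and> q \<in> \<Omega>}"

definition polar_sector :: "real \<Rightarrow> real \<Rightarrow> real \<Rightarrow> plane set" where
  "polar_sector c \<theta>\<^sub>0 \<theta>\<^sub>1 =
     {vector [r * cos \<theta>, r * sin \<theta>] |r \<theta>.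
        1 < r \<and> r < exp (pi / c) \<and> \<theta>\<^sub>0 < \<theta> \<and> \<theta> < \<theta>\<^sub>1}"


section \<open>Dirichlet eigenvalues\<close>

text \<open>Pointwise linear structure on real functions.\<close>

global_interpretation fun_space: vector_space "\<lambda>(a::real) (f::'a \<Rightarrow> real) x. a * f x"
  by unfold_locales (auto simp: fun_eq_iff algebra_simps)

text \<open>Classical Dirichlet problem: solutions are twice continuously differentiable in the open
  set \<open>\<Omega>\<close>, continuous on its closure and zero on its boundary. They are extended by zero outside
  \<open>\<Omega>\<close>, so that a function on the closure corresponds to exactly one function on the plane and
  dimensions are those of the space of functions on the closure. The closure is Euclidean; this is
  the closure in the hyperbolic plane if it does not meet the boundary line \<open>y = 0\<close>.\<close>

definition dirichlet_eigenspace :: "plane set \<Rightarrow> real \<Rightarrow> (plane \<Rightarrow> real) set" where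
  "dirichlet_eigenspace \<Omega> \<mu> =
     {u. C2_on \<Omega> u \<and> continuous_on (closure \<Omega>) u \<and>
         (\<forall>p. p \<notin> \<Omega> \<longrightarrow> u p = 0) \<and>
         (\<forall>p\<in>\<Omega>. - hyp_laplacian u p = \<mu> * u p)}"

definition dirichlet_multiplicity :: "plane set \<Rightarrow> real \<Rightarrow> enat" where
  "dirichlet_multiplicity \<Omega> \<mu> =
     (SUP B \<in> {B. finite B \<and> B \<subseteq> dirichlet_eigenspace \<Omega> \<mu> \<and> fun_space.independent B}.
        enat (card B))"

text \<open>Number of eigenvalues in \<open>J\<close>, counted with multiplicity. Numbers that are not
  eigenvalues contribute zero.\<close>

definition dirichlet_count :: "plane set \<Rightarrow> real set \<Rightarrow> enat" where
  "dirichlet_count \<Omega> J =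
     (SUP F \<in> {F. finite F \<and> F \<subseteq> J}. \<Sum>\<mu>\<in>F. dirichlet_multiplicity \<Omega> \<mu>)"

text \<open>\<open>\<mu>\<close> is the entry in position \<open>k \<ge> 1\<close> when the eigenvalues are listed in
  increasing order with multiplicity.\<close>

definition is_dirichlet_eigenvalue :: "plane set \<Rightarrow> nat \<Rightarrow> real \<Rightarrow> bool" where
  "is_dirichlet_eigenvalue \<Omega> k \<mu> \<longleftrightarrow>
     dirichlet_count \<Omega> {..<\<mu>} < enat k \<and> enat k \<le> dirichlet_count \<Omega> {..\<mu>}"

lemma dirichlet_count_mono: "I \<subseteq> J \<Longrightarrow> dirichlet_count \<Omega> I \<le> dirichlet_count \<Omega> J"
  unfolding dirichlet_count_def by (rule SUP_subset_mono) auto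

lemma is_dirichlet_eigenvalue_unique:
  assumes "is_dirichlet_eigenvalue \<Omega> k \<mu>" "is_dirichlet_eigenvalue \<Omega> k \<nu>"
  shows "\<mu> = \<nu>"
proof -
  have "\<not> a < b" if "is_dirichlet_eigenvalue \<Omega> k a" "is_dirichlet_eigenvalue \<Omega> k b" for a b
  proof
    assume "a < b"
    then have "dirichlet_count \<Omega> {..a} \<le> dirichlet_count \<Omega> {..<b}"
      by (intro dirichlet_count_mono) auto
    with that show False unfolding is_dirichlet_eigenvalue_def by (meson not_le order_trans)
  qed
  with assms show ?thesis by (meson linorder_less_linear)
qed


section \<open>The hyperbolic Laplacian in coordinates\<close>

lemma partial_cong:
  assumes "open S" "p \<in> S" "\<And>q. q \<in> S \<Longrightarrow> f q = h q"
  shows "partial i f p = partial i h p"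
proof -
  have "(f has_derivative D) (at p) \<longleftrightarrow> (h has_derivative D) (at p)" for D
    using assms has_derivative_transform_within_open [of f D p UNIV S h]
      has_derivative_transform_within_open [of h D p UNIV S f] by auto
  then show ?thesis by (simp add: partial_def frechet_derivative_def)
qed

lemma open_half_plane: "open half_plane"
  unfolding half_plane_def by (intro open_Collect_less continuous_intros)

lemma det_hyp_metric: "sqrt (det (hyp_metric p)) = 1 / (p $ 2)\<^sup>2"
proof -
  have "det (hyp_metric p) = (1 / (p $ 2)\<^sup>2)\<^sup>2"
    by (simp add: hyp_metric_def det_2 mat_def power2_eq_square)
  then show ?thesis by (simp only: real_sqrt_abs) simp
qed

lemma matrix_inv_hyp_metric:
  assumes "p \<in> half_plane"
  shows "matrix_inv (hyp_metric p) = (p $ 2)\<^sup>2 *\<^sub>R mat 1"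
proof -
  let ?A = "hyp_metric p" and ?B = "(p $ 2)\<^sup>2 *\<^sub>R mat 1 :: real ^ 2 ^ 2"
  have "p $ 2 \<noteq> 0" using assms by (simp add: half_plane_def)
  then have AB: "?A ** ?B = mat 1" "?B ** ?A = mat 1"
    by (simp_all add: hyp_metric_def vec_eq_iff forall_2 matrix_matrix_mult_def mat_def sum_2)
  then have "\<exists>X. ?A ** X = mat 1 \<and> X ** ?A = mat 1" by blast
  then have inv: "?A ** matrix_inv ?A = mat 1"
    unfolding matrix_inv_def by (rule someI2_ex) (rule conjunct1)
  have "matrix_inv ?A = (?B ** ?A) ** matrix_inv ?A"
    by (simp only: AB matrix_mul_lid)
  also have "\<dots> = ?B"
    by (simp only: matrix_mul_assoc [symmetric] inv matrix_mul_rid)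
  finally show ?thesis .
qed

lemma hyp_laplacian_eq:
  assumes "p \<in> half_plane"
  shows "hyp_laplacian u p = (p $ 2)\<^sup>2 * (partial 1 (partial 1 u) p + partial 2 (partial 2 u) p)"
proof -
  have *: "partial i (\<lambda>q. sqrt (det (hyp_metric q)) *
          (\<Sum>j\<in>UNIV. matrix_inv (hyp_metric q) $ i $ j * partial j u q)) p
        = partial i (partial i u) p" for i
  proof (rule partial_cong [OF open_half_plane assms])
    fix q assume q: "q \<in> half_plane"
    then have "q $ 2 \<noteq> 0" by (simp add: half_plane_def)
    then show "sqrt (det (hyp_metric q)) *
          (\<Sum>j\<in>UNIV. matrix_inv (hyp_metric q) $ i $ j * partial j u q) = partial i u q"
      using exhaust_2 [of i]
      by (auto simp: det_hyp_metric matrix_inv_hyp_metric [OF q] mat_def sum_2)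
  qed
  show ?thesis
    unfolding laplace_beltrami_def * by (simp add: det_hyp_metric sum_2)
qed

end

theory Submission
  imports Defs
begin

text \<open>In the coordinates \<open>t = ln r\<close>, \<open>\<theta>\<close> the Laplacian is \<open>sin\<^sup>2 \<theta> (\<partial>\<^sub>t\<^sup>2 + \<partial>\<^sub>\<theta>\<^sup>2)\<close>, so
  eigenfunctions separate into \<open>sin (k c t) \<phi> \<theta>\<close> with
  \<open>- \<phi>'' = (\<mu> / sin\<^sup>2 \<theta> - k\<^sup>2 c\<^sup>2) \<phi>\<close>. For thin sectors \<open>\<mu>\<^sub>1\<close> and \<open>\<mu>\<^sub>2\<close> are the ground
  states for \<open>k = 1\<close> and \<open>k = 2\<close>, because the angular interval is so short that the second
  angular mode lies far above. With \<open>m = \<pi> / 2 - \<theta>\<^sub>*\<close>, comparing the two angular equations gives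
  \<open>\<mu>\<^sub>2 - \<mu>\<^sub>1 \<ge> 3 c\<^sup>2 cos\<^sup>2 m\<close>. On the other hand the points with polar coordinates \<open>(1, \<theta>)\<close>, where
  \<open>\<theta>\<close> is the edge with \<open>sin \<theta> = cos m\<close>, and \<open>(e\<^sup>L, \<pi> / 2)\<close>, where \<open>L = \<pi> / c\<close>, show that
  \<open>cosh D \<ge> cosh L / cos m\<close>, and this exceeds \<open>cosh (L / cos m)\<close> for small \<open>m\<close> because
  \<open>L tanh L < 1\<close> when \<open>L < 1\<close>. So \<open>D > L / cos m\<close>, which makes \<open>3 \<pi>\<^sup>2 / D\<^sup>2\<close> smaller than the
  gap.\<close>

section \<open>Comparison of Dirichlet solutions on an interval\<close>

text \<open>Eigenvalues are defined here through classical solutions, with no spectral theorem or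
  Rayleigh quotient behind them. Exhibiting two ground states therefore does not locate them in the
  list: it must also be shown that no other number below \<mu>2 has an eigenfunction and that the
  eigenspace of \<mu>1 is a line. For this an arbitrary eigenfunction is projected to each sin (k c
  t). The coefficient solves the angular equation of that k, comparison with a positive ground state
  makes it vanish or be a multiple of the ground state, and completeness of the sines carries the
  result back. The remoteness of the second angular mode enters as one inequality,
  \<open>q \<le> 2 * \<kappa>\<^sup>2\<close> for the potential, with \<kappa> = pi / (b - a). On an
  interval of length b - a the operator -F'' has first modes \<kappa>^2 and 4 \<kappa>^2, so this
  bound admits a first mode and excludes a second. Existence of the ground states is a shooting
  argument in the eigenvalue parameter. The gap has its origin in 4 c^2 - c^2 = 3 c^2, the change of
  the separation constant, weakened by the upper bound 1 / (cos m)^2 for 1 / (sin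
  \<theta>)^2.\<close>

lemma local_min_second_derivative_nonneg:
  fixes f f' :: "real \<Rightarrow> real"
  assumes "a < z" "z < b"
    and D1: "\<And>t. a < t \<Longrightarrow> t < b \<Longrightarrow> (f has_field_derivative f' t) (at t)"
    and D2: "(f' has_field_derivative l) (at z)"
    and min: "\<And>t. a < t \<Longrightarrow> t < b \<Longrightarrow> f z \<le> f t"
  shows "0 \<le> l"
proof (rule ccontr)
  assume "\<not> 0 \<le> l"
  \<comment> \<open>\<open>f'\<close> vanishes at the minimum, so a negative \<open>l\<close> makes
    \<open>f'\<close> negative immediately to the right of \<open>z\<close>; the mean value theorem
    then yields a value below the minimum.\<close>
  then have "l < 0" by simp
  from DERIV_neg_dec_right [OF D2 this]
  obtain d where d: "d > 0" "\<And>h. h > 0 \<Longrightarrow> h < d \<Longrightarrow> f' (z + h) < f' z" by auto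
  have "f' z = 0"
  proof (rule DERIV_local_min [OF D1 [OF assms(1,2)], of "min (z - a) (b - z)"])
    show "\<forall>y. \<bar>z - y\<bar> < min (z - a) (b - z) \<longrightarrow> f z \<le> f y"
      by (intro allI impI min) auto
  qed (use assms in auto)
  define h where "h = min (d / 2) ((b - z) / 2)"
  have h: "h > 0" "h < d" "z + h < b" using d(1) assms(2) by (auto simp: h_def min_def field_simps)
  have "\<exists>s. z < s \<and> s < z + h \<and> f (z + h) - f z = (z + h - z) * f' s"
    by (rule MVT2) (use h assms in \<open>auto intro!: D1\<close>)
  then obtain s where s: "z < s" "s < z + h" "f (z + h) - f z = h * f' s" by auto
  have "f' s < 0" using d(2) [of "s - z"] s h \<open>f' z = 0\<close> by auto
  then have "f (z + h) < f z" using s h by (smt (verit) mult_pos_neg)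
  moreover have "f z \<le> f (z + h)" by (rule min) (use assms(1,2) h in linarith)+
  ultimately show False by simp
qed

text \<open>Compare with a positive function \<open>v\<close> solving
  \<open>v'' = - w\<^sup>2 * v\<close> with \<open>w\<^sup>2 > q\<close>. If \<open>G / v\<close>
  had a negative minimum \<open>M\<close> at \<open>z\<close>, then \<open>G - M * v\<close> would
  be nonnegative with a zero at \<open>z\<close>, yet its second derivative there is at most
  \<open>M * v z * (w\<^sup>2 - q z) < 0\<close>. The interval has half the critical length, which
  leaves room for such a \<open>v\<close>.\<close>

lemma max_principle_short_interval:
  fixes G G' G'' q :: "real \<Rightarrow> real"
  assumes "x < y" "0 < \<kappa>" "\<kappa> * (y - x) \<le> pi / 2"
    and cont: "continuous_on {x..y} G"
    and D1: "\<And>t. x < t \<Longrightarrow> t < y \<Longrightarrow> (G has_field_derivative G' t) (at t)"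
    and D2: "\<And>t. x < t \<Longrightarrow> t < y \<Longrightarrow> (G' has_field_derivative G'' t) (at t)"
    and bnd: "0 \<le> G x" "0 \<le> G y"
    and q: "\<And>t. x < t \<Longrightarrow> t < y \<Longrightarrow> q t \<le> 2 * \<kappa>\<^sup>2"
    and ineq: "\<And>t. x < t \<Longrightarrow> t < y \<Longrightarrow> G'' t + q t * G t \<le> 0"
    and t: "t \<in> {x..y}"
  shows "0 \<le> G t"
proof (rule ccontr)
  assume neg: "\<not> 0 \<le> G t"
  \<comment> \<open>Any factor strictly between sqrt 2 and 2 would serve: above sqrt 2 it gives
    \<open>w\<^sup>2 > 2 * \<kappa>\<^sup>2\<close>, below 2 it keeps the argument of the cosine
    under pi / 2 on the closed interval.\<close>
  define w where "w = 3 / 2 * \<kappa>"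
  define v where "v = (\<lambda>s. cos (w * (s - (x + y) / 2)))"
  have v: "v s > 0" if "s \<in> {x..y}" for s
  proof -
    have "\<bar>s - (x + y) / 2\<bar> \<le> (y - x) / 2"
      using that by (intro abs_leI) (auto simp: field_simps)
    then have "\<bar>w * (s - (x + y) / 2)\<bar> \<le> w * ((y - x) / 2)"
      using assms by (simp add: abs_mult w_def)
    also have "\<dots> \<le> 3 / 8 * pi" using assms by (simp add: w_def field_simps)
    also have "\<dots> < pi / 2" using pi_gt_zero by (simp add: field_simps)
    finally show ?thesis unfolding v_def by (intro cos_gt_zero_pi) auto
  qed
  have contv: "continuous_on {x..y} v" unfolding v_def by (intro continuous_intros)
  have "continuous_on {x..y} (\<lambda>s. G s / v s)"
    using v by (intro continuous_intros cont contv) force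
  then obtain z where z: "z \<in> {x..y}" "\<And>s. s \<in> {x..y} \<Longrightarrow> G z / v z \<le> G s / v s"
    using continuous_attains_inf [of "{x..y}" "\<lambda>s. G s / v s"] \<open>x < y\<close> by auto
  define M where "M = G z / v z"
  have M: "M < 0" using z(2) [OF t] neg v [OF t] unfolding M_def
    by (meson divide_neg_pos not_le order.strict_trans1)
  then have "G z < 0" using v [OF z(1)] by (auto simp: M_def divide_less_0_iff)
  then have zi: "x < z" "z < y" using bnd z(1) by (auto simp: order.strict_iff_order)
  define H where "H = (\<lambda>s. G s - M * v s)"
  define H' where "H' = (\<lambda>s. G' s + M * w * sin (w * (s - (x + y) / 2)))"
  have "0 \<le> G'' z + M * w\<^sup>2 * v z"
  proof (rule local_min_second_derivative_nonneg [OF zi, of H H'])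
    show "(H has_field_derivative H' s) (at s)" if "x < s" "s < y" for s
      unfolding H_def H'_def v_def
      by (auto intro!: derivative_eq_intros D1 [OF that] simp: algebra_simps)
    show "(H' has_field_derivative G'' z + M * w\<^sup>2 * v z) (at z)"
      unfolding H'_def v_def
      by (auto intro!: derivative_eq_intros D2 [OF zi] simp: algebra_simps power2_eq_square)
    show "H z \<le> H s" if "x < s" "s < y" for s
    proof -
      have "M \<le> G s / v s" unfolding M_def by (rule z(2)) (use that in auto)
      then have "M * v s \<le> G s" using v [of s] that by (simp add: field_simps)
      moreover have "M * v z = G z" using v [OF z(1)] by (simp add: M_def)
      ultimately show ?thesis by (simp add: H_def)
    qed
  qed
  also have "\<dots> \<le> - (q z * G z) + M * w\<^sup>2 * v z" using ineq [OF zi] by simp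
  also have "G z = M * v z" using v [OF z(1)] by (simp add: M_def)
  also have "- (q z * (M * v z)) + M * w\<^sup>2 * v z = M * v z * (w\<^sup>2 - q z)"
    by (simp add: algebra_simps)
  finally have "0 \<le> M * v z * (w\<^sup>2 - q z)" .
  moreover have "M * v z < 0" using M v [OF z(1)] by (simp add: mult_neg_pos)
  moreover have "w\<^sup>2 - q z > 0"
    using q [OF zi] \<open>0 < \<kappa>\<close> by (simp add: w_def power2_eq_square) (smt (verit) mult_pos_pos)
  ultimately show False by (smt (verit) mult_neg_pos)
qed

text \<open>The problem F'' + q F = 0 with zero end values. Derivatives are demanded only in the
  open interval, since the eigenfunctions that give rise to such F are merely continuous up to the
  edge.\<close>

definition dirichlet_solution ::
  "real \<Rightarrow> real \<Rightarrow> (real \<Rightarrow> real) \<Rightarrow> (real \<Rightarrow> real) \<Rightarrow> bool" where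
  "dirichlet_solution a b q F \<longleftrightarrow> continuous_on {a..b} F \<and> F a = 0 \<and> F b = 0 \<and>
     (\<exists>F'. \<forall>t\<in>{a<..<b}. (F has_field_derivative F' t) (at t) \<and>
        (F' has_field_derivative - q t * F t) (at t))"

lemma dirichlet_solution_uminus:
  assumes "dirichlet_solution a b q F"
  shows "dirichlet_solution a b q (\<lambda>t. - F t)"
proof -
  from assms obtain F' where F': "\<forall>t\<in>{a<..<b}. (F has_field_derivative F' t) (at t) \<and>
        (F' has_field_derivative - q t * F t) (at t)" by (auto simp: dirichlet_solution_def)
  have "\<forall>t\<in>{a<..<b}. ((\<lambda>t. - F t) has_field_derivative - F' t) (at t) \<and>
        ((\<lambda>t. - F' t) has_field_derivative - q t * - F t) (at t)"
    using F' by (auto intro!: derivative_eq_intros)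
  then show ?thesis
    using assms by (auto simp: dirichlet_solution_def intro!: continuous_intros exI [of _ "\<lambda>t. - F' t"])
qed

text \<open>Subtracting the multiple of \<open>\<phi>\<close> that agrees with \<open>F\<close> at the midpoint gives a function
  with zero boundary values on both halves, where the maximum principle holds although it fails on
  the whole interval.\<close>

lemma comparison_midpoint:
  fixes F \<phi> q r :: "real \<Rightarrow> real"
  assumes "a < b" and \<kappa>: "\<kappa> = pi / (b - a)"
    and F: "dirichlet_solution a b q F" and \<phi>: "dirichlet_solution a b r \<phi>"
    and pos: "\<forall>t\<in>{a<..<b}. 0 < \<phi> t"
    and q: "\<forall>t\<in>{a<..<b}. q t \<le> 2 * \<kappa>\<^sup>2"
    and M: "M = F ((a + b) / 2) / \<phi> ((a + b) / 2)"
    and sgn: "\<forall>t\<in>{a<..<b}. 0 \<le> M * (q t - r t)"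
    and t: "t \<in> {a..b}"
  shows "M * \<phi> t \<le> F t" and "M * (q ((a + b) / 2) - r ((a + b) / 2)) \<le> 0"
proof -
  obtain F' where "\<forall>t\<in>{a<..<b}. (F has_field_derivative F' t) (at t) \<and>
      (F' has_field_derivative - q t * F t) (at t)"
    using F by (auto simp: dirichlet_solution_def)
  with F have F: "continuous_on {a..b} F" "F a = 0" "F b = 0"
      "\<And>t. a < t \<Longrightarrow> t < b \<Longrightarrow> (F has_field_derivative F' t) (at t)"
      "\<And>t. a < t \<Longrightarrow> t < b \<Longrightarrow> (F' has_field_derivative - q t * F t) (at t)"
    by (simp_all add: dirichlet_solution_def)
  obtain \<phi>' where "\<forall>t\<in>{a<..<b}. (\<phi> has_field_derivative \<phi>' t) (at t) \<and>
      (\<phi>' has_field_derivative - r t * \<phi> t) (at t)"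
    using \<phi> by (auto simp: dirichlet_solution_def)
  with \<phi> pos have \<phi>: "continuous_on {a..b} \<phi>" "\<phi> a = 0" "\<phi> b = 0"
      "\<And>t. a < t \<Longrightarrow> t < b \<Longrightarrow> (\<phi> has_field_derivative \<phi>' t) (at t)"
      "\<And>t. a < t \<Longrightarrow> t < b \<Longrightarrow> (\<phi>' has_field_derivative - r t * \<phi> t) (at t)"
      "\<And>t. a < t \<Longrightarrow> t < b \<Longrightarrow> 0 < \<phi> t"
    by (simp_all add: dirichlet_solution_def)
  define m where "m = (a + b) / 2"
  have m: "a < m" "m < b" using \<open>a < b\<close> by (auto simp: m_def field_simps)
  \<comment> \<open>The equation for \<open>G\<close> has right-hand side
    \<open>- M * (q - r) * \<phi>\<close>, whose sign is the hypothesis on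
    \<open>M * (q - r)\<close>; thus \<open>G\<close> is a supersolution on each half.\<close>
  define G where "G = (\<lambda>s. F s - M * \<phi> s)"
  define G' where "G' = (\<lambda>s. F' s - M * \<phi>' s)"
  define G'' where "G'' = (\<lambda>s. - q s * F s + M * r s * \<phi> s)"
  have D1: "(G has_field_derivative G' s) (at s)" if "a < s" "s < b" for s
    unfolding G_def G'_def
    by (auto intro!: derivative_eq_intros F(4) \<phi>(4) that)
  have D2: "(G' has_field_derivative G'' s) (at s)" if "a < s" "s < b" for s
    unfolding G'_def G''_def
    by (auto intro!: derivative_eq_intros F(5) \<phi>(5) that)
  have "continuous_on {a..b} G" unfolding G_def by (intro continuous_intros F \<phi>)
  then have c: "continuous_on {a..m} G" "continuous_on {m..b} G"
    using m by (auto elim!: continuous_on_subset)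
  have z: "G a = 0" "G m = 0" "G b = 0"
    using F \<phi> \<phi>(6) [OF m] by (simp_all add: G_def M m_def)
  have "G'' s + q s * G s = - (M * (q s - r s)) * \<phi> s" for s
    by (simp add: G''_def G_def algebra_simps)
  then have ineq: "G'' s + q s * G s \<le> 0" if "a < s" "s < b" for s
    using sgn \<phi>(6) [OF that] that by simp
  have kap: "0 < \<kappa>" "\<kappa> * (m - a) = pi / 2" "\<kappa> * (b - m) = pi / 2"
  proof -
    have "m - a = (b - a) / 2" "b - m = (b - a) / 2" by (simp_all add: m_def field_simps)
    then show "0 < \<kappa>" "\<kappa> * (m - a) = pi / 2" "\<kappa> * (b - m) = pi / 2"
      using \<open>a < b\<close> by (simp_all only: \<kappa>) simp_all
  qed
  have G: "0 \<le> G s" if "s \<in> {a..b}" for s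
  proof (cases "s \<le> m")
    case True
    show ?thesis
      by (rule max_principle_short_interval [OF m(1) kap(1) _ c(1), of G' G'' q])
        (use z kap m that True in \<open>auto intro!: D1 D2 bspec [OF q] ineq\<close>)
  next
    case False
    show ?thesis
      by (rule max_principle_short_interval [OF m(2) kap(1) _ c(2), of G' G'' q])
        (use z kap m that False in \<open>auto intro!: D1 D2 bspec [OF q] ineq\<close>)
  qed
  from G [OF t] show "M * \<phi> t \<le> F t" by (simp add: G_def)
  \<comment> \<open>\<open>G\<close> is nonnegative and zero at the midpoint, so the midpoint is a
    minimum; the sign of \<open>G''\<close> there restricts the potentials and yields the second
    claim.\<close>
  have "0 \<le> G'' m"
    by (rule local_min_second_derivative_nonneg [OF m, of G G'])
      (use D1 D2 m G z in auto)
  also have "G'' m = - (M * (q m - r m)) * \<phi> m"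
    using z by (simp add: G''_def G_def algebra_simps)
  finally show "M * (q ((a + b) / 2) - r ((a + b) / 2)) \<le> 0"
    using \<phi>(6) [OF m] by (simp add: m_def zero_le_mult_iff mult_le_0_iff)
qed

text \<open>The midpoint comparison is applied to \<open>F\<close> and to \<open>- F\<close>, which
  reverses the sign of \<open>M\<close>. If the potentials agree, both applications hold and squeeze
  \<open>F\<close> onto \<open>M * \<phi>\<close>. If they are strictly ordered and \<open>M\<close>
  is nonzero, one of the two satisfies the sign hypothesis, and its second conclusion contradicts
  strictness at the midpoint; so \<open>M = 0\<close> and the squeeze gives \<open>F = 0\<close>.
  The bound on \<open>q\<close> matters: for r = \<kappa>^2 and q = 4 \<kappa>^2, with \<kappa> = pi
  / (b - a), the function sin (2 \<kappa> (t - a)) would violate the last claim.\<close>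

lemma dirichlet_comparison:
  fixes F \<phi> q r :: "real \<Rightarrow> real"
  assumes ab: "a < b"
    and F: "dirichlet_solution a b q F" and \<phi>: "dirichlet_solution a b r \<phi>"
    and pos: "\<forall>t\<in>{a<..<b}. 0 < \<phi> t"
    and q: "\<forall>t\<in>{a<..<b}. q t \<le> 2 * (pi / (b - a))\<^sup>2"
  shows dirichlet_comparison_eq:
      "\<forall>t\<in>{a<..<b}. q t = r t \<Longrightarrow> \<exists>M. \<forall>t\<in>{a..b}. F t = M * \<phi> t"
    and dirichlet_comparison_less:
      "\<forall>t\<in>{a<..<b}. q t < r t \<Longrightarrow> t \<in> {a..b} \<Longrightarrow> F t = 0"
    and dirichlet_comparison_greater:
      "\<forall>t\<in>{a<..<b}. q t > r t \<Longrightarrow> t \<in> {a..b} \<Longrightarrow> F t = 0"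
proof -
  define M where "M = F ((a + b) / 2) / \<phi> ((a + b) / 2)"
  have m: "(a + b) / 2 \<in> {a<..<b}" using ab by auto
  note pos1 = comparison_midpoint [OF ab refl F \<phi> pos q M_def]
  have M2: "- M = - F ((a + b) / 2) / \<phi> ((a + b) / 2)" by (simp add: M_def)
  note neg1 = comparison_midpoint [OF ab refl dirichlet_solution_uminus [OF F] \<phi> pos q M2]
  have eq: "F t = M * \<phi> t" if "\<forall>t\<in>{a<..<b}. M * (q t - r t) = 0" "t \<in> {a..b}" for t
    using pos1(1) [of t] neg1(1) [of t] that by force
  show "\<exists>M. \<forall>t\<in>{a..b}. F t = M * \<phi> t" if "\<forall>t\<in>{a<..<b}. q t = r t"
    using eq that by auto
  have zero: "F t = 0" if "M = 0" "t \<in> {a..b}" for t using eq that by auto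
  show "F t = 0" if *: "\<forall>t\<in>{a<..<b}. q t < r t" and t: "t \<in> {a..b}" for t
  proof (rule zero [OF _ t], rule ccontr)
    assume "M \<noteq> 0"
    then consider "M < 0" | "- M < 0" by linarith
    then show False
    proof cases
      case 1
      have "0 \<le> M * (q t - r t)" if "t \<in> {a<..<b}" for t
        using 1 bspec [OF * that] by (simp add: zero_le_mult_iff)
      from pos1(2) [OF ballI t, OF this] 1 bspec [OF * m] show False by (simp add: mult_le_0_iff)
    next
      case 2
      have "0 \<le> - M * (q t - r t)" if "t \<in> {a<..<b}" for t
        using 2 bspec [OF * that] by (simp add: mult_le_0_iff)
      from neg1(2) [OF ballI t, OF this] 2 bspec [OF * m] show False by (simp add: zero_le_mult_iff)
    qed
  qed
  show "F t = 0" if *: "\<forall>t\<in>{a<..<b}. q t > r t" and t: "t \<in> {a..b}" for t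
  proof (rule zero [OF _ t], rule ccontr)
    assume "M \<noteq> 0"
    then consider "M > 0" | "- M > 0" by linarith
    then show False
    proof cases
      case 1
      have "0 \<le> M * (q t - r t)" if "t \<in> {a<..<b}" for t
        using 1 bspec [OF * that] by (simp add: zero_le_mult_iff)
      from pos1(2) [OF ballI t, OF this] 1 bspec [OF * m] show False by (simp add: mult_le_0_iff)
    next
      case 2
      have "0 \<le> - M * (q t - r t)" if "t \<in> {a<..<b}" for t
        using 2 bspec [OF * that] by (simp add: mult_le_0_iff)
      from neg1(2) [OF ballI t, OF this] 2 bspec [OF * m] show False by (simp add: zero_le_mult_iff)
    qed
  qed
qed

section \<open>Hyperbolic distance and diameter\<close>

lemma hyp_speed_eq:
  "riemannian_speed hyp_metric \<gamma> t = norm (vector_derivative \<gamma> (at t)) / \<bar>\<gamma> t $ 2\<bar>"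
proof -
  define v where "v = vector_derivative \<gamma> (at t)"
  have "v \<bullet> (hyp_metric (\<gamma> t) *v v) = (v \<bullet> v) / (\<gamma> t $ 2)\<^sup>2"
    by (simp add: hyp_metric_def inner_vec_def sum_2 matrix_vector_mult_def mat_def add_divide_distrib)
  then show ?thesis
    by (simp add: riemannian_speed_def v_def [symmetric] real_sqrt_divide norm_eq_sqrt_inner)
qed

text \<open>The classical closed formula for cosh of the distance in the half-plane model. Only the
  inequality bounding \<open>hyp_dist\<close> from below by its arcosh is established, the direction
  that a lower bound for the diameter requires.\<close>

definition cosh_hyp_dist :: "plane \<Rightarrow> plane \<Rightarrow> real" where
  "cosh_hyp_dist p q = 1 + ((q $ 1 - p $ 1)\<^sup>2 + (q $ 2 - p $ 2)\<^sup>2) / (2 * p $ 2 * q $ 2)"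

lemma cosh_hyp_dist_ge_1:
  "p \<in> half_plane \<Longrightarrow> q \<in> half_plane \<Longrightarrow> 1 \<le> cosh_hyp_dist p q"
  by (auto simp: cosh_hyp_dist_def half_plane_def)

text \<open>The distance from a base point is singular there; replacing \<open>arcosh g\<close> by
  \<open>arcosh (g + \<eta>)\<close> keeps it smooth and only decreases its derivative.\<close>

lemma cosh_hyp_dist_path:
  fixes \<gamma> :: "real \<Rightarrow> plane"
  assumes \<gamma>: "valid_path \<gamma>" "path_image \<gamma> \<subseteq> half_plane"
    and len: "(riemannian_speed hyp_metric \<gamma> has_integral l) {0..1}"
  shows "arcosh (cosh_hyp_dist (pathstart \<gamma>) (pathfinish \<gamma>)) \<le> l"
proof -
  define p where "p = pathstart \<gamma>"
  have pos: "\<gamma> t $ 2 > 0" if "t \<in> {0..1}" for t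
    using \<gamma>(2) that unfolding path_image_def half_plane_def by blast
  then have p: "p $ 2 > 0" by (simp add: p_def pathstart_def)
  have cont: "continuous_on {0..1} \<gamma>" using valid_path_imp_path [OF \<gamma>(1)] by (simp add: path_def)
  obtain S where S: "finite S" and dS: "\<And>t. t \<in> {0..1} - S \<Longrightarrow> \<gamma> differentiable at t"
    using \<gamma>(1) by (auto simp: valid_path_def piecewise_C1_differentiable_on_def C1_differentiable_on_eq)
  define g where "g = (\<lambda>t. cosh_hyp_dist p (\<gamma> t))"
  have g1: "g t \<ge> 1" if "t \<in> {0..1}" for t
    using pos [OF that] p unfolding g_def by (intro cosh_hyp_dist_ge_1) (auto simp: half_plane_def)
  have contg: "continuous_on {0..1} g"
    unfolding g_def cosh_hyp_dist_def using pos p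
    by (intro continuous_intros cont) force+
  have main: "arcosh (g 1 + \<eta>) - arcosh (1 + \<eta>) \<le> l" if \<eta>: "\<eta> > 0" for \<eta>
  proof -
    define v where "v = (\<lambda>t. vector_derivative \<gamma> (at t))"
    define g' where "g' = (\<lambda>t. (2 * (\<gamma> t $ 1 - p $ 1) * v t $ 1 + 2 * (\<gamma> t $ 2 - p $ 2) * v t $ 2)
        / (2 * p $ 2 * \<gamma> t $ 2)
        - ((\<gamma> t $ 1 - p $ 1)\<^sup>2 + (\<gamma> t $ 2 - p $ 2)\<^sup>2) * v t $ 2 / (2 * p $ 2 * (\<gamma> t $ 2)\<^sup>2))"
    have dg: "(g has_field_derivative g' t) (at t)" if t: "t \<in> {0..1} - S" for t
    proof -
      have "(\<gamma> has_vector_derivative v t) (at t)"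
        using dS [OF t] by (simp add: v_def vector_derivative_works)
      then have *: "((\<lambda>s. \<gamma> s $ i) has_field_derivative v t $ i) (at t)" for i
        unfolding has_real_derivative_iff_has_vector_derivative
        by (intro bounded_linear.has_vector_derivative [OF bounded_linear_vec_nth])
      show ?thesis
        unfolding g_def cosh_hyp_dist_def g'_def
        using pos [of t] t p
        by (auto intro!: derivative_eq_intros * simp: power2_eq_square field_simps)
    qed
    have bound: "g' t \<le> sqrt ((g t)\<^sup>2 - 1) * (norm (v t) / \<gamma> t $ 2)" if t: "t \<in> {0..1}" for t
    proof -
      define y where "y = \<gamma> t $ 2"
      define X where "X = \<gamma> t $ 1 - p $ 1"
      \<comment> \<open>\<open>A\<close> and \<open>B\<close> are \<open>y\<close> times the partial
        derivatives of cosh of the distance, that is, its gradient in a hyperbolic orthonormal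
        frame. The identity \<open>(g t)\<^sup>2 - 1 = A\<^sup>2 + B\<^sup>2\<close> says that the
        distance has unit gradient, and Cauchy-Schwarz bounds its growth along the path by the
        speed.\<close>
      define A where "A = X / (p $ 2)"
      define B where "B = (y\<^sup>2 - X\<^sup>2 - (p $ 2)\<^sup>2) / (2 * p $ 2 * y)"
      have y: "y > 0" using pos [OF t] by (simp add: y_def)
      have 1: "g' t = (A * v t $ 1 + B * v t $ 2) / y"
        using y p unfolding g'_def A_def B_def X_def [symmetric] y_def [symmetric]
        by (simp add: field_simps power2_eq_square)
      have 2: "(g t)\<^sup>2 - 1 = A\<^sup>2 + B\<^sup>2"
        using y p unfolding g_def cosh_hyp_dist_def A_def B_def X_def [symmetric] y_def [symmetric]
        by (simp add: field_simps) (simp add: power2_eq_square algebra_simps)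
      have "(A * v t $ 1 + B * v t $ 2)\<^sup>2 \<le> (A\<^sup>2 + B\<^sup>2) * ((v t $ 1)\<^sup>2 + (v t $ 2)\<^sup>2)"
        using zero_le_power2 [of "A * v t $ 2 - B * v t $ 1"]
        by (simp add: power2_eq_square algebra_simps)
      then have "A * v t $ 1 + B * v t $ 2 \<le> sqrt ((A\<^sup>2 + B\<^sup>2) * ((v t $ 1)\<^sup>2 + (v t $ 2)\<^sup>2))"
        by (rule real_le_rsqrt)
      also have "\<dots> = sqrt (A\<^sup>2 + B\<^sup>2) * norm (v t)"
        by (simp add: real_sqrt_mult norm_vec_def L2_set_def sum_2)
      finally show ?thesis
        unfolding 1 2 y_def [symmetric] using y by (simp add: divide_right_mono)
    qed
    have "((\<lambda>t. g' t / sqrt ((g t + \<eta>)\<^sup>2 - 1)) has_integral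
        (arcosh (g 1 + \<eta>) - arcosh (g 0 + \<eta>))) {0..1}"
    proof (rule fundamental_theorem_of_calculus_interior_strong [OF S])
      show "((\<lambda>t. arcosh (g t + \<eta>)) has_vector_derivative g' t / sqrt ((g t + \<eta>)\<^sup>2 - 1)) (at t)"
        if "t \<in> {0<..<1} - S" for t
        unfolding has_real_derivative_iff_has_vector_derivative [symmetric]
      proof -
        have "1 < g t + \<eta>" using g1 [of t] that \<eta> by simp
        moreover have "((\<lambda>t. g t + \<eta>) has_field_derivative g' t + 0) (at t)"
          using that by (intro DERIV_add dg) auto
        ultimately show "((\<lambda>t. arcosh (g t + \<eta>)) has_field_derivative
            g' t / sqrt ((g t + \<eta>)\<^sup>2 - 1)) (at t)"
          using DERIV_chain2 [of arcosh "1 / sqrt ((g t + \<eta>)\<^sup>2 - 1)" "\<lambda>t. g t + \<eta>" t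
              "g' t + 0" UNIV, OF arcosh_real_has_field_derivative] by simp
      qed
      have "continuous_on {0..1} (arcosh \<circ> (\<lambda>t. g t + \<eta>))"
        using g1 \<eta> by (intro continuous_on_compose continuous_intros contg) force
      then show "continuous_on {0..1} (\<lambda>t. arcosh (g t + \<eta>))" by (simp add: o_def)
    qed simp
    moreover have "g 0 = 1"
      by (simp add: g_def p_def pathstart_def cosh_hyp_dist_def)
    ultimately have "((\<lambda>t. g' t / sqrt ((g t + \<eta>)\<^sup>2 - 1)) has_integral
        (arcosh (g 1 + \<eta>) - arcosh (1 + \<eta>))) {0..1}" by simp
    then show ?thesis
    proof (rule has_integral_le [OF _ len])
      fix t :: real assume t: "t \<in> {0..1}"
      have y: "\<gamma> t $ 2 > 0" by (rule pos [OF t])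
      have "(g t)\<^sup>2 \<le> (g t + \<eta>)\<^sup>2" "1 < (g t + \<eta>)\<^sup>2"
        using g1 [OF t] \<eta> by (auto intro!: power_mono) 
      then have s: "sqrt ((g t)\<^sup>2 - 1) \<le> sqrt ((g t + \<eta>)\<^sup>2 - 1)" "0 < sqrt ((g t + \<eta>)\<^sup>2 - 1)"
        by auto
      have "g' t \<le> sqrt ((g t + \<eta>)\<^sup>2 - 1) * (norm (v t) / \<gamma> t $ 2)"
        using y by (intro order_trans [OF bound [OF t]] mult_right_mono s) auto
      then show "g' t / sqrt ((g t + \<eta>)\<^sup>2 - 1) \<le> riemannian_speed hyp_metric \<gamma> t"
        using s(2) y by (simp add: hyp_speed_eq v_def field_simps)
    qed
  qed
  have "((\<lambda>\<eta>. arcosh (g 1 + \<eta>) - arcosh (1 + \<eta>)) \<longlongrightarrow> arcosh (g 1 + 0) - arcosh (1 + 0)) (at_right 0)"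
    using g1 [of 1] eventually_at_right_less [of "0 :: real"]
    by (intro tendsto_intros) (auto elim!: eventually_mono)
  then have "((\<lambda>\<eta>. arcosh (g 1 + \<eta>) - arcosh (1 + \<eta>)) \<longlongrightarrow> arcosh (g 1)) (at_right 0)" by simp
  then have "arcosh (g 1) \<le> l"
    by (rule tendsto_upperbound) (auto simp: eventually_at_right_less eventually_at_filter main)
  then show ?thesis by (simp add: g_def p_def pathfinish_def)
qed

section \<open>Finite upper bounds for distances, and the diameter of a sector\<close>

lemma linepath_half_plane:
  assumes "p \<in> half_plane" "q \<in> half_plane" "t \<in> {0..1}"
  shows "min (p $ 2) (q $ 2) \<le> linepath p q t $ 2"
proof -
  have "(1 - t) * min (p $ 2) (q $ 2) + t * min (p $ 2) (q $ 2) \<le> (1 - t) * p $ 2 + t * q $ 2"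
    using assms by (intro add_mono mult_left_mono) auto
  then show ?thesis by (simp add: linepath_def algebra_simps)
qed

lemma linepath_hyp_length:
  assumes p: "p \<in> half_plane" and q: "q \<in> half_plane"
  obtains l where "(riemannian_speed hyp_metric (linepath p q) has_integral l) {0..1}"
    "l \<le> norm (q - p) / min (p $ 2) (q $ 2)" "path_image (linepath p q) \<subseteq> half_plane"
proof -
  define \<eta> where "\<eta> = min (p $ 2) (q $ 2)"
  have \<eta>: "0 < \<eta>" using p q by (simp add: \<eta>_def half_plane_def)
  have ge: "\<eta> \<le> linepath p q t $ 2" if "t \<in> {0..1}" for t
    using linepath_half_plane [OF p q that] by (simp add: \<eta>_def)
  have speed: "riemannian_speed hyp_metric (linepath p q) t = norm (q - p) / \<bar>linepath p q t $ 2\<bar>" for t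
    by (simp add: hyp_speed_eq)
  have "continuous_on {0..1} (\<lambda>t. norm (q - p) / \<bar>linepath p q t $ 2\<bar>)"
    using ge \<eta> by (intro continuous_intros) force+
  then have int: "(\<lambda>t. norm (q - p) / \<bar>linepath p q t $ 2\<bar>) integrable_on {0..1}"
    by (rule integrable_continuous_real)
  have "integral {0..1} (\<lambda>t. norm (q - p) / \<bar>linepath p q t $ 2\<bar>)
      \<le> integral {0..1} (\<lambda>t :: real. norm (q - p) / \<eta>)"
  proof (rule integral_le [OF int])
    fix t :: real assume t: "t \<in> {0..1}"
    show "norm (q - p) / \<bar>linepath p q t $ 2\<bar> \<le> norm (q - p) / \<eta>"
      using ge [OF t] \<eta> by (intro divide_left_mono mult_pos_pos) auto
  qed (auto intro: integrable_continuous_real)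
  moreover have "path_image (linepath p q) \<subseteq> half_plane"
  proof
    fix z assume "z \<in> path_image (linepath p q)"
    then obtain t where "t \<in> {0..1}" "z = linepath p q t" unfolding path_image_def by blast
    with ge [of t] \<eta> show "z \<in> half_plane" by (simp add: half_plane_def)
  qed
  ultimately show ?thesis
    using that [of "integral {0..1} (\<lambda>t. norm (q - p) / \<bar>linepath p q t $ 2\<bar>)"] int
    by (simp add: speed [abs_def] integrable_integral \<eta>_def)
qed

text \<open>The Euclidean segment serves two ends: its finite length makes the set under the infimum
  nonempty, so that a lower bound for all lengths passes to \<open>Inf\<close>, and it gives a crude
  upper bound for the distance.\<close>

lemma hyp_dist_bounds:
  assumes p: "p \<in> half_plane" and q: "q \<in> half_plane"
  shows "arcosh (cosh_hyp_dist p q) \<le> hyp_dist p q"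
    and "hyp_dist p q \<le> norm (q - p) / min (p $ 2) (q $ 2)"
proof -
  define X where "X = {L. \<exists>\<gamma>. valid_path \<gamma> \<and> path_image \<gamma> \<subseteq> half_plane \<and>
                 pathstart \<gamma> = p \<and> pathfinish \<gamma> = q \<and>
                 (riemannian_speed hyp_metric \<gamma> has_integral L) {0..1}}"
  have d: "hyp_dist p q = Inf X" by (simp add: riemannian_dist_def X_def)
  obtain l where l: "(riemannian_speed hyp_metric (linepath p q) has_integral l) {0..1}"
    "l \<le> norm (q - p) / min (p $ 2) (q $ 2)" "path_image (linepath p q) \<subseteq> half_plane"
    by (rule linepath_hyp_length [OF p q])
  have lX: "l \<in> X" unfolding X_def
    using l by (intro CollectI exI [of _ "linepath p q"]) auto
  have lb: "arcosh (cosh_hyp_dist p q) \<le> x" if "x \<in> X" for x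
    using that cosh_hyp_dist_path unfolding X_def by blast
  show "arcosh (cosh_hyp_dist p q) \<le> hyp_dist p q"
    unfolding d using lX lb by (intro cInf_greatest) auto
  have "Inf X \<le> l" using lX lb by (intro cInf_lower) (auto simp: bdd_below_def)
  then show "hyp_dist p q \<le> norm (q - p) / min (p $ 2) (q $ 2)" using l(2) d by simp
qed

text \<open>\<open>Sup\<close> is meaningful only for a bounded set, so distances inside the sector
  must first be bounded uniformly. Points of the sector have height at least the minimum of the sine
  on the closed angular interval and norm at most \<open>exp (pi / c)\<close>, which bounds the
  length of every segment between them.\<close>

lemma polar_sector_diameter_ge:
  assumes "0 < c" and \<theta>: "0 < \<theta>\<^sub>0" "\<theta>\<^sub>0 < \<theta>\<^sub>1" "\<theta>\<^sub>1 < pi"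
    and p: "p \<in> polar_sector c \<theta>\<^sub>0 \<theta>\<^sub>1" and q: "q \<in> polar_sector c \<theta>\<^sub>0 \<theta>\<^sub>1"
  shows "arcosh (cosh_hyp_dist p q) \<le> hyp_diameter (polar_sector c \<theta>\<^sub>0 \<theta>\<^sub>1)"
proof -
  define \<Omega> where "\<Omega> = polar_sector c \<theta>\<^sub>0 \<theta>\<^sub>1"
  have "continuous_on {\<theta>\<^sub>0..\<theta>\<^sub>1} (sin :: real \<Rightarrow> real)" by (intro continuous_intros)
  then obtain \<theta> where \<theta>m: "\<theta> \<in> {\<theta>\<^sub>0..\<theta>\<^sub>1}" "\<And>t. t \<in> {\<theta>\<^sub>0..\<theta>\<^sub>1} \<Longrightarrow> sin \<theta> \<le> sin t"
    using continuous_attains_inf [of "{\<theta>\<^sub>0..\<theta>\<^sub>1}" "sin :: real \<Rightarrow> real"] \<theta> by auto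
  define \<eta> where "\<eta> = sin \<theta>"
  have \<eta>: "\<eta> > 0" using \<theta>m \<theta> by (auto simp: \<eta>_def intro!: sin_gt_zero)
  have \<Omega>: "\<eta> \<le> z $ 2 \<and> norm z \<le> exp (pi / c)" if z\<Omega>: "z \<in> \<Omega>" for z
  proof -
    obtain r t where z: "z = vector [r * cos t, r * sin t]" "1 < r" "r < exp (pi / c)"
      "\<theta>\<^sub>0 < t" "t < \<theta>\<^sub>1"
      using z\<Omega> unfolding \<Omega>_def polar_sector_def by blast
    have "1 * \<eta> \<le> r * sin t" using z \<theta>m(2) [of t] \<eta> by (intro mult_mono) (auto simp: \<eta>_def)
    moreover have "norm z = sqrt ((r * cos t)\<^sup>2 + (r * sin t)\<^sup>2)"
      by (simp add: z(1) norm_vec_def L2_set_def sum_2)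
    moreover have "(r * cos t)\<^sup>2 + (r * sin t)\<^sup>2 = r\<^sup>2 * ((cos t)\<^sup>2 + (sin t)\<^sup>2)"
      unfolding power_mult_distrib by (simp only: distrib_left)
    ultimately show ?thesis using z by simp
  qed
  have hp: "z \<in> half_plane" if "z \<in> \<Omega>" for z
    using \<Omega> [OF that] \<eta> by (simp add: half_plane_def)
  have ub: "hyp_dist x y \<le> 2 * exp (pi / c) / \<eta>" if "x \<in> \<Omega>" "y \<in> \<Omega>" for x y
  proof -
    have "norm (y - x) \<le> 2 * exp (pi / c)"
      using \<Omega> [OF that(1)] \<Omega> [OF that(2)] norm_triangle_ineq4 [of y x] by simp
    then have "norm (y - x) / min (x $ 2) (y $ 2) \<le> 2 * exp (pi / c) / \<eta>"
      using \<Omega> [OF that(1)] \<Omega> [OF that(2)] \<eta> by (intro frac_le) auto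
    with hyp_dist_bounds(2) [OF hp [OF that(1)] hp [OF that(2)]] show ?thesis by simp
  qed
  have "hyp_dist p q \<le> hyp_diameter \<Omega>"
    unfolding hyp_diameter_def using p q ub
    by (intro cSup_upper) (auto simp: \<Omega>_def [symmetric] bdd_above_def)
  moreover have "arcosh (cosh_hyp_dist p q) \<le> hyp_dist p q"
    using p q by (intro hyp_dist_bounds hp) (auto simp: \<Omega>_def)
  ultimately show ?thesis by (simp add: \<Omega>_def)
qed

text \<open>The two points with polar coordinates (1, \<theta>) and (exp (pi / c), pi / 2) lie on
  the boundary of the open sector. They are approached from inside by \<open>p s\<close> and
  \<open>q s\<close>, and the bound survives the limit because arcosh is continuous at the limiting
  value, which exceeds 1.\<close>

lemma cosh_le_polar_sector_diameter:
  assumes "0 < c" and \<theta>: "0 < \<theta>\<^sub>0" "\<theta>\<^sub>0 < pi / 2" "pi / 2 < \<theta>\<^sub>1" "\<theta>\<^sub>1 < pi"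
    and \<theta>: "\<theta> \<in> {\<theta>\<^sub>0, \<theta>\<^sub>1}"
  shows "arcosh (cosh (pi / c) / sin \<theta>) \<le> hyp_diameter (polar_sector c \<theta>\<^sub>0 \<theta>\<^sub>1)"
proof -
  define E where "E = exp (pi / c)"
  \<comment> \<open>The direction of angle that leads from the chosen edge into the sector.\<close>
  define \<sigma> :: real where "\<sigma> = (if \<theta> = \<theta>\<^sub>0 then 1 else - 1)"
  define p :: "real \<Rightarrow> plane" where
    "p = (\<lambda>s. vector [(1 + s) * cos (\<theta> + \<sigma> * s), (1 + s) * sin (\<theta> + \<sigma> * s)])"
  define q :: "real \<Rightarrow> plane" where
    "q = (\<lambda>s. vector [(E - s) * cos (pi / 2), (E - s) * sin (pi / 2)])"
  have E: "E > 1" using \<open>0 < c\<close> by (simp add: E_def)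
  have s\<theta>: "sin \<theta> > 0" using assms by (auto intro!: sin_gt_zero)
  have "\<forall>\<^sub>F s in at_right 0. 0 < s \<and> s < E - 1 \<and> s < \<theta>\<^sub>1 - \<theta>\<^sub>0"
    using E assms by (intro eventually_at_rightI [of 0 "min (E - 1) (\<theta>\<^sub>1 - \<theta>\<^sub>0)"]) auto
  then have ev: "\<forall>\<^sub>F s in at_right 0.
      arcosh (cosh_hyp_dist (p s) (q s)) \<le> hyp_diameter (polar_sector c \<theta>\<^sub>0 \<theta>\<^sub>1)"
  proof (rule eventually_mono)
    fix s :: real assume s: "0 < s \<and> s < E - 1 \<and> s < \<theta>\<^sub>1 - \<theta>\<^sub>0"
    then have "\<theta>\<^sub>0 < \<theta> + \<sigma> * s" "\<theta> + \<sigma> * s < \<theta>\<^sub>1" using \<theta> by (auto simp: \<sigma>_def)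
    then have "p s \<in> polar_sector c \<theta>\<^sub>0 \<theta>\<^sub>1"
      unfolding polar_sector_def p_def
      by (intro CollectI exI [of _ "1 + s"] exI [of _ "\<theta> + \<sigma> * s"]) (use s in \<open>auto simp: E_def\<close>)
    moreover have "q s \<in> polar_sector c \<theta>\<^sub>0 \<theta>\<^sub>1"
      unfolding polar_sector_def q_def
      by (rule CollectI, rule exI [of _ "E - s"], rule exI [of _ "pi / 2"])
        (use s assms in \<open>auto simp: E_def\<close>)
    ultimately show "arcosh (cosh_hyp_dist (p s) (q s)) \<le> hyp_diameter (polar_sector c \<theta>\<^sub>0 \<theta>\<^sub>1)"
      using assms by (intro polar_sector_diameter_ge) auto
  qed
  have "(p 0) $ 2 * (q 0) $ 2 \<noteq> 0" using s\<theta> E by (simp add: p_def q_def)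
  then have "((\<lambda>s. cosh_hyp_dist (p s) (q s)) \<longlongrightarrow> cosh_hyp_dist (p 0) (q 0)) (at_right 0)"
    unfolding cosh_hyp_dist_def p_def q_def
    by (auto intro!: tendsto_eq_intros)
  also have "cosh_hyp_dist (p 0) (q 0) = cosh (pi / c) / sin \<theta>"
  proof -
    have "cosh_hyp_dist (p 0) (q 0)
        = 1 + ((cos \<theta>)\<^sup>2 + (E - sin \<theta>)\<^sup>2) / (2 * sin \<theta> * E)"
      by (simp add: cosh_hyp_dist_def p_def q_def)
    also have "(cos \<theta>)\<^sup>2 + (E - sin \<theta>)\<^sup>2 = 1 + E\<^sup>2 - 2 * E * sin \<theta>"
      by (simp add: cos_squared_eq power2_eq_square algebra_simps)
    also have "1 + (1 + E\<^sup>2 - 2 * E * sin \<theta>) / (2 * sin \<theta> * E) = ((E + 1 / E) / 2) / sin \<theta>"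
      using s\<theta> E by (simp add: field_simps power2_eq_square)
    also have "(E + 1 / E) / 2 = cosh (pi / c)"
      by (simp add: E_def cosh_field_def exp_minus inverse_eq_divide)
    finally show ?thesis .
  qed
  finally have lim: "((\<lambda>s. cosh_hyp_dist (p s) (q s)) \<longlongrightarrow> cosh (pi / c) / sin \<theta>) (at_right 0)" .
  have "1 < cosh (pi / c)" using \<open>0 < c\<close> cosh_real_strict_mono [of 0 "pi / c"] by simp
  also have "cosh (pi / c) * sin \<theta> \<le> cosh (pi / c)" by (simp add: mult_left_le)
  then have "cosh (pi / c) \<le> cosh (pi / c) / sin \<theta>" using s\<theta> by (simp add: field_simps)
  finally have gt: "1 < cosh (pi / c) / sin \<theta>" .
  have "((\<lambda>s. arcosh (cosh_hyp_dist (p s) (q s))) \<longlongrightarrow> arcosh (cosh (pi / c) / sin \<theta>)) (at_right 0)"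
    using gt by (intro tendsto_arcosh lim)
  then show ?thesis
    by (rule tendsto_upperbound [OF _ ev]) simp
qed

text \<open>The two sides agree at \<open>k = 1\<close>, so the derivatives at that point decide.
  The factor \<open>k\<close> will be 1 / cos m.\<close>

lemma cosh_scale_less:
  fixes L :: real
  assumes "0 < L" "L < 1"
  shows "\<forall>\<^sub>F k in at_right 1. cosh (k * L) < k * cosh L"
proof -
  define f where "f = (\<lambda>k. k * cosh L - cosh (k * L))"
  have "(f has_field_derivative cosh L - L * sinh L) (at 1)"
    unfolding f_def by (auto intro!: derivative_eq_intros)
  moreover have "L * sinh L < 1 * cosh L"
    using assms sinh_less_cosh_real [of L] by (intro mult_strict_mono) auto
  ultimately obtain d where d: "d > 0" "\<And>h. h > 0 \<Longrightarrow> h < d \<Longrightarrow> f 1 < f (1 + h)"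
    using DERIV_pos_inc_right [of f "cosh L - L * sinh L" 1] by auto
  have "cosh (k * L) < k * cosh L" if "1 < k" "k < 1 + d" for k
    using d(2) [of "k - 1"] that by (simp add: f_def)
  then show ?thesis
    using d(1) by (intro eventually_at_rightI [of 1 "1 + d"]) auto
qed

section \<open>Ground states by the Pruefer transformation\<close>

lemma integral_has_real_derivative_interior:
  fixes g :: "real \<Rightarrow> real"
  assumes "continuous_on {a..b} g" "t \<in> {a<..<b}"
  shows "((\<lambda>x. integral {a..x} g) has_field_derivative g t) (at t)"
proof -
  have "((\<lambda>x. integral {a..x} g) has_field_derivative g t) (at t within {a..b})"
    using assms by (intro integral_has_real_derivative) auto
  moreover have "at t within {a..b} = at t"
    using assms by (intro at_within_interior) (auto simp: interior_atLeastAtMost_real)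
  ultimately show ?thesis by simp
qed

text \<open>The phase equation below depends on the phase only through its squared sine; this is its
  Lipschitz constant.\<close>

lemma sin_squared_lipschitz: "\<bar>(sin x)\<^sup>2 - (sin y)\<^sup>2\<bar> \<le> \<bar>x - y\<bar>" for x y :: real
proof -
  have "(sin x)\<^sup>2 - (sin y)\<^sup>2 = sin (x - y) * sin (x + y)"
  proof -
    have "sin (x - y) * sin (x + y) = (sin x)\<^sup>2 * (cos y)\<^sup>2 - (cos x)\<^sup>2 * (sin y)\<^sup>2"
      by (simp add: sin_add sin_diff power2_eq_square algebra_simps)
    then show ?thesis by (simp add: cos_squared_eq algebra_simps)
  qed
  then have "\<bar>(sin x)\<^sup>2 - (sin y)\<^sup>2\<bar> = \<bar>sin (x - y)\<bar> * \<bar>sin (x + y)\<bar>"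
    by (simp add: abs_mult)
  also have "\<dots> \<le> \<bar>x - y\<bar> * 1"
    by (intro mult_mono abs_sin_x_le_abs_x abs_sin_le_one) auto
  finally show ?thesis by simp
qed

text \<open>Writing \<phi> = R sin \<alpha> and \<phi>' = \<kappa> R cos \<alpha>, the equation
  \<phi>'' + \<kappa> (k + \<kappa>) \<phi> = 0 becomes \<alpha>' = \<kappa> + k (sin \<alpha>)^2
  for the phase; this is its integral form with \<alpha> = 0 at \<open>a\<close>. Here
  \<open>k\<close> measures the deviation from the constant potential \<kappa>^2, for which the
  phase is linear and, with \<kappa> = pi / (b - a), reaches pi exactly at \<open>b\<close>.\<close>

definition pruefer_solution :: "real \<Rightarrow> real \<Rightarrow> real \<Rightarrow> (real \<Rightarrow> real) \<Rightarrow> (real \<Rightarrow> real) \<Rightarrow> bool" where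
  "pruefer_solution a b \<kappa> k \<alpha> \<longleftrightarrow> continuous_on {a..b} \<alpha> \<and>
     (\<forall>t\<in>{a..b}. \<alpha> t = \<kappa> * (t - a) + integral {a..t} (\<lambda>s. k s * (sin (\<alpha> s))\<^sup>2))"

lemma integral_abs_bound:
  fixes f :: "real \<Rightarrow> real"
  assumes "continuous_on {a..b} f" "t \<in> {a..b}" "\<And>s. s \<in> {a..b} \<Longrightarrow> \<bar>f s\<bar> \<le> B"
  shows "\<bar>integral {a..t} f\<bar> \<le> B * (b - a)"
proof -
  have "a \<in> {a..b}" using assms(2) by auto
  from assms(3) [OF this] have "0 \<le> B" by simp
  have "\<bar>integral {a..t} f\<bar> \<le> B * (t - a)"
    using assms(2) integral_bound [of a t f B] assms(3) continuous_on_subset [OF assms(1), of "{a..t}"]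
    by auto
  also have "\<dots> \<le> B * (b - a)" using \<open>0 \<le> B\<close> assms by (intro mult_left_mono) auto
  finally show ?thesis .
qed

text \<open>Banach's fixed point theorem in the complete space
  \<open>real \<Rightarrow>\<^sub>C real\<close>; \<open>clamp\<close> extends the Picard operator
  from the interval to the line by constants. Smallness of \<open>k\<close> makes it a contraction
  with factor 1/2 on the whole interval at once.\<close>

lemma pruefer_solution_exists:
  fixes k :: "real \<Rightarrow> real"
  assumes "a < b" and k: "continuous_on {a..b} k"
    and small: "\<And>s. s \<in> {a..b} \<Longrightarrow> \<bar>k s\<bar> * (b - a) \<le> 1 / 2"
  shows "\<exists>\<alpha>. pruefer_solution a b \<kappa> k \<alpha>"
proof -
  define g where "g = (\<lambda>(f :: real \<Rightarrow>\<^sub>C real) t.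
      \<kappa> * (t - a) + integral {a..t} (\<lambda>s. k s * (sin (f s))\<^sup>2))"
  have cf: "continuous_on S (apply_bcontfun f)" for S and f :: "real \<Rightarrow>\<^sub>C real"
    by (metis continuous_on_apply_bcontfun continuous_on_subset subset_UNIV)
  have ci: "continuous_on {a..b} (\<lambda>s. k s * (sin (f s))\<^sup>2)" for f :: "real \<Rightarrow>\<^sub>C real"
    by (intro continuous_intros k cf)
  have cg: "continuous_on {a..b} (g f)" for f
    unfolding g_def
    by (intro continuous_intros indefinite_integral_continuous_1 integrable_continuous_real ci)
  have "\<exists>T :: real \<Rightarrow>\<^sub>C real. \<forall>x. T x = g f (clamp a b x)" for f
    by (rule continuous_on_cbox_bcontfunE [of a b "g f"]) (use cg in auto)
  then obtain T :: "(real \<Rightarrow>\<^sub>C real) \<Rightarrow> (real \<Rightarrow>\<^sub>C real)"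
    where T: "\<And>f x. T f x = g f (clamp a b x)" by metis
  have lip: "dist (T f1) (T f2) \<le> 1 / 2 * dist f1 f2" for f1 f2
  proof (rule dist_bound)
    fix x
    define t where "t = clamp a b x"
    have t: "t \<in> {a..b}" using clamp_in_interval [of a b x] \<open>a < b\<close> by (simp add: t_def)
    have int: "(\<lambda>s. k s * (sin (f s))\<^sup>2) integrable_on {a..t}" for f :: "real \<Rightarrow>\<^sub>C real"
      using t by (intro integrable_continuous_real continuous_on_subset [OF ci]) auto
    have "T f1 x - T f2 x = integral {a..t} (\<lambda>s. k s * (sin (f1 s))\<^sup>2 - k s * (sin (f2 s))\<^sup>2)"
      using int by (simp add: T g_def t_def [symmetric] integral_diff)
    moreover have "\<bar>integral {a..t} (\<lambda>s. k s * (sin (f1 s))\<^sup>2 - k s * (sin (f2 s))\<^sup>2)\<bar>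
        \<le> (1 / 2 * dist f1 f2 / (b - a)) * (b - a)"
    proof (rule integral_abs_bound [OF _ t])
      show "continuous_on {a..b} (\<lambda>s. k s * (sin (f1 s))\<^sup>2 - k s * (sin (f2 s))\<^sup>2)"
        by (intro continuous_intros k cf)
      fix s assume s: "s \<in> {a..b}"
      have "\<bar>k s * (sin (f1 s))\<^sup>2 - k s * (sin (f2 s))\<^sup>2\<bar> = \<bar>k s\<bar> * \<bar>(sin (f1 s))\<^sup>2 - (sin (f2 s))\<^sup>2\<bar>"
        by (simp add: abs_mult [symmetric] right_diff_distrib)
      also have "\<dots> \<le> (1 / 2 / (b - a)) * dist f1 f2"
        using small [OF s] \<open>a < b\<close>
        by (intro mult_mono order_trans [OF sin_squared_lipschitz]
            order_trans [OF _ dist_bounded [of f1 s f2]])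
          (auto simp: field_simps dist_real_def)
      finally show "\<bar>k s * (sin (f1 s))\<^sup>2 - k s * (sin (f2 s))\<^sup>2\<bar> \<le> 1 / 2 * dist f1 f2 / (b - a)"
        by simp
    qed
    moreover have "(1 / 2 * dist f1 f2 / (b - a)) * (b - a) = 1 / 2 * dist f1 f2"
      using \<open>a < b\<close> by (intro nonzero_eq_divide_eq [THEN iffD1] refl) simp
    ultimately show "dist (T f1 x) (T f2 x) \<le> 1 / 2 * dist f1 f2"
      by (simp only: dist_real_def)
  qed
  then obtain f where f: "T f = f"
    using banach_fix_type [of "1 / 2" T] by auto
  have "f t = g f t" if "t \<in> {a..b}" for t
    using T [of f t] that by (simp add: f)
  then show ?thesis
    unfolding pruefer_solution_def g_def using cf by blast
qed

text \<open>Compare the integral equations at a point where the phases differ most, by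
  \<open>D\<close> say. The change of phase contributes at most \<open>D / 2\<close> and the change
  of the coefficient at most \<open>e\<close>, so \<open>D \<le> D / 2 + e\<close>. This will make
  the final phase continuous in the eigenvalue parameter.\<close>

lemma pruefer_solution_dependence:
  fixes k1 k2 :: "real \<Rightarrow> real"
  assumes "a < b" and k: "continuous_on {a..b} k1" "continuous_on {a..b} k2"
    and small: "\<And>s. s \<in> {a..b} \<Longrightarrow> \<bar>k1 s\<bar> * (b - a) \<le> 1 / 2"
    and diff: "\<And>s. s \<in> {a..b} \<Longrightarrow> \<bar>k1 s - k2 s\<bar> * (b - a) \<le> e"
    and \<alpha>: "pruefer_solution a b \<kappa> k1 \<alpha>" and \<beta>: "pruefer_solution a b \<kappa> k2 \<beta>"
    and t: "t \<in> {a..b}"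
  shows "\<bar>\<alpha> t - \<beta> t\<bar> \<le> 2 * e"
proof -
  have c: "continuous_on {a..b} \<alpha>" "continuous_on {a..b} \<beta>"
    using \<alpha> \<beta> by (auto simp: pruefer_solution_def)
  have "continuous_on {a..b} (\<lambda>s. \<bar>\<alpha> s - \<beta> s\<bar>)" by (intro continuous_intros c)
  then obtain z where z: "z \<in> {a..b}" "\<And>s. s \<in> {a..b} \<Longrightarrow> \<bar>\<alpha> s - \<beta> s\<bar> \<le> \<bar>\<alpha> z - \<beta> z\<bar>"
    using continuous_attains_sup [of "{a..b}" "\<lambda>s. \<bar>\<alpha> s - \<beta> s\<bar>"] \<open>a < b\<close> by auto
  define D where "D = \<bar>\<alpha> z - \<beta> z\<bar>"
  have int: "(\<lambda>s. k1 s * (sin (\<alpha> s))\<^sup>2) integrable_on {a..z}"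
    "(\<lambda>s. k2 s * (sin (\<beta> s))\<^sup>2) integrable_on {a..z}"
    using z(1) k c
    by (auto intro!: integrable_continuous_real continuous_intros elim!: continuous_on_subset)
  have "\<alpha> z - \<beta> z = integral {a..z} (\<lambda>s. k1 s * (sin (\<alpha> s))\<^sup>2 - k2 s * (sin (\<beta> s))\<^sup>2)"
    using \<alpha> \<beta> z(1) int by (auto simp: pruefer_solution_def integral_diff)
  moreover have "\<bar>integral {a..z} (\<lambda>s. k1 s * (sin (\<alpha> s))\<^sup>2 - k2 s * (sin (\<beta> s))\<^sup>2)\<bar>
      \<le> ((D / 2 + e) / (b - a)) * (b - a)"
  proof (rule integral_abs_bound [OF _ z(1)])
    show "continuous_on {a..b} (\<lambda>s. k1 s * (sin (\<alpha> s))\<^sup>2 - k2 s * (sin (\<beta> s))\<^sup>2)"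
      by (intro continuous_intros k c)
    fix s assume s: "s \<in> {a..b}"
    have "k1 s * (sin (\<alpha> s))\<^sup>2 - k2 s * (sin (\<beta> s))\<^sup>2
        = k1 s * ((sin (\<alpha> s))\<^sup>2 - (sin (\<beta> s))\<^sup>2) + (k1 s - k2 s) * (sin (\<beta> s))\<^sup>2"
      by (simp add: algebra_simps)
    also have "\<bar>\<dots>\<bar> \<le> \<bar>k1 s\<bar> * \<bar>(sin (\<alpha> s))\<^sup>2 - (sin (\<beta> s))\<^sup>2\<bar> + \<bar>k1 s - k2 s\<bar> * (sin (\<beta> s))\<^sup>2"
      by (rule order_trans [OF abs_triangle_ineq]) (simp add: abs_mult)
    also have "\<dots> \<le> (1 / 2 / (b - a)) * D + (e / (b - a)) * 1"
    proof (intro add_mono mult_mono)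
      show "\<bar>(sin (\<alpha> s))\<^sup>2 - (sin (\<beta> s))\<^sup>2\<bar> \<le> D"
        using sin_squared_lipschitz [of "\<alpha> s" "\<beta> s"] z(2) [OF s] by (simp add: D_def)
      show "(sin (\<beta> s))\<^sup>2 \<le> 1" by (simp add: abs_square_le_1)
      have "0 \<le> \<bar>k1 s - k2 s\<bar> * (b - a)" using \<open>a < b\<close> by simp
      then have "0 \<le> e" using diff [OF s] by linarith
      then show "0 \<le> e / (b - a)" using \<open>a < b\<close> by simp
    qed (use small [OF s] diff [OF s] \<open>a < b\<close> in \<open>auto simp: field_simps\<close>)
    also have "\<dots> = (D / 2 + e) / (b - a)" by (simp add: add_divide_distrib)
    finally show "\<bar>k1 s * (sin (\<alpha> s))\<^sup>2 - k2 s * (sin (\<beta> s))\<^sup>2\<bar> \<le> (D / 2 + e) / (b - a)" .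
  qed
  ultimately have "D \<le> D / 2 + e" using \<open>a < b\<close> by (simp add: D_def)
  then show ?thesis using z(2) [OF t] by (simp add: D_def)
qed

text \<open>The amplitude is recovered from its logarithmic derivative
  \<open>- k * sin \<alpha> * cos \<alpha>\<close>, which is what makes the derivative of
  \<open>R * sin \<alpha>\<close> equal to \<open>\<kappa> * R * cos \<alpha>\<close>. Since |k| (b
  - a) is at most 1/2 < pi, the phase has positive derivative; it increases strictly from 0 to pi,
  and its sine is positive in between.\<close>

lemma pruefer_solution_positive:
  fixes k :: "real \<Rightarrow> real"
  assumes "a < b" and k: "continuous_on {a..b} k"
    and small: "\<And>s. s \<in> {a..b} \<Longrightarrow> \<bar>k s\<bar> * (b - a) \<le> 1 / 2"
    and \<alpha>: "pruefer_solution a b (pi / (b - a)) k \<alpha>" and "\<alpha> b = pi"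
  shows "\<exists>\<phi>. dirichlet_solution a b (\<lambda>t. pi / (b - a) * (k t + pi / (b - a))) \<phi> \<and>
    (\<forall>t\<in>{a<..<b}. 0 < \<phi> t)"
proof -
  define \<kappa> where "\<kappa> = pi / (b - a)"
  have c: "continuous_on {a..b} \<alpha>"
    and \<alpha>_eq: "\<And>t. t \<in> {a..b} \<Longrightarrow>
      \<alpha> t = \<kappa> * (t - a) + integral {a..t} (\<lambda>s. k s * (sin (\<alpha> s))\<^sup>2)"
    using \<alpha> by (auto simp: pruefer_solution_def \<kappa>_def)
  have ck: "continuous_on {a..b} (\<lambda>s. k s * (sin (\<alpha> s))\<^sup>2)"
    by (intro continuous_intros k c)
  have d\<alpha>: "(\<alpha> has_field_derivative \<kappa> + k t * (sin (\<alpha> t))\<^sup>2) (at t)" if t: "t \<in> {a<..<b}" for t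
  proof -
    have "((\<lambda>t. \<kappa> * (t - a) + integral {a..t} (\<lambda>s. k s * (sin (\<alpha> s))\<^sup>2))
        has_field_derivative \<kappa> + k t * (sin (\<alpha> t))\<^sup>2) (at t)"
      by (auto intro!: derivative_eq_intros integral_has_real_derivative_interior [OF ck t])
    then show ?thesis
      by (rule has_field_derivative_transform_within_open [where S = "{a<..<b}"])
        (use t \<alpha>_eq in auto)
  qed
  have pos: "0 < \<kappa> + k t * (sin (\<alpha> t))\<^sup>2" if t: "t \<in> {a..b}" for t
  proof -
    have "\<bar>k t * (sin (\<alpha> t))\<^sup>2\<bar> \<le> \<bar>k t\<bar> * 1"
      unfolding abs_mult by (intro mult_left_mono) (auto simp: abs_square_le_1)
    also have "\<dots> < \<kappa>"
      using small [OF t] \<open>a < b\<close> pi_gt3 by (simp add: \<kappa>_def field_simps)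
    finally show ?thesis by linarith
  qed
  have mono: "\<alpha> s < \<alpha> t" if "a \<le> s" "s < t" "t \<le> b" for s t
  proof (rule DERIV_pos_imp_increasing_open [OF \<open>s < t\<close>])
    show "\<exists>y. (\<alpha> has_field_derivative y) (at x) \<and> 0 < y" if "s < x" "x < t" for x
      using d\<alpha> [of x] pos [of x] that \<open>a \<le> s\<close> \<open>t \<le> b\<close> by auto
    show "continuous_on {s..t} \<alpha>"
      using that by (intro continuous_on_subset [OF c]) auto
  qed
  have \<alpha>a: "\<alpha> a = 0" using \<alpha>_eq [of a] \<open>a < b\<close> by simp
  define r where "r = (\<lambda>s. - k s * sin (\<alpha> s) * cos (\<alpha> s))"
  have cr: "continuous_on {a..b} r" unfolding r_def by (intro continuous_intros k c)
  define R where "R = (\<lambda>t. exp (integral {a..t} r))"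
  have dR: "(R has_field_derivative R t * r t) (at t)" if t: "t \<in> {a<..<b}" for t
    unfolding R_def
    by (auto intro!: derivative_eq_intros integral_has_real_derivative_interior [OF cr t])
  define \<phi> where "\<phi> = (\<lambda>t. R t * sin (\<alpha> t))"
  have "dirichlet_solution a b (\<lambda>t. \<kappa> * (k t + \<kappa>)) \<phi>"
    unfolding dirichlet_solution_def
  proof (intro conjI exI ballI)
    show "continuous_on {a..b} \<phi>" unfolding \<phi>_def R_def
      by (intro continuous_intros c indefinite_integral_continuous_1 integrable_continuous_real cr)
    show "\<phi> a = 0" "\<phi> b = 0" by (simp_all add: \<phi>_def \<alpha>a \<open>\<alpha> b = pi\<close>)
    fix t assume t: "t \<in> {a<..<b}"
    have "R t * r t * sin (\<alpha> t) + cos (\<alpha> t) * (\<kappa> + k t * (sin (\<alpha> t))\<^sup>2) * R t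
        = R t * \<kappa> * cos (\<alpha> t)"
      by (simp add: r_def algebra_simps power2_eq_square)
    moreover have "(\<phi> has_field_derivative
        R t * r t * sin (\<alpha> t) + cos (\<alpha> t) * (\<kappa> + k t * (sin (\<alpha> t))\<^sup>2) * R t) (at t)"
      unfolding \<phi>_def by (auto intro!: derivative_eq_intros dR [OF t] d\<alpha> [OF t])
    ultimately show "(\<phi> has_field_derivative R t * \<kappa> * cos (\<alpha> t)) (at t)" by simp
    have "R t * r t * \<kappa> * cos (\<alpha> t) - sin (\<alpha> t) * (\<kappa> + k t * (sin (\<alpha> t))\<^sup>2) * (R t * \<kappa>)
        = - \<kappa> * R t * sin (\<alpha> t) * (k t * ((cos (\<alpha> t))\<^sup>2 + (sin (\<alpha> t))\<^sup>2) + \<kappa>)"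
      unfolding r_def by algebra
    also have "\<dots> = - (\<kappa> * (k t + \<kappa>)) * \<phi> t" by (simp add: \<phi>_def)
    finally show "((\<lambda>t. R t * \<kappa> * cos (\<alpha> t)) has_field_derivative - (\<kappa> * (k t + \<kappa>)) * \<phi> t) (at t)"
      by (auto intro!: derivative_eq_intros dR [OF t] d\<alpha> [OF t])
  qed
  moreover have "0 < \<phi> t" if "t \<in> {a<..<b}" for t
    using mono [of a t] mono [of t b] that \<alpha>a \<open>\<alpha> b = pi\<close>
    by (auto simp: \<phi>_def R_def intro!: mult_pos_pos sin_gt_zero)
  ultimately show ?thesis unfolding \<kappa>_def by blast
qed

text \<open>Shooting in \<mu>. With \<open>K = \<kappa>\<^sup>2 + A\<close> and
  \<open>k = (\<mu> * w - K) / \<kappa>\<close>, the potential \<kappa> (k + \<kappa>) is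
  \<open>\<mu> * w - A\<close>. At \<open>\<mu> = K\<close> the bound \<open>1 \<le> w\<close> makes
  \<open>k\<close> nonnegative and the final phase at least pi; at \<open>\<mu> = C * K\<close> the
  bound \<open>w \<le> 1 / C\<close> makes \<open>k\<close> nonpositive and the final phase at most
  pi. In between, \<open>k\<close> stays within the smallness bound, and the intermediate value
  theorem supplies a \<mu> with final phase exactly pi.\<close>

lemma dirichlet_ground_state_exists:
  fixes w :: "real \<Rightarrow> real"
  assumes "a < b" and w: "continuous_on {a..b} w" and "0 < C" "0 \<le> A"
    and wb: "\<And>t. t \<in> {a..b} \<Longrightarrow> 1 \<le> w t \<and> w t \<le> 1 / C"
    and \<kappa>: "\<kappa> = pi / (b - a)"
    and small: "(\<kappa>\<^sup>2 + A) * (1 / C - 1) * (b - a) / \<kappa> \<le> 1 / 2"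
  shows "\<exists>\<mu> \<phi>. \<mu> \<le> \<kappa>\<^sup>2 + A \<and> dirichlet_solution a b (\<lambda>t. \<mu> * w t - A) \<phi> \<and> (\<forall>t\<in>{a<..<b}. 0 < \<phi> t)"
proof -
  define K where "K = \<kappa>\<^sup>2 + A"
  have \<kappa>0: "\<kappa> > 0" using \<open>a < b\<close> by (simp add: \<kappa>)
  then have K: "K > 0" using \<open>0 \<le> A\<close> by (simp add: K_def add_pos_nonneg)
  have I0: "0 \<le> \<mu>" if "C * K \<le> \<mu>" for \<mu>
    using mult_pos_pos [OF \<open>0 < C\<close> K] that by linarith
  have "1 \<le> 1 / C" using wb [of a] \<open>a < b\<close> by auto
  then have C: "C \<le> 1" using \<open>0 < C\<close> by (simp add: field_simps)
  define k where "k = (\<lambda>\<mu> t. (\<mu> * w t - K) / \<kappa>)"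
  define I where "I = {C * K..K}"
  have ck: "continuous_on {a..b} (k \<mu>)" for \<mu>
    unfolding k_def using \<kappa>0 by (intro continuous_intros w) auto
  have sk: "\<bar>k \<mu> s\<bar> * (b - a) \<le> 1 / 2" if \<mu>: "\<mu> \<in> I" and s: "s \<in> {a..b}" for \<mu> s
  proof -
    have "C * K * 1 \<le> \<mu> * w s"
      using \<mu> wb [OF s] K \<open>0 < C\<close> I0 by (intro mult_mono) (auto simp: I_def)
    moreover have "\<mu> * w s \<le> K * (1 / C)"
      using \<mu> wb [OF s] K \<open>0 < C\<close> I0 by (intro mult_mono) (auto simp: I_def)
    \<comment> \<open>\<open>\<mu> * w\<close> can fall below \<open>K\<close> by
      \<open>K * (1 - C)\<close> and exceed it by \<open>K * (1 / C - 1)\<close>; the second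
      deviation dominates.\<close>
    moreover have "K * (1 - C) \<le> K * (1 / C - 1)"
    proof (intro mult_left_mono)
      have "0 \<le> (1 - C)\<^sup>2 / C" using \<open>0 < C\<close> by simp
      then show "1 - C \<le> 1 / C - 1" using \<open>0 < C\<close> by (simp add: field_simps power2_eq_square)
    qed (use K in auto)
    ultimately have "\<bar>\<mu> * w s - K\<bar> \<le> K * (1 / C - 1)"
      by (intro abs_leI) (auto simp: algebra_simps)
    then have "\<bar>\<mu> * w s - K\<bar> * (b - a) / \<kappa> \<le> K * (1 / C - 1) * (b - a) / \<kappa>"
      using \<kappa>0 \<open>a < b\<close> by (intro divide_right_mono mult_right_mono) auto
    moreover have "\<bar>k \<mu> s\<bar> * (b - a) = \<bar>\<mu> * w s - K\<bar> * (b - a) / \<kappa>"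
      using \<kappa>0 by (simp add: k_def)
    ultimately show ?thesis using small unfolding K_def [symmetric] by linarith
  qed
  have "\<exists>\<alpha>. pruefer_solution a b \<kappa> (k \<mu>) \<alpha>" if "\<mu> \<in> I" for \<mu>
    by (rule pruefer_solution_exists [OF \<open>a < b\<close> ck sk [OF that]])
  then obtain \<alpha> where \<alpha>: "\<And>\<mu>. \<mu> \<in> I \<Longrightarrow> pruefer_solution a b \<kappa> (k \<mu>) (\<alpha> \<mu>)" by metis
  define M where "M = 2 * ((b - a) / (C * \<kappa>))"
  have lip: "\<bar>\<alpha> \<mu> b - \<alpha> \<nu> b\<bar> \<le> M * \<bar>\<mu> - \<nu>\<bar>" if "\<mu> \<in> I" "\<nu> \<in> I" for \<mu> \<nu>
  proof -
    have "\<bar>\<alpha> \<mu> b - \<alpha> \<nu> b\<bar> \<le> 2 * ((b - a) / (C * \<kappa>) * \<bar>\<mu> - \<nu>\<bar>)"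
    proof (rule pruefer_solution_dependence [OF \<open>a < b\<close> ck ck sk [OF that(1)] _ \<alpha> [OF that(1)] \<alpha> [OF that(2)]])
      fix s assume s: "s \<in> {a..b}"
      have "k \<mu> s - k \<nu> s = (\<mu> - \<nu>) * w s / \<kappa>" by (simp add: k_def diff_divide_distrib algebra_simps)
      then have "\<bar>k \<mu> s - k \<nu> s\<bar> * (b - a) = \<bar>\<mu> - \<nu>\<bar> * w s * (b - a) / \<kappa>"
        using wb [OF s] \<kappa>0 by (simp add: abs_mult)
      also have "\<dots> \<le> \<bar>\<mu> - \<nu>\<bar> * (1 / C) * (b - a) / \<kappa>"
        using wb [OF s] \<kappa>0 \<open>a < b\<close>
        by (intro divide_right_mono mult_right_mono mult_left_mono) auto
      also have "\<dots> = (b - a) / (C * \<kappa>) * \<bar>\<mu> - \<nu>\<bar>" by simp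
      finally show "\<bar>k \<mu> s - k \<nu> s\<bar> * (b - a) \<le> (b - a) / (C * \<kappa>) * \<bar>\<mu> - \<nu>\<bar>" .
    qed (use \<open>a < b\<close> in auto)
    then show ?thesis by (simp only: M_def mult.assoc)
  qed
  have "M-lipschitz_on I (\<lambda>\<mu>. \<alpha> \<mu> b)"
    using \<kappa>0 \<open>0 < C\<close> \<open>a < b\<close> lip by (intro lipschitz_onI) (auto simp: M_def dist_real_def)
  then have cont: "continuous_on I (\<lambda>\<mu>. \<alpha> \<mu> b)" by (rule lipschitz_on_continuous_on)
  have eq: "\<alpha> \<mu> b = pi + integral {a..b} (\<lambda>s. k \<mu> s * (sin (\<alpha> \<mu> s))\<^sup>2)"
    and int: "(\<lambda>s. k \<mu> s * (sin (\<alpha> \<mu> s))\<^sup>2) integrable_on {a..b}" if "\<mu> \<in> I" for \<mu>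
    using \<alpha> [OF that] \<open>a < b\<close>
    by (auto simp: pruefer_solution_def \<kappa> intro!: integrable_continuous_real continuous_intros ck)
  have I: "C * K \<in> I" "K \<in> I" "C * K \<le> K" using C K by (auto simp: I_def mult_le_cancel_right1)
  have lo: "\<alpha> (C * K) b \<le> pi"
  proof -
    have "k (C * K) s \<le> 0" if "s \<in> {a..b}" for s
      using mult_left_mono [of "w s" "1 / C" "C * K"] wb [OF that] K \<kappa>0 \<open>0 < C\<close>
      by (auto simp: k_def divide_le_0_iff)
    then have "0 \<le> integral {a..b} (\<lambda>s. - (k (C * K) s * (sin (\<alpha> (C * K) s))\<^sup>2))"
      using int [OF I(1)] by (intro integral_nonneg integrable_neg) (auto simp: mult_le_0_iff)
    then show ?thesis using eq [OF I(1)] by simp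
  qed
  have hi: "pi \<le> \<alpha> K b"
  proof -
    have "0 \<le> k K s" if "s \<in> {a..b}" for s
      using wb [OF that] K \<kappa>0 by (auto simp: k_def)
    then have "0 \<le> integral {a..b} (\<lambda>s. k K s * (sin (\<alpha> K s))\<^sup>2)"
      using int [OF I(2)] by (intro integral_nonneg) auto
    then show ?thesis using eq [OF I(2)] by simp
  qed
  obtain \<mu> where \<mu>: "\<mu> \<in> I" "\<alpha> \<mu> b = pi"
    using IVT' [of "\<lambda>\<mu>. \<alpha> \<mu> b" "C * K" pi K] lo hi I cont by (auto simp: I_def)
  obtain \<phi> where \<phi>: "dirichlet_solution a b (\<lambda>t. \<kappa> * (k \<mu> t + \<kappa>)) \<phi>" "\<forall>t\<in>{a<..<b}. 0 < \<phi> t"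
    using pruefer_solution_positive [of a b "k \<mu>" "\<alpha> \<mu>", folded \<kappa>,
        OF \<open>a < b\<close> ck sk [OF \<mu>(1)] \<alpha> [OF \<mu>(1)] \<mu>(2)] by blast
  have eq: "(\<lambda>t. \<kappa> * (k \<mu> t + \<kappa>)) = (\<lambda>t. \<mu> * w t - A)"
  proof
    fix t
    have "\<kappa> * (k \<mu> t + \<kappa>) = (\<mu> * w t - K) + \<kappa>\<^sup>2"
      using \<kappa>0 by (simp add: k_def distrib_left power2_eq_square)
    then show "\<kappa> * (k \<mu> t + \<kappa>) = \<mu> * w t - A" by (simp add: K_def)
  qed
  have "\<mu> \<le> \<kappa>\<^sup>2 + A" using \<mu>(1) by (simp add: I_def K_def)
  with \<phi> show ?thesis unfolding eq by blast
qed

section \<open>Limits of second derivatives and completeness of the sines\<close>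

text \<open>The barrier \<open>e * ((t - a) * (b - t))\<close> has second derivative
  \<open>- 2 * e\<close>, so its difference to \<open>f\<close> is strictly concave where it would
  have an interior minimum; its least value is therefore taken at an end, where it is 0.\<close>

lemma second_derivative_bound_imp_bound:
  fixes f f' f'' :: "real \<Rightarrow> real"
  assumes "a < b" "0 < e" and c: "continuous_on {a..b} f" and bnd: "f a = 0" "f b = 0"
    and D1: "\<And>t. t \<in> {a<..<b} \<Longrightarrow> (f has_field_derivative f' t) (at t)"
    and D2: "\<And>t. t \<in> {a<..<b} \<Longrightarrow> (f' has_field_derivative f'' t) (at t)"
    and le: "\<And>t. t \<in> {a<..<b} \<Longrightarrow> - e \<le> f'' t"
    and t: "t \<in> {a..b}"
  shows "f t \<le> e * (b - a)\<^sup>2"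
proof -
  define p where "p = (\<lambda>t. e * ((t - a) * (b - t)) - f t)"
  have "continuous_on {a..b} p" unfolding p_def by (intro continuous_intros c)
  then obtain z where z: "z \<in> {a..b}" "\<And>s. s \<in> {a..b} \<Longrightarrow> p z \<le> p s"
    using continuous_attains_inf [of "{a..b}" p] \<open>a < b\<close> by auto
  have "0 \<le> p z"
  proof (rule ccontr)
    assume neg: "\<not> 0 \<le> p z"
    then have "z \<noteq> a" "z \<noteq> b" using bnd by (auto simp: p_def)
    with z(1) have zi: "a < z" "z < b" by auto
    have "0 \<le> - 2 * e - f'' z"
    proof (rule local_min_second_derivative_nonneg [OF zi, of p "\<lambda>t. e * ((b - t) - (t - a)) - f' t"])
      show "(p has_field_derivative e * ((b - t) - (t - a)) - f' t) (at t)" if "a < t" "t < b" for t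
        unfolding p_def using that by (auto intro!: derivative_eq_intros D1)
      show "((\<lambda>t. e * ((b - t) - (t - a)) - f' t) has_field_derivative - 2 * e - f'' z) (at z)"
        using zi by (auto intro!: derivative_eq_intros D2)
    qed (use z in auto)
    then show False using le [of z] zi \<open>0 < e\<close> by auto
  qed
  then have "0 \<le> p t" using z(2) [OF t] by linarith
  then have "f t \<le> e * ((t - a) * (b - t))" by (simp add: p_def)
  also have "\<dots> \<le> e * ((b - a) * (b - a))"
    using t \<open>0 < e\<close> by (intro mult_left_mono mult_mono) auto
  finally show ?thesis by (simp add: power2_eq_square)
qed

text \<open>Nothing is assumed about convergence of the first derivatives. Let \<open>H\<close> be a
  double primitive of \<open>G\<close>. Subtracting from \<open>f n - H\<close> the chord through
  its end values leaves a function that vanishes at both ends and has second derivative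
  \<open>f'' n - G\<close>, so it tends to 0 by the barrier bound. Hence \<open>F\<close> is
  \<open>H\<close> plus a linear function.\<close>

lemma second_derivative_of_limit:
  fixes F G :: "real \<Rightarrow> real" and f f' f'' :: "nat \<Rightarrow> real \<Rightarrow> real"
  assumes "a < b" and G: "continuous_on {a..b} G"
    and c: "\<And>n. continuous_on {a..b} (f n)"
    and D1: "\<And>n t. t \<in> {a<..<b} \<Longrightarrow> (f n has_field_derivative f' n t) (at t)"
    and D2: "\<And>n t. t \<in> {a<..<b} \<Longrightarrow> (f' n has_field_derivative f'' n t) (at t)"
    and unif: "uniform_limit {a<..<b} f'' G sequentially"
    and lim: "\<And>t. t \<in> {a..b} \<Longrightarrow> (\<lambda>n. f n t) \<longlonglongrightarrow> F t"
  shows "\<exists>F'. \<forall>t\<in>{a<..<b}. (F has_field_derivative F' t) (at t) \<and> (F' has_field_derivative G t) (at t)"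
proof -
  have ab: "b \<noteq> a" using \<open>a < b\<close> by simp
  define H' where "H' = (\<lambda>t. integral {a..t} G)"
  have dH': "(H' has_field_derivative G t) (at t)" if "t \<in> {a<..<b}" for t
    unfolding H'_def by (rule integral_has_real_derivative_interior [OF G that])
  have cH': "continuous_on {a..b} H'" unfolding H'_def
    by (intro indefinite_integral_continuous_1 integrable_continuous_real G)
  define H where "H = (\<lambda>t. integral {a..t} H')"
  have dH: "(H has_field_derivative H' t) (at t)" if "t \<in> {a<..<b}" for t
    unfolding H_def by (rule integral_has_real_derivative_interior [OF cH' that])
  have cH: "continuous_on {a..b} H" unfolding H_def
    by (intro indefinite_integral_continuous_1 integrable_continuous_real cH')
  define chord where "chord = (\<lambda>x y t. x + (t - a) * ((y - x) / (b - a)))"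
  define g where "g = (\<lambda>n t. f n t - H t - chord (f n a - H a) (f n b - H b) t)"
  have cg: "continuous_on {a..b} (g n)" for n
    unfolding g_def chord_def by (intro continuous_intros c cH) (auto simp: ab)
  have g0: "g n a = 0" "g n b = 0" for n by (auto simp: g_def chord_def ab)
  define g' where "g' = (\<lambda>n t. f' n t - H' t - (f n b - H b - (f n a - H a)) / (b - a))"
  have dg: "(g n has_field_derivative g' n t) (at t)" if t: "t \<in> {a<..<b}" for n t
    unfolding g_def chord_def g'_def
    by (auto intro!: derivative_eq_intros D1 [OF t] dH [OF t] simp: ab)
  have dg': "(g' n has_field_derivative f'' n t - G t) (at t)" if t: "t \<in> {a<..<b}" for n t
    unfolding g'_def by (auto intro!: derivative_eq_intros D2 [OF t] dH' [OF t] simp: ab)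
  have bound: "\<bar>g n t\<bar> \<le> e * (b - a)\<^sup>2"
    if t: "t \<in> {a..b}" and "0 < e" and le: "\<forall>t\<in>{a<..<b}. \<bar>f'' n t - G t\<bar> \<le> e" for n t e
  proof (rule abs_leI)
    show "g n t \<le> e * (b - a)\<^sup>2"
    proof (rule second_derivative_bound_imp_bound [OF \<open>a < b\<close> \<open>0 < e\<close> cg g0 dg dg' _ t])
      show "- e \<le> f'' n s - G s" if "s \<in> {a<..<b}" for s using bspec [OF le that] by linarith
    qed
    show "- g n t \<le> e * (b - a)\<^sup>2"
    proof (rule second_derivative_bound_imp_bound [OF \<open>a < b\<close> \<open>0 < e\<close>, of "\<lambda>t. - g n t"])
      show "continuous_on {a..b} (\<lambda>t. - g n t)" by (intro continuous_intros cg)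
      show "((\<lambda>t. - g n t) has_field_derivative - g' n s) (at s)" if "s \<in> {a<..<b}" for s
        by (intro DERIV_minus dg that)
      show "((\<lambda>s. - g' n s) has_field_derivative - (f'' n s - G s)) (at s)" if "s \<in> {a<..<b}" for s
        by (intro DERIV_minus dg' that)
      show "- e \<le> - (f'' n s - G s)" if "s \<in> {a<..<b}" for s using bspec [OF le that] by linarith
    qed (use g0 t in auto)
  qed
  have F_eq: "F t = H t + chord (F a - H a) (F b - H b) t" if t: "t \<in> {a..b}" for t
  proof -
    have "(\<lambda>n. g n t) \<longlonglongrightarrow> 0"
    proof (rule tendstoI)
      fix \<epsilon> :: real assume "0 < \<epsilon>"
      define e where "e = \<epsilon> / 2 / (b - a)\<^sup>2"
      have e: "0 < e" "e * (b - a)\<^sup>2 < \<epsilon>" using \<open>0 < \<epsilon>\<close> ab by (auto simp: e_def)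
      have "\<forall>\<^sub>F n in sequentially. \<forall>t\<in>{a<..<b}. dist (f'' n t) (G t) < e"
        by (rule uniform_limitD [OF unif e(1)])
      then show "\<forall>\<^sub>F n in sequentially. dist (g n t) 0 < \<epsilon>"
      proof (rule eventually_mono)
        fix n assume "\<forall>t\<in>{a<..<b}. dist (f'' n t) (G t) < e"
        then have "\<forall>t\<in>{a<..<b}. \<bar>f'' n t - G t\<bar> \<le> e" by (auto simp: dist_real_def intro: less_imp_le)
        from bound [OF t e(1) this] e(2) show "dist (g n t) 0 < \<epsilon>" by simp
      qed
    qed
    moreover have "(\<lambda>n. g n t) \<longlonglongrightarrow> F t - H t - chord (F a - H a) (F b - H b) t"
      unfolding g_def chord_def by (intro tendsto_intros lim) (use t in \<open>auto simp: ab\<close>)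
    ultimately have "F t - H t - chord (F a - H a) (F b - H b) t = 0" using LIMSEQ_unique by blast
    then show ?thesis by simp
  qed
  define s where "s = (F b - H b - (F a - H a)) / (b - a)"
  have "(F has_field_derivative H' t + s) (at t)" if t: "t \<in> {a<..<b}" for t
  proof -
    have "((\<lambda>t. H t + (F a - H a + (t - a) * s)) has_field_derivative H' t + s) (at t)"
      by (auto intro!: derivative_eq_intros dH [OF t])
    then have "((\<lambda>t. H t + chord (F a - H a) (F b - H b) t) has_field_derivative H' t + s) (at t)"
      by (simp only: chord_def s_def)
    then show ?thesis
      by (rule has_field_derivative_transform_within_open [where S = "{a<..<b}"])
        (use t in \<open>auto intro!: F_eq [symmetric]\<close>)
  qed
  moreover have "((\<lambda>t. H' t + s) has_field_derivative G t) (at t)" if t: "t \<in> {a<..<b}" for t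
    by (auto intro!: derivative_eq_intros dH' [OF t])
  ultimately show ?thesis by (intro exI [of _ "\<lambda>t. H' t + s"] ballI conjI)
qed

text \<open>Multiplication by cos (c t) turns sin (k c t) into the average of its two neighbours, so
  \<open>g\<close> is orthogonal to sin (c t) p (cos (c t)) for every polynomial p. The substitution
  x = cos (c t) maps the interval onto [-1, 1], where Weierstrass approximation replaces p (cos (c
  t)) by \<open>g\<close> itself. The integral of sin (c t) times the square of \<open>g\<close> is
  then 0, and the weight is positive inside.\<close>

lemma sine_system_complete:
  fixes g :: "real \<Rightarrow> real"
  assumes "0 < c" and g: "continuous_on {0..pi / c} g"
    and orth: "\<And>k :: nat. integral {0..pi / c} (\<lambda>t. g t * sin (real k * c * t)) = 0"
    and t: "t \<in> {0<..<pi / c}"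
  shows "g t = 0"
proof -
  define L where "L = pi / c"
  have L: "0 < L" "c * L = pi" using \<open>0 < c\<close> by (auto simp: L_def)
  note g = g [folded L_def] and orth = orth [folded L_def]
  have pow: "integral {0..L} (\<lambda>t. g t * sin (real k * c * t) * cos (c * t) ^ n) = 0" for k n
  proof (induction n arbitrary: k)
    case 0
    then show ?case using orth by simp
  next
    case (Suc n)
    show ?case
    proof (cases k)
      case (Suc j)
      have "g t * sin (real k * c * t) * cos (c * t) ^ Suc n
          = (g t * sin (real (Suc k) * c * t) * cos (c * t) ^ n) / 2
            + (g t * sin (real j * c * t) * cos (c * t) ^ n) / 2" for t
      proof -
        have "real (Suc k) * c * t = real k * c * t + c * t" "real j * c * t = real k * c * t - c * t"
          by (simp_all add: Suc algebra_simps)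
        then have "sin (real (Suc k) * c * t) + sin (real j * c * t) = 2 * sin (real k * c * t) * cos (c * t)"
          by (simp add: sin_add sin_diff)
        then show ?thesis by (simp add: algebra_simps flip: add_divide_distrib) (simp flip: distrib_left)
      qed
      moreover have "integral {0..L} (\<lambda>t. (g t * sin (real (Suc k) * c * t) * cos (c * t) ^ n) / 2
            + (g t * sin (real j * c * t) * cos (c * t) ^ n) / 2) = 0"
        using Suc.IH [of "Suc k"] Suc.IH [of j]
        by (subst integral_add) (auto intro!: integrable_continuous_real continuous_intros g)
      ultimately show ?thesis by simp
    qed simp
  qed
  have poly: "integral {0..L} (\<lambda>t. g t * sin (c * t) * p (cos (c * t))) = 0"
    if "real_polynomial_function p" for p
  proof -
    obtain a n where p: "p = (\<lambda>x. \<Sum>i\<le>n. a i * x ^ i)"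
      using \<open>real_polynomial_function p\<close> by (auto simp: real_polynomial_function_iff_sum)
    have "integral {0..L} (\<lambda>t. g t * sin (c * t) * p (cos (c * t)))
        = integral {0..L} (\<lambda>t. \<Sum>i\<le>n. a i * (g t * sin (c * t) * cos (c * t) ^ i))"
      by (simp add: p sum_distrib_left algebra_simps)
    also have "\<dots> = (\<Sum>i\<le>n. integral {0..L} (\<lambda>t. a i * (g t * sin (c * t) * cos (c * t) ^ i)))"
      by (rule integral_sum) (auto intro!: integrable_continuous_real continuous_intros g)
    also have "\<dots> = 0" using pow [of 1] by simp
    finally show ?thesis .
  qed
  have "bounded (g ` {0..L})" by (intro compact_imp_bounded compact_continuous_image g) auto
  then obtain B where B: "B > 0" "\<And>t. t \<in> {0..L} \<Longrightarrow> \<bar>g t\<bar> \<le> B"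
    by (auto simp: bounded_pos)
  have cg2: "continuous_on {0..L} (\<lambda>t. g t * sin (c * t) * g t)"
    by (intro continuous_intros g)
  have pos: "0 \<le> g t * sin (c * t) * g t" if "t \<in> {0..L}" for t
  proof -
    have "c * t \<le> c * L" using that \<open>0 < c\<close> by (intro mult_left_mono) auto
    then have "0 \<le> sin (c * t)" using that L \<open>0 < c\<close> by (intro sin_ge_zero) auto
    then have "0 \<le> sin (c * t) * (g t)\<^sup>2" by simp
    then show ?thesis by (simp add: power2_eq_square algebra_simps)
  qed
  have le: "integral {0..L} (\<lambda>t. g t * sin (c * t) * g t) \<le> e" if "e > 0" for e
  proof -
    define d where "d = e / (B * L)"
    have d: "d > 0" using that B L by (simp add: d_def)
    have "continuous_on {-1..1} (\<lambda>x. g (arccos x / c))"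
    proof (intro continuous_on_compose2 [OF g])
      show "continuous_on {-1..1} (\<lambda>x. arccos x / c)"
        using \<open>0 < c\<close> by (intro continuous_intros) auto
      show "(\<lambda>x. arccos x / c) ` {-1..1} \<subseteq> {0..L}"
        using \<open>0 < c\<close> arccos_lbound arccos_ubound by (auto simp: L_def divide_right_mono)
    qed
    then obtain p where p: "real_polynomial_function p"
        "\<And>x. x \<in> {-1..1} \<Longrightarrow> \<bar>g (arccos x / c) - p x\<bar> < d"
      using Stone_Weierstrass_real_polynomial_function [of "{-1..1}" "\<lambda>x. g (arccos x / c)" d] d by auto
    have cp: "continuous_on S p" for S
      using p(1) by (intro continuous_on_polymonial_function) (simp add: polynomial_function_iff_Basis_inner)
    have cpc: "continuous_on {0..L} (\<lambda>t. p (cos (c * t)))"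
      by (intro continuous_on_compose2 [OF cp [of UNIV]] continuous_intros) auto
    have "integral {0..L} (\<lambda>t. g t * sin (c * t) * g t)
        = integral {0..L} (\<lambda>t. g t * sin (c * t) * g t) - integral {0..L} (\<lambda>t. g t * sin (c * t) * p (cos (c * t)))"
      using poly [OF p(1)] by simp
    also have "\<dots> = integral {0..L} (\<lambda>t. g t * sin (c * t) * g t - g t * sin (c * t) * p (cos (c * t)))"
      by (rule integral_diff [symmetric]) (auto intro!: integrable_continuous_real continuous_intros g cpc)
    also have "\<dots> \<le> integral {0..L} (\<lambda>t. B * 1 * d)"
    proof (rule integral_le)
      show "(\<lambda>t. g t * sin (c * t) * g t - g t * sin (c * t) * p (cos (c * t))) integrable_on {0..L}"
        by (intro integrable_continuous_real continuous_intros g cpc)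
      fix t assume t: "t \<in> {0..L}"
      have "c * t \<le> c * L" using t \<open>0 < c\<close> by (intro mult_left_mono) auto
      then have "arccos (cos (c * t)) = c * t" using t L \<open>0 < c\<close> by (intro arccos_cos) auto
      then have *: "\<bar>g t - p (cos (c * t))\<bar> \<le> d" using p(2) [of "cos (c * t)"] \<open>0 < c\<close> by simp
      have "g t * sin (c * t) * g t - g t * sin (c * t) * p (cos (c * t))
          \<le> \<bar>g t\<bar> * \<bar>sin (c * t)\<bar> * \<bar>g t - p (cos (c * t))\<bar>"
        unfolding abs_mult [symmetric] right_diff_distrib [symmetric] by (rule abs_ge_self)
      also have "\<dots> \<le> B * 1 * d"
        using B(2) [OF t] B(1) * by (intro mult_mono) auto
      finally show "g t * sin (c * t) * g t - g t * sin (c * t) * p (cos (c * t)) \<le> B * 1 * d" .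
    qed auto
    also have "\<dots> = e" using B L by (simp add: d_def)
    finally show ?thesis .
  qed
  have "integral {0..L} (\<lambda>t. g t * sin (c * t) * g t) = 0"
  proof (rule antisym)
    show "integral {0..L} (\<lambda>t. g t * sin (c * t) * g t) \<le> 0"
      by (rule field_le_epsilon) (use le in auto)
    show "0 \<le> integral {0..L} (\<lambda>t. g t * sin (c * t) * g t)"
      using pos by (intro integral_nonneg integrable_continuous_real cg2) auto
  qed
  then have "g t * sin (c * t) * g t = 0"
    using integral_eq_0_iff [OF cg2 L(1)] pos t by (auto simp: L_def)
  moreover have "c * t < c * L" using t \<open>0 < c\<close> by (intro mult_strict_left_mono) (auto simp: L_def)
  then have "sin (c * t) > 0" using t L \<open>0 < c\<close> by (intro sin_gt_zero) auto
  ultimately show ?thesis by simp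
qed

lemma sine_integrals:
  assumes "0 < c"
  shows sine_orthogonal: "\<And>k :: nat. k \<noteq> 1 \<Longrightarrow>
      integral {0..pi / c} (\<lambda>t. sin (c * t) * sin (real k * c * t)) = 0"
    and sine_square_integral: "integral {0..pi / c} (\<lambda>t. sin (c * t) * sin (c * t)) = pi / c / 2"
proof -
  fix k :: nat assume k: "k \<noteq> 1"
  define m where "m = real k - 1"
  define n where "n = real k + 1"
  have mn: "m * c \<noteq> 0" "n * c \<noteq> 0" using k assms by (auto simp: m_def n_def)
  define P where "P = (\<lambda>t. sin (m * c * t) / (2 * (m * c)) - sin (n * c * t) / (2 * (n * c)))"
  have "((\<lambda>t. sin (c * t) * sin (real k * c * t)) has_integral P (pi / c) - P 0) {0..pi / c}"
  proof (rule fundamental_theorem_of_calculus)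
    fix t
    have e: "m * c * t = real k * c * t - c * t" "n * c * t = real k * c * t + c * t"
      by (simp_all add: m_def n_def algebra_simps)
    have "(P has_field_derivative cos (m * c * t) * (m * c) / (2 * (m * c))
        - cos (n * c * t) * (n * c) / (2 * (n * c))) (at t within {0..pi / c})"
      unfolding P_def using mn by (auto intro!: derivative_eq_intros)
    also have "cos (m * c * t) * (m * c) / (2 * (m * c)) - cos (n * c * t) * (n * c) / (2 * (n * c))
        = (cos (m * c * t) - cos (n * c * t)) / 2"
      using mn by (simp add: diff_divide_distrib)
    also have "\<dots> = sin (c * t) * sin (real k * c * t)"
      unfolding e by (simp add: cos_add cos_diff)
    finally show "(P has_vector_derivative sin (c * t) * sin (real k * c * t)) (at t within {0..pi / c})"
      by (simp add: has_real_derivative_iff_has_vector_derivative)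
  qed (use assms in auto)
  moreover have "P (pi / c) = 0"
  proof -
    have "n * c * (pi / c) = real (k + 1) * pi" "m * c * (pi / c) = real k * pi - pi"
      using assms by (simp_all add: m_def n_def algebra_simps)
    then show ?thesis unfolding P_def by (simp only: sin_npi sin_diff) simp
  qed
  moreover have "P 0 = 0" by (simp add: P_def)
  ultimately show "integral {0..pi / c} (\<lambda>t. sin (c * t) * sin (real k * c * t)) = 0"
    by (simp add: integral_unique)
next
  define P where "P = (\<lambda>t. t / 2 - sin (c * t) * cos (c * t) / (2 * c))"
  have "((\<lambda>t. sin (c * t) * sin (c * t)) has_integral P (pi / c) - P 0) {0..pi / c}"
  proof (rule fundamental_theorem_of_calculus)
    fix t
    have "(P has_field_derivative 1 / 2 - (cos (c * t) * c * cos (c * t) - sin (c * t) * c * sin (c * t)) / (2 * c))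
        (at t within {0..pi / c})"
      unfolding P_def using assms by (auto intro!: derivative_eq_intros simp: field_simps)
    also have "1 / 2 - (cos (c * t) * c * cos (c * t) - sin (c * t) * c * sin (c * t)) / (2 * c)
        = (1 - (cos (c * t))\<^sup>2 + (sin (c * t))\<^sup>2) / 2"
      using assms by (simp add: field_simps power2_eq_square)
    also have "\<dots> = sin (c * t) * sin (c * t)"
      by (simp add: cos_squared_eq) (simp add: power2_eq_square)
    finally show "(P has_vector_derivative sin (c * t) * sin (c * t)) (at t within {0..pi / c})"
      by (simp add: has_real_derivative_iff_has_vector_derivative)
  qed (use assms in auto)
  moreover have "P (pi / c) - P 0 = pi / c / 2" using assms by (simp add: P_def)
  ultimately show "integral {0..pi / c} (\<lambda>t. sin (c * t) * sin (c * t)) = pi / c / 2"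
    by (simp add: integral_unique)
qed

section \<open>Sine coefficients of eigenfunctions\<close>

text \<open>Nothing is known about the \<open>t\<close>-derivatives of \<open>U\<close> near \<open>t = 0\<close> and \<open>t = L\<close>, so
  the integration by parts is done for the rescaled functions \<open>U (L / 2 + \<rho> (t - L / 2))\<close>
  with \<open>\<rho> < 1\<close>, whose boundary terms involve only values of \<open>U\<close> and vanish as \<open>\<rho> \<rightarrow> 1\<close>.\<close>

lemma sine_coefficient_dirichlet_solution:
  fixes U U\<^sub>t U\<^sub>t\<^sub>t U\<^sub>\<theta> U\<^sub>\<theta>\<^sub>\<theta> :: "real \<Rightarrow> real \<Rightarrow> real" and k :: nat
  assumes "0 < c" "a < b" and L: "L = pi / c"
    and U: "continuous_on ({0..L} \<times> {a..b}) (\<lambda>(t, \<theta>). U t \<theta>)"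
    and bc: "\<And>\<theta>. \<theta> \<in> {a..b} \<Longrightarrow> U 0 \<theta> = 0" "\<And>\<theta>. \<theta> \<in> {a..b} \<Longrightarrow> U L \<theta> = 0"
      "\<And>t. t \<in> {0..L} \<Longrightarrow> U t a = 0" "\<And>t. t \<in> {0..L} \<Longrightarrow> U t b = 0"
    and d\<theta>: "\<And>t \<theta>. t \<in> {0<..<L} \<Longrightarrow> \<theta> \<in> {a<..<b} \<Longrightarrow> (U t has_field_derivative U\<^sub>\<theta> t \<theta>) (at \<theta>)"
      "\<And>t \<theta>. t \<in> {0<..<L} \<Longrightarrow> \<theta> \<in> {a<..<b} \<Longrightarrow> (U\<^sub>\<theta> t has_field_derivative U\<^sub>\<theta>\<^sub>\<theta> t \<theta>) (at \<theta>)"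
    and dt: "\<And>t \<theta>. t \<in> {0<..<L} \<Longrightarrow> \<theta> \<in> {a<..<b} \<Longrightarrow>
        ((\<lambda>t. U t \<theta>) has_field_derivative U\<^sub>t t \<theta>) (at t)"
      "\<And>t \<theta>. t \<in> {0<..<L} \<Longrightarrow> \<theta> \<in> {a<..<b} \<Longrightarrow>
        ((\<lambda>t. U\<^sub>t t \<theta>) has_field_derivative U\<^sub>t\<^sub>t t \<theta>) (at t)"
    and c\<theta>: "continuous_on ({0<..<L} \<times> {a<..<b}) (\<lambda>(t, \<theta>). U\<^sub>\<theta> t \<theta>)"
      "continuous_on ({0<..<L} \<times> {a<..<b}) (\<lambda>(t, \<theta>). U\<^sub>\<theta>\<^sub>\<theta> t \<theta>)"
    and pde: "\<And>t \<theta>. t \<in> {0<..<L} \<Longrightarrow> \<theta> \<in> {a<..<b} \<Longrightarrow> U\<^sub>t\<^sub>t t \<theta> + U\<^sub>\<theta>\<^sub>\<theta> t \<theta> = - (\<mu> * w \<theta>) * U t \<theta>"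
    and w: "continuous_on {a..b} w"
  shows "dirichlet_solution a b (\<lambda>\<theta>. \<mu> * w \<theta> - (real k * c)\<^sup>2)
    (\<lambda>\<theta>. integral {0..L} (\<lambda>t. U t \<theta> * sin (real k * c * t)))"
proof -
  have L0: "L > 0" using \<open>0 < c\<close> by (simp add: L)
  define \<omega> where "\<omega> = real k * c"
  define S where "S = (\<lambda>t. sin (\<omega> * t))"
  have S: "S 0 = 0" "S L = 0" "continuous_on X S" for X
    using \<open>0 < c\<close> by (auto simp: S_def \<omega>_def L intro!: continuous_intros)
  define F where "F = (\<lambda>\<theta>. integral {0..L} (\<lambda>t. U t \<theta> * S t))"
  \<comment> \<open>The shift by two starts the sequence at 1/2, so that \<open>\<rho> n\<close> is
    always positive and may be divided by.\<close>
  define \<rho> where "\<rho> = (\<lambda>n. 1 - inverse (real (Suc (Suc n))))"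
  have \<rho>: "0 < \<rho> n" "\<rho> n < 1" for n by (auto simp: \<rho>_def field_simps)
  have \<rho>_lim: "\<rho> \<longlonglongrightarrow> 1"
    using tendsto_diff [OF tendsto_const LIMSEQ_Suc [OF LIMSEQ_inverse_real_of_nat], of 1]
    by (simp add: \<rho>_def)
  define T where "T = (\<lambda>n t. L / 2 + \<rho> n * (t - L / 2))"
  have T: "T n t \<in> {0<..<L}" if "t \<in> {0..L}" for n t
  proof -
    have "\<bar>t - L / 2\<bar> \<le> L / 2" using that by (auto simp: abs_if)
    then have "\<bar>\<rho> n * (t - L / 2)\<bar> \<le> \<rho> n * (L / 2)"
      unfolding abs_mult using \<rho>(1) [of n] by (intro mult_mono) auto
    also have "\<dots> < 1 * (L / 2)" using \<rho> L0 by (intro mult_strict_right_mono) auto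
    finally show ?thesis unfolding T_def by (auto simp: abs_less_iff)
  qed
  have T': "T n t \<in> {0..L}" if "t \<in> {0..L}" for n t using T [OF that, of n] by auto
  have cT: "continuous_on X (T n)" for X n unfolding T_def by (intro continuous_intros)
  \<comment> \<open>\<open>T n\<close> carries the closed interval into the open one, so continuity
    in the interior is enough for the rescaled integrands.\<close>
  have comp: "continuous_on (X \<times> {0..L}) (\<lambda>(\<theta>, t). V (T n t) \<theta> * S t)"
    if "continuous_on ({0<..<L} \<times> X) (\<lambda>(t, \<theta>). V t \<theta>)" for V :: "real \<Rightarrow> real \<Rightarrow> real" and X n
  proof -
    have "continuous_on (X \<times> {0..L}) (\<lambda>p. (\<lambda>(t, \<theta>). V t \<theta>) (T n (snd p), fst p) * S (snd p))"
    proof (intro continuous_intros continuous_on_compose2 [OF that] continuous_on_compose2 [OF cT [of UNIV]]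
        continuous_on_compose2 [OF S(3) [of UNIV]])
    qed (use T in auto)
    then show ?thesis by (simp add: case_prod_unfold)
  qed
  have cU: "continuous_on ({0<..<L} \<times> {a..b}) (\<lambda>(t, \<theta>). U t \<theta>)"
    by (rule continuous_on_subset [OF U]) auto
  define f where "f = (\<lambda>n \<theta>. integral {0..L} (\<lambda>t. U (T n t) \<theta> * S t))"
  define f' where "f' = (\<lambda>n \<theta>. integral {0..L} (\<lambda>t. U\<^sub>\<theta> (T n t) \<theta> * S t))"
  define f'' where "f'' = (\<lambda>n \<theta>. integral {0..L} (\<lambda>t. U\<^sub>\<theta>\<^sub>\<theta> (T n t) \<theta> * S t))"
  have section_int: "(\<lambda>t. V (T n t) \<theta> * S t) integrable_on {0..L}"
    if "continuous_on ({0<..<L} \<times> X) (\<lambda>(t, \<theta>). V t \<theta>)" "\<theta> \<in> X"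
    for V :: "real \<Rightarrow> real \<Rightarrow> real" and n \<theta> X
    using that(2) by (intro integrable_continuous_real
        continuous_on_compose2 [OF comp [OF that(1)], of _ "\<lambda>t. (\<theta>, t)", simplified] continuous_intros) auto
  have cf: "continuous_on {a..b} (f n)" for n
    unfolding f_def using integral_continuous_on_param [OF comp [OF cU, unfolded cbox_interval [symmetric]]]
    by (simp add: cbox_interval)
  have ci: "continuous_on ({0<..<L} \<times> {a<..<b}) (\<lambda>(t, \<theta>). U t \<theta>)"
    by (rule continuous_on_subset [OF U]) auto
  have at: "at \<theta> within {a<..<b} = at \<theta>" if "\<theta> \<in> {a<..<b}" for \<theta>
    using that by (intro at_within_open) auto
  have df: "(f n has_field_derivative f' n \<theta>) (at \<theta>)" if \<theta>: "\<theta> \<in> {a<..<b}" for n \<theta>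
    unfolding f_def f'_def at [OF \<theta>, symmetric] cbox_interval [symmetric]
  proof (rule leibniz_rule_field_derivative)
    show "((\<lambda>\<theta>. U (T n t) \<theta> * S t) has_field_derivative U\<^sub>\<theta> (T n t) x * S t) (at x within {a<..<b})"
      if "x \<in> {a<..<b}" "t \<in> cbox 0 L" for x t
      using that T [of t n] by (intro DERIV_cmult_right has_field_derivative_at_within [OF d\<theta>(1)]) auto
    show "(\<lambda>t. U (T n t) x * S t) integrable_on cbox 0 L" if "x \<in> {a<..<b}" for x
      using section_int [OF ci that] by simp
    show "continuous_on ({a<..<b} \<times> cbox 0 L) (\<lambda>(x, t). U\<^sub>\<theta> (T n t) x * S t)"
      using comp [OF c\<theta>(1)] by simp
  qed (use \<theta> in auto)
  have df': "(f' n has_field_derivative f'' n \<theta>) (at \<theta>)" if \<theta>: "\<theta> \<in> {a<..<b}" for n \<theta>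
    unfolding f'_def f''_def at [OF \<theta>, symmetric] cbox_interval [symmetric]
  proof (rule leibniz_rule_field_derivative)
    show "((\<lambda>\<theta>. U\<^sub>\<theta> (T n t) \<theta> * S t) has_field_derivative U\<^sub>\<theta>\<^sub>\<theta> (T n t) x * S t) (at x within {a<..<b})"
      if "x \<in> {a<..<b}" "t \<in> cbox 0 L" for x t
      using that T [of t n] by (intro DERIV_cmult_right has_field_derivative_at_within [OF d\<theta>(2)]) auto
    show "(\<lambda>t. U\<^sub>\<theta> (T n t) x * S t) integrable_on cbox 0 L" if "x \<in> {a<..<b}" for x
      using section_int [OF c\<theta>(1) that] by simp
    show "continuous_on ({a<..<b} \<times> cbox 0 L) (\<lambda>(x, t). U\<^sub>\<theta>\<^sub>\<theta> (T n t) x * S t)"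
      using comp [OF c\<theta>(2)] by simp
  qed (use \<theta> in auto)
  define S' where "S' = (\<lambda>t. \<omega> * cos (\<omega> * t))"
  define B where "B = (\<lambda>n \<theta>. (U (T n L) \<theta> * S' L - U (T n 0) \<theta> * S' 0) / (\<rho> n)\<^sup>2)"
  \<comment> \<open>The second angular derivative is expressed through \<open>f n\<close> and edge
    values of \<open>U\<close> alone. Its uniform convergence thus follows from that of the rescaled
    \<open>U\<close>, without control of second derivatives of \<open>U\<close> near the
    edges.\<close>
  have f''_eq: "f'' n \<theta> = - (\<mu> * w \<theta>) * f n \<theta> + \<omega>\<^sup>2 / (\<rho> n)\<^sup>2 * f n \<theta> + B n \<theta>"
    if \<theta>: "\<theta> \<in> {a<..<b}" for n \<theta>
  proof -
    \<comment> \<open>The antiderivative of Green's formula; the powers of \<open>\<rho> n\<close>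
      compensate the inner derivative of \<open>T n\<close>. The term with \<open>U\<^sub>t\<close>
      carries the factor \<open>S\<close>, which is zero at both ends, so only values of
      \<open>U\<close> remain.\<close>
    define P where "P = (\<lambda>t. U\<^sub>t (T n t) \<theta> * S t / \<rho> n - U (T n t) \<theta> * S' t / (\<rho> n)\<^sup>2)"
    have r: "\<rho> n \<noteq> 0" using \<rho>(1) [of n] by simp
    have dT: "(T n has_field_derivative \<rho> n) (at t within X)" for t X
      unfolding T_def by (auto intro!: derivative_eq_intros)
    have dS: "(S has_field_derivative S' t) (at t within X)"
      "(S' has_field_derivative - \<omega>\<^sup>2 * S t) (at t within X)" for t X
      unfolding S_def S'_def by (auto intro!: derivative_eq_intros simp: power2_eq_square)
    have "((\<lambda>t. - (U\<^sub>\<theta>\<^sub>\<theta> (T n t) \<theta> * S t) - \<mu> * w \<theta> * (U (T n t) \<theta> * S t)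
        + \<omega>\<^sup>2 / (\<rho> n)\<^sup>2 * (U (T n t) \<theta> * S t)) has_integral (P L - P 0)) {0..L}"
    proof (rule fundamental_theorem_of_calculus)
      fix t assume t: "t \<in> {0..L}"
      note TT = T [OF t, of n]
      have 1: "((\<lambda>t. U (T n t) \<theta>) has_field_derivative U\<^sub>t (T n t) \<theta> * \<rho> n) (at t within {0..L})"
        by (rule DERIV_chain2 [OF dt(1) [OF TT \<theta>] dT])
      have 2: "((\<lambda>t. U\<^sub>t (T n t) \<theta>) has_field_derivative U\<^sub>t\<^sub>t (T n t) \<theta> * \<rho> n) (at t within {0..L})"
        by (rule DERIV_chain2 [OF dt(2) [OF TT \<theta>] dT])
      have "(P has_field_derivative
          (U\<^sub>t\<^sub>t (T n t) \<theta> * \<rho> n * S t + S' t * U\<^sub>t (T n t) \<theta>) / \<rho> n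
          - (U\<^sub>t (T n t) \<theta> * \<rho> n * S' t + - \<omega>\<^sup>2 * S t * U (T n t) \<theta>) / (\<rho> n)\<^sup>2) (at t within {0..L})"
        unfolding P_def by (intro DERIV_diff DERIV_cdivide DERIV_mult 1 2 dS)
      also have "(U\<^sub>t\<^sub>t (T n t) \<theta> * \<rho> n * S t + S' t * U\<^sub>t (T n t) \<theta>) / \<rho> n
          - (U\<^sub>t (T n t) \<theta> * \<rho> n * S' t + - \<omega>\<^sup>2 * S t * U (T n t) \<theta>) / (\<rho> n)\<^sup>2
          = U\<^sub>t\<^sub>t (T n t) \<theta> * S t + \<omega>\<^sup>2 / (\<rho> n)\<^sup>2 * (U (T n t) \<theta> * S t)"
        using r by (simp add: field_simps power2_eq_square)
      also have "U\<^sub>t\<^sub>t (T n t) \<theta> = - U\<^sub>\<theta>\<^sub>\<theta> (T n t) \<theta> - \<mu> * w \<theta> * U (T n t) \<theta>"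
        using pde [OF TT \<theta>] by simp
      finally show "(P has_vector_derivative - (U\<^sub>\<theta>\<^sub>\<theta> (T n t) \<theta> * S t) - \<mu> * w \<theta> * (U (T n t) \<theta> * S t)
          + \<omega>\<^sup>2 / (\<rho> n)\<^sup>2 * (U (T n t) \<theta> * S t)) (at t within {0..L})"
        unfolding has_real_derivative_iff_has_vector_derivative [symmetric]
        by (rule DERIV_cong) (simp add: algebra_simps)
    qed (use L0 in auto)
    moreover have "((\<lambda>t. - (U\<^sub>\<theta>\<^sub>\<theta> (T n t) \<theta> * S t) - \<mu> * w \<theta> * (U (T n t) \<theta> * S t)
        + \<omega>\<^sup>2 / (\<rho> n)\<^sup>2 * (U (T n t) \<theta> * S t)) has_integral
        (- f'' n \<theta> - \<mu> * w \<theta> * f n \<theta> + \<omega>\<^sup>2 / (\<rho> n)\<^sup>2 * f n \<theta>)) {0..L}"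
      unfolding f_def f''_def
      by (intro has_integral_add has_integral_diff has_integral_neg has_integral_mult_right
          integrable_integral section_int [OF ci \<theta>] section_int [OF c\<theta>(2) \<theta>])
    ultimately have "P L - P 0 = - f'' n \<theta> - \<mu> * w \<theta> * f n \<theta> + \<omega>\<^sup>2 / (\<rho> n)\<^sup>2 * f n \<theta>"
      by (rule has_integral_unique)
    moreover have "P L - P 0 = - B n \<theta>"
      by (simp add: P_def B_def S diff_divide_distrib)
    ultimately show ?thesis by simp
  qed
  have unifU: "\<forall>\<^sub>F n in sequentially. \<forall>t\<in>{0..L}. \<forall>\<theta>\<in>{a..b}. \<bar>U (T n t) \<theta> - U t \<theta>\<bar> < e" if "e > 0" for e
  proof -
    have "uniformly_continuous_on ({0..L} \<times> {a..b}) (\<lambda>(t, \<theta>). U t \<theta>)"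
      by (intro compact_uniformly_continuous U compact_Times) auto
    from uniformly_continuous_onE [OF this \<open>e > 0\<close>]
    obtain d where d: "d > 0" "\<And>x y. x \<in> {0..L} \<times> {a..b} \<Longrightarrow> y \<in> {0..L} \<times> {a..b} \<Longrightarrow> dist y x < d \<Longrightarrow>
        dist (case y of (t, \<theta>) \<Rightarrow> U t \<theta>) (case x of (t, \<theta>) \<Rightarrow> U t \<theta>) < e" by blast
    have "(\<lambda>n. (1 - \<rho> n) * L) \<longlonglongrightarrow> (1 - 1) * L" by (intro tendsto_intros \<rho>_lim)
    then have "\<forall>\<^sub>F n in sequentially. (1 - \<rho> n) * L < d" using d(1) by (intro order_tendstoD(2)) auto
    then show ?thesis
    proof (rule eventually_mono, intro ballI)
      fix n t \<theta> assume n: "(1 - \<rho> n) * L < d" and t: "t \<in> {0..L}" and \<theta>: "\<theta> \<in> {a..b}"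
      have "dist (T n t, \<theta>) (t, \<theta>) = \<bar>(1 - \<rho> n) * (L / 2 - t)\<bar>"
        by (simp add: dist_prod_def dist_real_def T_def algebra_simps)
      also have "\<bar>L / 2 - t\<bar> \<le> L" using t by (auto simp: abs_if)
      then have "\<bar>(1 - \<rho> n) * (L / 2 - t)\<bar> \<le> (1 - \<rho> n) * L"
        unfolding abs_mult using \<rho> [of n] by (intro mult_mono) auto
      finally have "dist (T n t, \<theta>) (t, \<theta>) < d" using n by simp
      from d(2) [OF _ _ this] show "\<bar>U (T n t) \<theta> - U t \<theta>\<bar> < e"
        using t \<theta> T' [OF t, of n] by (simp add: dist_real_def)
    qed
  qed
  have intU: "(\<lambda>t. U t \<theta> * S t) integrable_on {0..L}" if "\<theta> \<in> {a..b}" for \<theta>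
    using that by (intro integrable_continuous_real continuous_intros S
        continuous_on_compose2 [OF U, of _ "\<lambda>t. (t, \<theta>)", simplified]) auto
  have lim_f: "uniform_limit {a..b} f F sequentially"
  proof (rule uniform_limitI)
    fix e :: real assume "e > 0"
    define e' where "e' = e / 2 / L"
    have e': "e' > 0" "e' * L < e" using \<open>e > 0\<close> L0 by (auto simp: e'_def)
    show "\<forall>\<^sub>F n in sequentially. \<forall>\<theta>\<in>{a..b}. dist (f n \<theta>) (F \<theta>) < e"
    proof (rule eventually_mono [OF unifU [OF e'(1)]], rule ballI)
      fix n \<theta> assume n: "\<forall>t\<in>{0..L}. \<forall>\<theta>\<in>{a..b}. \<bar>U (T n t) \<theta> - U t \<theta>\<bar> < e'" and \<theta>: "\<theta> \<in> {a..b}"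
      have "((\<lambda>t. U (T n t) \<theta> * S t - U t \<theta> * S t) has_integral (f n \<theta> - F \<theta>)) {0..L}"
        unfolding f_def F_def
        by (intro has_integral_diff integrable_integral intU [OF \<theta>] section_int [OF cU \<theta>])
      moreover have "\<bar>U (T n t) \<theta> * S t - U t \<theta> * S t\<bar> \<le> e'" if t: "t \<in> {0..L}" for t
      proof -
        have "\<bar>(U (T n t) \<theta> - U t \<theta>) * S t\<bar> \<le> e' * 1"
          unfolding abs_mult using t \<theta> n e'(1) by (intro mult_mono) (auto simp: S_def intro: less_imp_le)
        then show ?thesis by (simp add: algebra_simps)
      qed
      ultimately have "norm (f n \<theta> - F \<theta>) \<le> e' * measure lborel {0..L}"
        using e'(1) by (intro has_integral_bound_real [where S = "{}"]) auto
      then show "dist (f n \<theta>) (F \<theta>) < e" using e' L0 by (simp add: dist_real_def)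
    qed
  qed
  have lim_edge: "uniform_limit {a<..<b} (\<lambda>n \<theta>. U (T n t) \<theta>) (\<lambda>\<theta>. 0) sequentially"
    if "t = 0 \<or> t = L" for t
  proof (rule uniform_limitI)
    fix e :: real assume "e > 0"
    show "\<forall>\<^sub>F n in sequentially. \<forall>\<theta>\<in>{a<..<b}. dist (U (T n t) \<theta>) 0 < e"
    proof (rule eventually_mono [OF unifU [OF \<open>e > 0\<close>]], rule ballI)
      fix n \<theta> assume n: "\<forall>t\<in>{0..L}. \<forall>\<theta>\<in>{a..b}. \<bar>U (T n t) \<theta> - U t \<theta>\<bar> < e" and \<theta>: "\<theta> \<in> {a<..<b}"
      have "t \<in> {0..L}" "\<theta> \<in> {a..b}" using that \<theta> L0 by auto
      moreover from this have "U t \<theta> = 0" using that bc by auto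
      ultimately show "dist (U (T n t) \<theta>) 0 < e" using n by force
    qed
  qed
  define G where "G = (\<lambda>\<theta>. - (\<mu> * w \<theta> - \<omega>\<^sup>2) * F \<theta>)"
  have cF: "continuous_on {a..b} F"
    by (rule uniform_limit_theorem [OF _ lim_f]) (auto simp: cf)
  then have cG: "continuous_on {a..b} G" unfolding G_def by (intro continuous_intros w)
  have bdd: "bounded (h ` {a<..<b})" if "continuous_on {a..b} h" for h :: "real \<Rightarrow> real"
  proof -
    have "bounded (h ` {a..b})" by (intro compact_imp_bounded compact_continuous_image that) auto
    then show ?thesis by (rule bounded_subset) auto
  qed
  have const: "uniform_limit X (\<lambda>n \<theta>. h n) (\<lambda>\<theta>. l) sequentially"
    if "h \<longlonglongrightarrow> l" for h :: "nat \<Rightarrow> real" and l and X :: "real set"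
    by (rule uniform_limitI) (auto intro: eventually_mono [OF tendstoD [OF that]])
  have r2: "(\<lambda>n. \<omega>\<^sup>2 / (\<rho> n)\<^sup>2) \<longlonglongrightarrow> \<omega>\<^sup>2 / 1\<^sup>2" "(\<lambda>n. 1 / (\<rho> n)\<^sup>2) \<longlonglongrightarrow> 1 / 1\<^sup>2"
    by (intro tendsto_intros \<rho>_lim; simp)+
  have lim_f': "uniform_limit {a<..<b} f F sequentially"
    by (rule uniform_limit_on_subset [OF lim_f]) auto
  have "uniform_limit {a<..<b} (\<lambda>n \<theta>. - (\<mu> * w \<theta>) * f n \<theta> + \<omega>\<^sup>2 / (\<rho> n)\<^sup>2 * f n \<theta>
        + (U (T n L) \<theta> * S' L - U (T n 0) \<theta> * S' 0) * (1 / (\<rho> n)\<^sup>2))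
      (\<lambda>\<theta>. - (\<mu> * w \<theta>) * F \<theta> + \<omega>\<^sup>2 / 1\<^sup>2 * F \<theta> + (0 * S' L - 0 * S' 0) * (1 / 1\<^sup>2)) sequentially"
    by (intro uniform_limit_add uniform_lim_mult uniform_limit_minus uniform_limit_const const r2 lim_f' lim_edge bdd cF
        continuous_intros w) auto
  then have "uniform_limit {a<..<b} f'' G sequentially"
    by (rule uniform_limit_cong' [THEN iffD1, rotated -1])
      (auto simp: f''_eq G_def B_def algebra_simps diff_divide_distrib)
  then have "\<exists>F'. \<forall>\<theta>\<in>{a<..<b}. (F has_field_derivative F' \<theta>) (at \<theta>) \<and> (F' has_field_derivative G \<theta>) (at \<theta>)"
    using \<open>a < b\<close> cG cf df df' lim_f
    by (intro second_derivative_of_limit [of a b G f f' f'']) (auto dest: tendsto_uniform_limitI)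
  moreover have "F a = 0" "F b = 0"
  proof -
    have "F \<theta> = integral {0..L} (\<lambda>t. 0)" if "\<theta> = a \<or> \<theta> = b" for \<theta>
      unfolding F_def using that bc by (intro integral_cong) auto
    then show "F a = 0" "F b = 0" by auto
  qed
  ultimately show ?thesis
    using cF unfolding dirichlet_solution_def F_def G_def S_def \<omega>_def by simp
qed

section \<open>Polar coordinates\<close>

lemma has_derivative_partial:
  assumes "f differentiable at p"
  shows "(f has_derivative (\<lambda>h. partial 1 f p * h $ 1 + partial 2 f p * h $ 2)) (at p)"
proof -
  define D where "D = frechet_derivative f (at p)"
  have D: "(f has_derivative D) (at p)"
    using assms by (simp add: D_def frechet_derivative_works)
  then interpret D: linear D by (rule has_derivative_linear)
  have "D h = partial 1 f p * h $ 1 + partial 2 f p * h $ 2" for h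
  proof -
    have "h = h $ 1 *\<^sub>R axis 1 1 + h $ 2 *\<^sub>R axis 2 1"
      by (simp add: vec_eq_iff forall_2 axis_def)
    then have "D h = h $ 1 *\<^sub>R D (axis 1 1) + h $ 2 *\<^sub>R D (axis 2 1)"
      by (metis D.add D.scale)
    then show ?thesis by (simp add: partial_def D_def)
  qed
  then have "D = (\<lambda>h. partial 1 f p * h $ 1 + partial 2 f p * h $ 2)" by auto
  with D show ?thesis by simp
qed

lemma partial_eqI:
  assumes "(f has_derivative (\<lambda>h. A * h $ 1 + B * h $ 2)) (at p)"
  shows "partial 1 f p = A" "partial 2 f p = B"
  unfolding partial_def frechet_derivative_at [OF assms, symmetric] by (simp_all add: axis_def)

lemma has_field_derivative_along_curve:
  fixes x y :: "real \<Rightarrow> real"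
  assumes f: "f differentiable at (vector [x t, y t] :: plane)"
    and x: "(x has_field_derivative x') (at t)" and y: "(y has_field_derivative y') (at t)"
  shows "((\<lambda>t. f (vector [x t, y t] :: plane)) has_field_derivative
    partial 1 f (vector [x t, y t]) * x' + partial 2 f (vector [x t, y t]) * y') (at t)"
proof -
  have v: "vector [r, s] = r *\<^sub>R axis 1 1 + s *\<^sub>R (axis 2 1 :: plane)" for r s :: real
    by (simp add: vec_eq_iff forall_2 axis_def)
  have "((\<lambda>t. vector [x t, y t] :: plane) has_derivative (\<lambda>h. vector [x' * h, y' * h])) (at t)"
    unfolding v using x y
    by (auto simp: has_field_derivative_def intro!: derivative_eq_intros)
  from has_derivative_compose [OF this has_derivative_partial [OF f]]
  have "((\<lambda>t. f (vector [x t, y t] :: plane)) has_derivative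
      (\<lambda>h. partial 1 f (vector [x t, y t]) * (x' * h) + partial 2 f (vector [x t, y t]) * (y' * h))) (at t)"
    by simp
  then show ?thesis
    unfolding has_field_derivative_def
    by (rule has_derivative_eq_rhs) (simp add: fun_eq_iff algebra_simps)
qed

text \<open>The first argument is ln r rather than r, which makes the coordinates conformal.\<close>

definition polar_point :: "real \<Rightarrow> real \<Rightarrow> plane" where
  "polar_point t \<theta> = vector [exp t * cos \<theta>, exp t * sin \<theta>]"

definition log_radius :: "plane \<Rightarrow> real" where
  "log_radius p = ln ((p $ 1)\<^sup>2 + (p $ 2)\<^sup>2) / 2"

text \<open>With the quotient x / y, whose denominator is positive on the half-plane, one formula
  covers all angles between 0 and pi without a change of branch.\<close>

definition polar_angle :: "plane \<Rightarrow> real" where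
  "polar_angle p = pi / 2 - arctan (p $ 1 / p $ 2)"

lemma polar_point_coordinates:
  assumes "0 < \<theta>" "\<theta> < pi"
  shows "polar_point t \<theta> \<in> half_plane" "log_radius (polar_point t \<theta>) = t"
    "polar_angle (polar_point t \<theta>) = \<theta>"
proof -
  have s: "sin \<theta> > 0" using assms by (rule sin_gt_zero)
  then show "polar_point t \<theta> \<in> half_plane" by (simp add: polar_point_def half_plane_def)
  have "(exp t * cos \<theta>)\<^sup>2 + (exp t * sin \<theta>)\<^sup>2 = (exp t)\<^sup>2 * ((cos \<theta>)\<^sup>2 + (sin \<theta>)\<^sup>2)"
    unfolding power_mult_distrib by (simp only: distrib_left)
  then show "log_radius (polar_point t \<theta>) = t"
    by (simp add: log_radius_def polar_point_def ln_realpow)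
  have "cos \<theta> / sin \<theta> = tan (pi / 2 - \<theta>)" by (simp add: tan_def sin_diff cos_diff)
  then have "arctan (cos \<theta> / sin \<theta>) = pi / 2 - \<theta>"
    using assms by (simp add: arctan_tan)
  then show "polar_angle (polar_point t \<theta>) = \<theta>"
    by (simp add: polar_angle_def polar_point_def)
qed

lemma polar_point_surj:
  assumes "p \<in> half_plane"
  shows "polar_point (log_radius p) (polar_angle p) = p" "0 < polar_angle p" "polar_angle p < pi"
proof -
  define x where "x = p $ 1"
  define y where "y = p $ 2"
  have y: "y > 0" using assms by (simp add: y_def half_plane_def)
  have pos: "x\<^sup>2 + y\<^sup>2 > 0" using y by (simp add: add_nonneg_pos)
  have e: "exp (log_radius p) = sqrt (x\<^sup>2 + y\<^sup>2)"
    using pos by (simp add: log_radius_def x_def y_def flip: ln_sqrt)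
  have "y\<^sup>2 * (1 + (x / y)\<^sup>2) = x\<^sup>2 + y\<^sup>2" using y by (simp add: field_simps)
  then have "sqrt (x\<^sup>2 + y\<^sup>2) = y * sqrt (1 + (x / y)\<^sup>2)"
    using y by (metis real_sqrt_mult real_sqrt_unique less_imp_le)
  moreover have "0 < sqrt (1 + (x / y)\<^sup>2)" by (simp add: add_pos_nonneg)
  ultimately show "polar_point (log_radius p) (polar_angle p) = p"
    using y by (simp add: polar_point_def e polar_angle_def cos_diff sin_diff vec_eq_iff forall_2
        sin_arctan cos_arctan flip: x_def y_def)
  show "0 < polar_angle p" "polar_angle p < pi"
    using arctan_ubound [of "p $ 1 / p $ 2"] arctan_lbound [of "p $ 1 / p $ 2"]
    by (simp_all add: polar_angle_def)
qed

section \<open>Sectors and their closures as images of rectangles\<close>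

lemma in_polar_sector_iff:
  assumes "0 < \<theta>\<^sub>0" "\<theta>\<^sub>1 < pi"
  shows "p \<in> polar_sector c \<theta>\<^sub>0 \<theta>\<^sub>1 \<longleftrightarrow> p \<in> half_plane \<and> log_radius p \<in> {0<..<pi / c} \<and>
    polar_angle p \<in> {\<theta>\<^sub>0<..<\<theta>\<^sub>1}"
proof
  assume "p \<in> polar_sector c \<theta>\<^sub>0 \<theta>\<^sub>1"
  then obtain r \<theta> where p: "p = vector [r * cos \<theta>, r * sin \<theta>]" "1 < r" "r < exp (pi / c)"
    "\<theta>\<^sub>0 < \<theta>" "\<theta> < \<theta>\<^sub>1" unfolding polar_sector_def by blast
  have "p = polar_point (ln r) \<theta>" using p by (simp add: polar_point_def)
  moreover have "0 < ln r" "ln r < pi / c"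
    using p ln_less_cancel_iff [of r "exp (pi / c)"] by simp_all
  ultimately show "p \<in> half_plane \<and> log_radius p \<in> {0<..<pi / c} \<and> polar_angle p \<in> {\<theta>\<^sub>0<..<\<theta>\<^sub>1}"
    using p assms by (auto simp: polar_point_coordinates)
next
  assume r: "p \<in> half_plane \<and> log_radius p \<in> {0<..<pi / c} \<and> polar_angle p \<in> {\<theta>\<^sub>0<..<\<theta>\<^sub>1}"
  then have "p = polar_point (log_radius p) (polar_angle p)" by (simp add: polar_point_surj)
  then have "p = vector [exp (log_radius p) * cos (polar_angle p), exp (log_radius p) * sin (polar_angle p)]"
    by (simp only: polar_point_def)
  moreover have "1 < exp (log_radius p)" "exp (log_radius p) < exp (pi / c)" using r by auto
  ultimately show "p \<in> polar_sector c \<theta>\<^sub>0 \<theta>\<^sub>1" using r unfolding polar_sector_def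
    by (intro CollectI exI [of _ "exp (log_radius p)"] exI [of _ "polar_angle p"] conjI) auto
qed

lemma continuous_on_log_radius: "continuous_on half_plane log_radius"
  unfolding log_radius_def by (intro continuous_intros) (auto simp: half_plane_def sum_power2_eq_zero_iff)

lemma continuous_on_polar_angle: "continuous_on half_plane polar_angle"
  unfolding polar_angle_def by (intro continuous_intros) (auto simp: half_plane_def)

lemma open_polar_sector:
  assumes "0 < \<theta>\<^sub>0" "\<theta>\<^sub>1 < pi"
  shows "open (polar_sector c \<theta>\<^sub>0 \<theta>\<^sub>1)"
proof -
  have "open (half_plane \<inter> log_radius -` {0<..<pi / c})"
    by (intro continuous_open_preimage continuous_on_log_radius open_half_plane) auto
  moreover have "open (half_plane \<inter> polar_angle -` {\<theta>\<^sub>0<..<\<theta>\<^sub>1})"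
    by (intro continuous_open_preimage continuous_on_polar_angle open_half_plane) auto
  moreover have "polar_sector c \<theta>\<^sub>0 \<theta>\<^sub>1 = (half_plane \<inter> log_radius -` {0<..<pi / c}) \<inter>
      (half_plane \<inter> polar_angle -` {\<theta>\<^sub>0<..<\<theta>\<^sub>1})"
    using in_polar_sector_iff [OF assms] by blast
  ultimately show ?thesis by (metis open_Int)
qed

lemma continuous_on_polar_point: "continuous_on S (\<lambda>(t, \<theta>). polar_point t \<theta>)"
proof -
  have v: "vector [r, s] = r *\<^sub>R axis 1 1 + s *\<^sub>R (axis 2 1 :: plane)" for r s :: real
    by (simp add: vec_eq_iff forall_2 axis_def)
  show ?thesis unfolding polar_point_def v case_prod_unfold by (intro continuous_intros)
qed

lemma closure_polar_sector:
  assumes "0 < c" "0 < \<theta>\<^sub>0" "\<theta>\<^sub>0 < \<theta>\<^sub>1" "\<theta>\<^sub>1 < pi"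
  shows "closure (polar_sector c \<theta>\<^sub>0 \<theta>\<^sub>1) = (\<lambda>(t, \<theta>). polar_point t \<theta>) ` ({0..pi / c} \<times> {\<theta>\<^sub>0..\<theta>\<^sub>1})"
    (is "closure ?\<Omega> = ?P ` ?R")
proof
  have \<Omega>: "?\<Omega> = ?P ` ({0<..<pi / c} \<times> {\<theta>\<^sub>0<..<\<theta>\<^sub>1})"
  proof (intro set_eqI iffI)
    fix p assume "p \<in> ?\<Omega>"
    then show "p \<in> ?P ` ({0<..<pi / c} \<times> {\<theta>\<^sub>0<..<\<theta>\<^sub>1})"
      using assms polar_point_surj(1) [of p]
      by (intro image_eqI [of _ _ "(log_radius p, polar_angle p)"]) (auto simp: in_polar_sector_iff)
  next
    fix p assume "p \<in> ?P ` ({0<..<pi / c} \<times> {\<theta>\<^sub>0<..<\<theta>\<^sub>1})"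
    then show "p \<in> ?\<Omega>"
      using assms by (auto simp: in_polar_sector_iff polar_point_coordinates)
  qed
  have R: "closure ({0<..<pi / c} \<times> {\<theta>\<^sub>0<..<\<theta>\<^sub>1}) = ?R"
    using assms by (simp add: closure_Times)
  have "closed (?P ` ?R)"
    by (intro compact_imp_closed compact_continuous_image continuous_on_polar_point compact_Times) auto
  then show "closure ?\<Omega> \<subseteq> ?P ` ?R"
    unfolding \<Omega> by (intro closure_minimal image_mono) auto
  show "?P ` ?R \<subseteq> closure ?\<Omega>"
    unfolding R [symmetric] \<Omega>
    by (intro image_closure_subset continuous_on_polar_point closed_closure closure_subset)
qed

text \<open>The chain rule, applied twice, moves the classical solution to the rectangle of (t,
  \<theta>), where conformality gives the equation the form needed for sine coefficients, with
  weight 1 / (sin \<theta>)^2.\<close>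

lemma eigenfunction_sine_coefficient:
  assumes "0 < c" and \<theta>: "0 < \<theta>\<^sub>0" "\<theta>\<^sub>0 < \<theta>\<^sub>1" "\<theta>\<^sub>1 < pi"
    and u: "u \<in> dirichlet_eigenspace (polar_sector c \<theta>\<^sub>0 \<theta>\<^sub>1) \<mu>"
  shows "dirichlet_solution \<theta>\<^sub>0 \<theta>\<^sub>1 (\<lambda>\<theta>. \<mu> * (1 / (sin \<theta>)\<^sup>2) - (real k * c)\<^sup>2)
    (\<lambda>\<theta>. integral {0..pi / c} (\<lambda>t. u (polar_point t \<theta>) * sin (real k * c * t)))"
proof -
  define L where "L = pi / c"
  define \<Omega> where "\<Omega> = polar_sector c \<theta>\<^sub>0 \<theta>\<^sub>1"
  define P where "P = polar_point"
  define X where "X = (\<lambda>t \<theta> :: real. exp t * cos \<theta>)"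
  define Y where "Y = (\<lambda>t \<theta> :: real. exp t * sin \<theta>)"
  have P_eq: "P t \<theta> = vector [X t \<theta>, Y t \<theta>]" for t \<theta> by (simp add: P_def X_def Y_def polar_point_def)
  have u: "C2_on \<Omega> u" "continuous_on (closure \<Omega>) u" "\<And>p. p \<notin> \<Omega> \<Longrightarrow> u p = 0"
    "\<And>p. p \<in> \<Omega> \<Longrightarrow> - hyp_laplacian u p = \<mu> * u p"
    using u by (auto simp: dirichlet_eigenspace_def \<Omega>_def)
  have P\<Omega>: "P t \<theta> \<in> \<Omega> \<longleftrightarrow> t \<in> {0<..<L} \<and> \<theta> \<in> {\<theta>\<^sub>0<..<\<theta>\<^sub>1}" if "\<theta> \<in> {\<theta>\<^sub>0..\<theta>\<^sub>1}" for t \<theta>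
    using \<theta> that by (auto simp: \<Omega>_def P_def L_def in_polar_sector_iff polar_point_coordinates)
  then have in\<Omega>: "P t \<theta> \<in> \<Omega>" if "t \<in> {0<..<L}" "\<theta> \<in> {\<theta>\<^sub>0<..<\<theta>\<^sub>1}" for t \<theta> using that by auto
  define u1 where "u1 = (\<lambda>i t \<theta>. partial i u (P t \<theta>))"
  define u2 where "u2 = (\<lambda>i j t \<theta>. partial j (partial i u) (P t \<theta>))"
  have diff: "u differentiable at (P t \<theta>)" "partial i u differentiable at (P t \<theta>)"
    if "t \<in> {0<..<L}" "\<theta> \<in> {\<theta>\<^sub>0<..<\<theta>\<^sub>1}" for t \<theta> i
    using u(1) in\<Omega> [OF that] by (auto simp: C2_on_def)
  have dX: "((\<lambda>t. X t \<theta>) has_field_derivative X t \<theta>) (at t)" "(X t has_field_derivative - Y t \<theta>) (at \<theta>)"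
    and dY: "((\<lambda>t. Y t \<theta>) has_field_derivative Y t \<theta>) (at t)" "(Y t has_field_derivative X t \<theta>) (at \<theta>)" for t \<theta>
    unfolding X_def Y_def by (auto intro!: derivative_eq_intros)
  have du: "((\<lambda>t. u (P t \<theta>)) has_field_derivative u1 1 t \<theta> * X t \<theta> + u1 2 t \<theta> * Y t \<theta>) (at t)"
    "((\<lambda>\<theta>. u (P t \<theta>)) has_field_derivative u1 1 t \<theta> * - Y t \<theta> + u1 2 t \<theta> * X t \<theta>) (at \<theta>)"
    if "t \<in> {0<..<L}" "\<theta> \<in> {\<theta>\<^sub>0<..<\<theta>\<^sub>1}" for t \<theta>
    unfolding u1_def P_eq
    by (intro has_field_derivative_along_curve diff(1) [OF that, unfolded P_eq] dX dY)+
  have du1: "(u1 i t has_field_derivative u2 i 1 t \<theta> * - Y t \<theta> + u2 i 2 t \<theta> * X t \<theta>) (at \<theta>)"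
    "((\<lambda>t. u1 i t \<theta>) has_field_derivative u2 i 1 t \<theta> * X t \<theta> + u2 i 2 t \<theta> * Y t \<theta>) (at t)"
    if "t \<in> {0<..<L}" "\<theta> \<in> {\<theta>\<^sub>0<..<\<theta>\<^sub>1}" for t \<theta> i
    unfolding u1_def u2_def P_eq
    by (intro has_field_derivative_along_curve diff(2) [OF that, unfolded P_eq] dX dY)+
  have cP: "continuous_on S (\<lambda>p. P (fst p) (snd p))" for S
    using continuous_on_polar_point by (simp add: P_def case_prod_unfold)
  have cu1: "continuous_on ({0<..<L} \<times> {\<theta>\<^sub>0<..<\<theta>\<^sub>1}) (\<lambda>p. u1 i (fst p) (snd p))" for i
  proof -
    have "continuous_on \<Omega> (partial i u)"
      using u(1) unfolding C2_on_def
      by (intro continuous_at_imp_continuous_on ballI differentiable_imp_continuous_within) blast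
    then show ?thesis unfolding u1_def
      by (rule continuous_on_compose2 [OF _ cP]) (auto intro: in\<Omega>)
  qed
  have cu2: "continuous_on ({0<..<L} \<times> {\<theta>\<^sub>0<..<\<theta>\<^sub>1}) (\<lambda>p. u2 i j (fst p) (snd p))" for i j
  proof -
    have "continuous_on \<Omega> (partial j (partial i u))" using u(1) by (auto simp: C2_on_def)
    then show ?thesis unfolding u2_def
      by (rule continuous_on_compose2 [OF _ cP]) (auto intro: in\<Omega>)
  qed
  have cXY: "continuous_on S (\<lambda>p. X (fst p) (snd p))" "continuous_on S (\<lambda>p. Y (fst p) (snd p))" for S
    unfolding X_def Y_def by (intro continuous_intros)+
  show ?thesis
    unfolding L_def [symmetric] P_def [symmetric]
  proof (rule sine_coefficient_dirichlet_solution [where U = "\<lambda>t \<theta>. u (P t \<theta>)"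
        and U\<^sub>t = "\<lambda>t \<theta>. u1 1 t \<theta> * X t \<theta> + u1 2 t \<theta> * Y t \<theta>"
        and U\<^sub>\<theta> = "\<lambda>t \<theta>. u1 1 t \<theta> * - Y t \<theta> + u1 2 t \<theta> * X t \<theta>"
        and U\<^sub>t\<^sub>t = "\<lambda>t \<theta>. ((u2 1 1 t \<theta> * X t \<theta> + u2 1 2 t \<theta> * Y t \<theta>) * X t \<theta> + X t \<theta> * u1 1 t \<theta>)
          + ((u2 2 1 t \<theta> * X t \<theta> + u2 2 2 t \<theta> * Y t \<theta>) * Y t \<theta> + Y t \<theta> * u1 2 t \<theta>)"
        and U\<^sub>\<theta>\<^sub>\<theta> = "\<lambda>t \<theta>. ((u2 1 1 t \<theta> * - Y t \<theta> + u2 1 2 t \<theta> * X t \<theta>) * - Y t \<theta> + - X t \<theta> * u1 1 t \<theta>)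
          + ((u2 2 1 t \<theta> * - Y t \<theta> + u2 2 2 t \<theta> * X t \<theta>) * X t \<theta> + - Y t \<theta> * u1 2 t \<theta>)"])
    show "continuous_on ({0..L} \<times> {\<theta>\<^sub>0..\<theta>\<^sub>1}) (\<lambda>(t, \<theta>). u (P t \<theta>))"
      unfolding case_prod_unfold
    proof (rule continuous_on_compose2 [OF u(2) cP])
      show "(\<lambda>p. P (fst p) (snd p)) ` ({0..L} \<times> {\<theta>\<^sub>0..\<theta>\<^sub>1}) \<subseteq> closure \<Omega>"
        using closure_polar_sector [OF \<open>0 < c\<close> \<theta>] by (simp add: \<Omega>_def P_def L_def case_prod_unfold)
    qed
    show "u (P 0 \<theta>) = 0" "u (P L \<theta>) = 0" if "\<theta> \<in> {\<theta>\<^sub>0..\<theta>\<^sub>1}" for \<theta>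
      using P\<Omega> [OF that] by (auto intro!: u(3))
    show "u (P t \<theta>\<^sub>0) = 0" "u (P t \<theta>\<^sub>1) = 0" for t
      using P\<Omega> [of \<theta>\<^sub>0 t] P\<Omega> [of \<theta>\<^sub>1 t] \<theta> by (auto intro!: u(3))
    show "continuous_on {\<theta>\<^sub>0..\<theta>\<^sub>1} (\<lambda>\<theta>. 1 / (sin \<theta>)\<^sup>2)"
    proof (intro continuous_intros ballI)
      fix x assume "x \<in> {\<theta>\<^sub>0..\<theta>\<^sub>1}"
      then have "sin x > 0" using \<theta> by (intro sin_gt_zero) auto
      then show "(sin x)\<^sup>2 \<noteq> 0" by simp
    qed
    fix t \<theta> assume t: "t \<in> {0<..<L}" and th: "\<theta> \<in> {\<theta>\<^sub>0<..<\<theta>\<^sub>1}"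
    have s: "sin \<theta> > 0" using th \<theta> by (intro sin_gt_zero) auto
    have "(P t \<theta>) $ 2 = Y t \<theta>" by (simp add: P_eq)
    moreover have "P t \<theta> \<in> half_plane" using th \<theta> by (simp add: P_def polar_point_coordinates)
    ultimately have lap: "(Y t \<theta>)\<^sup>2 * (u2 1 1 t \<theta> + u2 2 2 t \<theta>) = - (\<mu> * u (P t \<theta>))"
      using u(4) [OF in\<Omega> [OF t th]] hyp_laplacian_eq [of "P t \<theta>" u] by (simp add: u2_def)
    have XY: "(X t \<theta>)\<^sup>2 + (Y t \<theta>)\<^sup>2 = (Y t \<theta>)\<^sup>2 * (1 / (sin \<theta>)\<^sup>2)"
    proof -
      have "(X t \<theta>)\<^sup>2 + (Y t \<theta>)\<^sup>2 = (exp t)\<^sup>2"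
        unfolding X_def Y_def power_mult_distrib by (simp flip: distrib_left)
      then show ?thesis using s by (simp add: Y_def power_mult_distrib)
    qed
    \<comment> \<open>The first-order terms and the mixed terms cancel, leaving the Euclidean
      Laplacian times the squared radius.\<close>
    have "((u2 1 1 t \<theta> * X t \<theta> + u2 1 2 t \<theta> * Y t \<theta>) * X t \<theta> + X t \<theta> * u1 1 t \<theta>)
          + ((u2 2 1 t \<theta> * X t \<theta> + u2 2 2 t \<theta> * Y t \<theta>) * Y t \<theta> + Y t \<theta> * u1 2 t \<theta>)
          + (((u2 1 1 t \<theta> * - Y t \<theta> + u2 1 2 t \<theta> * X t \<theta>) * - Y t \<theta> + - X t \<theta> * u1 1 t \<theta>)
          + ((u2 2 1 t \<theta> * - Y t \<theta> + u2 2 2 t \<theta> * X t \<theta>) * X t \<theta> + - Y t \<theta> * u1 2 t \<theta>))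
        = ((X t \<theta>)\<^sup>2 + (Y t \<theta>)\<^sup>2) * (u2 1 1 t \<theta> + u2 2 2 t \<theta>)"
      by (simp add: power2_eq_square algebra_simps)
    also have "\<dots> = - (\<mu> * (1 / (sin \<theta>)\<^sup>2)) * u (P t \<theta>)"
      unfolding XY using lap by (simp add: field_simps)
    finally show "((u2 1 1 t \<theta> * X t \<theta> + u2 1 2 t \<theta> * Y t \<theta>) * X t \<theta> + X t \<theta> * u1 1 t \<theta>)
          + ((u2 2 1 t \<theta> * X t \<theta> + u2 2 2 t \<theta> * Y t \<theta>) * Y t \<theta> + Y t \<theta> * u1 2 t \<theta>)
          + (((u2 1 1 t \<theta> * - Y t \<theta> + u2 1 2 t \<theta> * X t \<theta>) * - Y t \<theta> + - X t \<theta> * u1 1 t \<theta>)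
          + ((u2 2 1 t \<theta> * - Y t \<theta> + u2 2 2 t \<theta> * X t \<theta>) * X t \<theta> + - Y t \<theta> * u1 2 t \<theta>))
        = - (\<mu> * (1 / (sin \<theta>)\<^sup>2)) * u (P t \<theta>)" .
    show "((\<lambda>\<theta>. u (P t \<theta>)) has_field_derivative u1 1 t \<theta> * - Y t \<theta> + u1 2 t \<theta> * X t \<theta>) (at \<theta>)"
      by (rule du(2) [OF t th])
    show "((\<lambda>\<theta>. u1 1 t \<theta> * - Y t \<theta> + u1 2 t \<theta> * X t \<theta>) has_field_derivative
        ((u2 1 1 t \<theta> * - Y t \<theta> + u2 1 2 t \<theta> * X t \<theta>) * - Y t \<theta> + - X t \<theta> * u1 1 t \<theta>)
          + ((u2 2 1 t \<theta> * - Y t \<theta> + u2 2 2 t \<theta> * X t \<theta>) * X t \<theta> + - Y t \<theta> * u1 2 t \<theta>)) (at \<theta>)"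
      by (intro DERIV_add DERIV_mult DERIV_minus du1(1) [OF t th] dX dY)
  qed (use \<open>0 < c\<close> \<theta> in \<open>auto simp: L_def case_prod_unfold intro!: du du1 dX dY DERIV_add DERIV_mult DERIV_minus
      continuous_intros cu1 cu2 cXY simp flip: L_def\<close>)
qed

text \<open>The gradients of \<open>log_radius\<close> and \<open>polar_angle\<close> are exp (-x)
  times (cos y, sin y) and (- sin y, cos y). Both partial derivatives are left as sums of products
  of a function of x and a function of y, so that the lemma applies again to compute second
  derivatives.\<close>

lemma has_derivative_polar_product:
  fixes A B :: "real \<Rightarrow> real"
  assumes p: "p \<in> half_plane"
    and A: "(A has_field_derivative A') (at (log_radius p))"
    and B: "(B has_field_derivative B') (at (polar_angle p))"
  defines "x \<equiv> log_radius p" and "y \<equiv> polar_angle p"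
  shows "((\<lambda>q. A (log_radius q) * B (polar_angle q)) has_derivative
    (\<lambda>h. (A' * exp (- x) * (B y * cos y) - A x * exp (- x) * (B' * sin y)) * h $ 1
      + (A' * exp (- x) * (B y * sin y) + A x * exp (- x) * (B' * cos y)) * h $ 2)) (at p)"
proof -
  have y: "p $ 2 > 0" using p by (simp add: half_plane_def)
  define \<rho> where "\<rho> = (p $ 1)\<^sup>2 + (p $ 2)\<^sup>2"
  have \<rho>: "\<rho> > 0" using y by (simp add: \<rho>_def add_nonneg_pos)
  have "p = polar_point x y" using polar_point_surj(1) [OF p] by (simp add: x_def y_def)
  then have p12: "p $ 1 = exp x * cos y" "p $ 2 = exp x * sin y"
    by (simp_all add: polar_point_def)
  have "\<rho> = (exp x)\<^sup>2"
    unfolding \<rho>_def p12 power_mult_distrib by (simp flip: distrib_left)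
  then have e: "p $ 1 / \<rho> = exp (- x) * cos y" "p $ 2 / \<rho> = exp (- x) * sin y"
    by (simp_all add: p12 exp_minus field_simps power2_eq_square)
  have "(log_radius has_derivative (\<lambda>h. (2 * (p $ 1) * h $ 1 + 2 * (p $ 2) * h $ 2) * inverse \<rho> / 2)) (at p)"
    unfolding log_radius_def \<rho>_def using \<rho>
    by (auto intro!: derivative_eq_intros bounded_linear.has_derivative [OF bounded_linear_vec_nth]
        simp: \<rho>_def [symmetric])
  then have dX: "(log_radius has_derivative (\<lambda>h. exp (- x) * cos y * h $ 1 + exp (- x) * sin y * h $ 2)) (at p)"
    by (rule has_derivative_eq_rhs) (simp add: fun_eq_iff flip: e, simp add: field_simps)
  have "((\<lambda>q. q $ 1 / q $ 2) has_derivative (\<lambda>h. (h $ 1 * p $ 2 - p $ 1 * h $ 2) / (p $ 2)\<^sup>2)) (at p)"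
    using y by (auto intro!: derivative_eq_intros bounded_linear.has_derivative [OF bounded_linear_vec_nth]
        simp: fun_eq_iff field_simps power2_eq_square)
  moreover have "(arctan has_field_derivative inverse (1 + (p $ 1 / p $ 2)\<^sup>2)) (at (p $ 1 / p $ 2))"
    by (rule DERIV_arctan)
  ultimately have "((\<lambda>q. arctan (q $ 1 / q $ 2)) has_derivative
      (\<lambda>h. inverse (1 + (p $ 1 / p $ 2)\<^sup>2) * ((h $ 1 * p $ 2 - p $ 1 * h $ 2) / (p $ 2)\<^sup>2))) (at p)"
    unfolding has_field_derivative_def by (rule has_derivative_compose)
  then have "(polar_angle has_derivative
      (\<lambda>h. - (inverse (1 + (p $ 1 / p $ 2)\<^sup>2) * ((h $ 1 * p $ 2 - p $ 1 * h $ 2) / (p $ 2)\<^sup>2)))) (at p)"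
    unfolding polar_angle_def
    by (intro has_derivative_eq_rhs [OF has_derivative_diff [OF has_derivative_const]]) auto
  then have dY: "(polar_angle has_derivative (\<lambda>h. exp (- x) * cos y * h $ 2 - exp (- x) * sin y * h $ 1)) (at p)"
  proof (rule has_derivative_eq_rhs, intro ext)
    fix h :: plane
    have "inverse (1 + (p $ 1 / p $ 2)\<^sup>2) = (p $ 2)\<^sup>2 / \<rho>"
      using y \<rho> by (simp add: \<rho>_def field_simps)
    then have "inverse (1 + (p $ 1 / p $ 2)\<^sup>2) * (N / (p $ 2)\<^sup>2) = N / \<rho>" for N
      using y by simp
    then show "- (inverse (1 + (p $ 1 / p $ 2)\<^sup>2) * ((h $ 1 * p $ 2 - p $ 1 * h $ 2) / (p $ 2)\<^sup>2))
        = exp (- x) * cos y * h $ 2 - exp (- x) * sin y * h $ 1"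
      unfolding e [symmetric] by (simp only:) (simp add: diff_divide_distrib mult.commute)
  qed
  have "((\<lambda>q. A (log_radius q)) has_derivative
      (\<lambda>h. A' * (exp (- x) * cos y * h $ 1 + exp (- x) * sin y * h $ 2))) (at p)"
    using has_derivative_compose [OF dX A [unfolded has_field_derivative_def]] by simp
  moreover have "((\<lambda>q. B (polar_angle q)) has_derivative
      (\<lambda>h. B' * (exp (- x) * cos y * h $ 2 - exp (- x) * sin y * h $ 1))) (at p)"
    using has_derivative_compose [OF dY B [unfolded has_field_derivative_def]] by simp
  ultimately show ?thesis
    by (rule has_derivative_eq_rhs [OF has_derivative_mult])
      (simp add: fun_eq_iff x_def [symmetric] y_def [symmetric] algebra_simps)
qed

section \<open>Eigenfunctions and multiplicities\<close>

text \<open>Each derivative of a separated product is a sum of separated products. Second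
  derivatives of \<phi> are eliminated by its equation, so all second partials are built from
  \<phi>, its first derivative and the potential, which makes them continuous in the sector.\<close>

lemma product_eigenfunction:
  assumes "0 < c" and \<theta>: "0 < \<theta>\<^sub>0" "\<theta>\<^sub>0 < \<theta>\<^sub>1" "\<theta>\<^sub>1 < pi"
    and \<phi>: "dirichlet_solution \<theta>\<^sub>0 \<theta>\<^sub>1 (\<lambda>\<theta>. \<mu> * (1 / (sin \<theta>)\<^sup>2) - (real k * c)\<^sup>2) \<phi>"
  shows "(\<lambda>p. if p \<in> polar_sector c \<theta>\<^sub>0 \<theta>\<^sub>1
      then sin (real k * c * log_radius p) * \<phi> (polar_angle p) else 0)
    \<in> dirichlet_eigenspace (polar_sector c \<theta>\<^sub>0 \<theta>\<^sub>1) \<mu>"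
proof -
  define \<Omega> where "\<Omega> = polar_sector c \<theta>\<^sub>0 \<theta>\<^sub>1"
  define \<omega> where "\<omega> = real k * c"
  have op: "open \<Omega>" unfolding \<Omega>_def by (rule open_polar_sector [OF \<theta>(1,3)])
  have \<Omega>: "p \<in> half_plane" "polar_angle p \<in> {\<theta>\<^sub>0<..<\<theta>\<^sub>1}" if "p \<in> \<Omega>" for p
    using that in_polar_sector_iff [OF \<theta>(1,3)] by (auto simp: \<Omega>_def)
  define q where "q = (\<lambda>\<theta>. \<mu> * (1 / (sin \<theta>)\<^sup>2) - \<omega>\<^sup>2)"
  from \<phi> have c\<phi>: "continuous_on {\<theta>\<^sub>0..\<theta>\<^sub>1} \<phi>" and \<phi>0: "\<phi> \<theta>\<^sub>0 = 0" "\<phi> \<theta>\<^sub>1 = 0"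
    by (auto simp: dirichlet_solution_def)
  from \<phi> obtain \<phi>' where "\<forall>s\<in>{\<theta>\<^sub>0<..<\<theta>\<^sub>1}. (\<phi> has_field_derivative \<phi>' s) (at s) \<and>
      (\<phi>' has_field_derivative - q s * \<phi> s) (at s)"
    unfolding dirichlet_solution_def q_def \<omega>_def by blast
  then have d\<phi>: "\<And>s. s \<in> {\<theta>\<^sub>0<..<\<theta>\<^sub>1} \<Longrightarrow> (\<phi> has_field_derivative \<phi>' s) (at s)"
    and d\<phi>': "\<And>s. s \<in> {\<theta>\<^sub>0<..<\<theta>\<^sub>1} \<Longrightarrow> (\<phi>' has_field_derivative - q s * \<phi> s) (at s)"
    by blast+
  define f where "f = (\<lambda>t. sin (\<omega> * t))"
  define f1 where "f1 = (\<lambda>t. \<omega> * cos (\<omega> * t))"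
  \<comment> \<open>The radial factors \<open>a0\<close>, \<open>a1\<close> carry \<open>f\<close>
    and its derivative; the angular factors \<open>b0\<close>, \<open>b1\<close> carry \<phi> and
    \<open>e0\<close>, \<open>e1\<close> carry its derivative, with index 0 for the cosine and 1 for
    the sine. Primes denote derivatives.\<close>
  define a0 where "a0 = (\<lambda>t. f t * exp (- t))"
  define a0' where "a0' = (\<lambda>t. (f1 t - f t) * exp (- t))"
  define a1 where "a1 = (\<lambda>t. f1 t * exp (- t))"
  define a1' where "a1' = (\<lambda>t. (- \<omega>\<^sup>2 * f t - f1 t) * exp (- t))"
  define b0 where "b0 = (\<lambda>s. \<phi> s * cos s)"
  define b0' where "b0' = (\<lambda>s. \<phi>' s * cos s - \<phi> s * sin s)"
  define b1 where "b1 = (\<lambda>s. \<phi> s * sin s)"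
  define b1' where "b1' = (\<lambda>s. \<phi>' s * sin s + \<phi> s * cos s)"
  define e0 where "e0 = (\<lambda>s. \<phi>' s * cos s)"
  define e0' where "e0' = (\<lambda>s. - q s * \<phi> s * cos s - \<phi>' s * sin s)"
  define e1 where "e1 = (\<lambda>s. \<phi>' s * sin s)"
  define e1' where "e1' = (\<lambda>s. - q s * \<phi> s * sin s + \<phi>' s * cos s)"
  have df: "(f has_field_derivative f1 t) (at t)" for t
    unfolding f_def f1_def by (auto intro!: derivative_eq_intros)
  have df1: "(f1 has_field_derivative - \<omega>\<^sup>2 * f t) (at t)" for t
    unfolding f_def f1_def by (auto intro!: derivative_eq_intros simp: power2_eq_square)
  have da: "(a0 has_field_derivative a0' t) (at t)" "(a1 has_field_derivative a1' t) (at t)" for t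
    unfolding a0_def a0'_def a1_def a1'_def
    by (auto intro!: derivative_eq_intros df df1 simp: algebra_simps)
  have db: "(b0 has_field_derivative b0' s) (at s)" "(b1 has_field_derivative b1' s) (at s)"
    "(e0 has_field_derivative e0' s) (at s)" "(e1 has_field_derivative e1' s) (at s)"
    if "s \<in> {\<theta>\<^sub>0<..<\<theta>\<^sub>1}" for s
    unfolding b0_def b0'_def b1_def b1'_def e0_def e0'_def e1_def e1'_def
    by (auto intro!: derivative_eq_intros d\<phi> [OF that] d\<phi>' [OF that] simp: algebra_simps)
  define T :: "(real \<Rightarrow> real) \<Rightarrow> (real \<Rightarrow> real) \<Rightarrow> plane \<Rightarrow> real"
    where "T = (\<lambda>A B p. A (log_radius p) * B (polar_angle p))"
  define D1 where "D1 = (\<lambda>A A' B B' p. T (\<lambda>t. A' t * exp (- t)) (\<lambda>s. B s * cos s) p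
      - T (\<lambda>t. A t * exp (- t)) (\<lambda>s. B' s * sin s) p)"
  define D2 where "D2 = (\<lambda>A A' B B' p. T (\<lambda>t. A' t * exp (- t)) (\<lambda>s. B s * sin s) p
      + T (\<lambda>t. A t * exp (- t)) (\<lambda>s. B' s * cos s) p)"
  have dT: "(T A B has_derivative (\<lambda>h. D1 A A' B B' p * h $ 1 + D2 A A' B B' p * h $ 2)) (at p)"
    if "p \<in> \<Omega>" "\<And>t. (A has_field_derivative A' t) (at t)"
      "\<And>s. s \<in> {\<theta>\<^sub>0<..<\<theta>\<^sub>1} \<Longrightarrow> (B has_field_derivative B' s) (at s)" for A A' B B' p
    using has_derivative_polar_product [OF \<Omega>(1) [OF that(1)] that(2) that(3) [OF \<Omega>(2) [OF that(1)]]]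
    unfolding T_def D1_def D2_def by simp
  have transfer: "g differentiable at p" "partial 1 g p = A" "partial 2 g p = B"
    if "p \<in> \<Omega>" "(h has_derivative (\<lambda>v. A * v $ 1 + B * v $ 2)) (at p)"
      "\<And>x. x \<in> \<Omega> \<Longrightarrow> g x = h x" for g h A B p
  proof -
    have "(g has_derivative (\<lambda>v. A * v $ 1 + B * v $ 2)) (at p)"
      by (rule has_derivative_transform_within_open [OF that(2) op that(1)]) (simp add: that(3))
    then show "g differentiable at p" "partial 1 g p = A" "partial 2 g p = B"
      by (auto simp: differentiable_def intro: partial_eqI)
  qed
  define v where "v = (\<lambda>p. if p \<in> \<Omega> then T f \<phi> p else 0)"
  have v: "v p = T f \<phi> p" if "p \<in> \<Omega>" for p using that by (simp add: v_def)
  note dv = transfer [OF _ dT [OF _ df d\<phi>] v]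
  have v1: "partial 1 v p = T a1 b0 p - T a0 e1 p" and v2: "partial 2 v p = T a1 b1 p + T a0 e0 p"
    if "p \<in> \<Omega>" for p
    using dv(2,3) [OF that that] by (simp_all add: D1_def D2_def a0_def a1_def b0_def b1_def e0_def e1_def)
  have dv1: "((\<lambda>p. T a1 b0 p - T a0 e1 p) has_derivative
      (\<lambda>h. (D1 a1 a1' b0 b0' p - D1 a0 a0' e1 e1' p) * h $ 1 + (D2 a1 a1' b0 b0' p - D2 a0 a0' e1 e1' p) * h $ 2)) (at p)"
    if "p \<in> \<Omega>" for p
    by (rule has_derivative_eq_rhs [OF has_derivative_diff [OF dT [OF that da(2) db(1)] dT [OF that da(1) db(4)]]])
      (auto simp: algebra_simps)
  have dv2: "((\<lambda>p. T a1 b1 p + T a0 e0 p) has_derivative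
      (\<lambda>h. (D1 a1 a1' b1 b1' p + D1 a0 a0' e0 e0' p) * h $ 1 + (D2 a1 a1' b1 b1' p + D2 a0 a0' e0 e0' p) * h $ 2)) (at p)"
    if "p \<in> \<Omega>" for p
    by (rule has_derivative_eq_rhs [OF has_derivative_add [OF dT [OF that da(2) db(2)] dT [OF that da(1) db(3)]]])
      (auto simp: algebra_simps)
  note ddv1 = transfer [OF _ dv1 v1] and ddv2 = transfer [OF _ dv2 v2]
  have cT: "continuous_on \<Omega> (T A B)" if "continuous_on UNIV A" "continuous_on {\<theta>\<^sub>0<..<\<theta>\<^sub>1} B" for A B
  proof -
    have "continuous_on \<Omega> log_radius" "continuous_on \<Omega> polar_angle"
      using \<Omega>(1) by (auto intro: continuous_on_subset continuous_on_log_radius continuous_on_polar_angle)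
    then show ?thesis
      unfolding T_def using \<Omega>(2)
      by (intro continuous_on_mult continuous_on_compose2 [OF that(1)] continuous_on_compose2 [OF that(2)]) auto
  qed
  have cs: "continuous_on {\<theta>\<^sub>0<..<\<theta>\<^sub>1} \<phi>" "continuous_on {\<theta>\<^sub>0<..<\<theta>\<^sub>1} \<phi>'" "continuous_on {\<theta>\<^sub>0<..<\<theta>\<^sub>1} q"
  proof -
    show "continuous_on {\<theta>\<^sub>0<..<\<theta>\<^sub>1} \<phi>"
      by (rule DERIV_continuous_on) (rule has_field_derivative_at_within [OF d\<phi>])
    show "continuous_on {\<theta>\<^sub>0<..<\<theta>\<^sub>1} \<phi>'"
      by (rule DERIV_continuous_on) (rule has_field_derivative_at_within [OF d\<phi>'])
    show "continuous_on {\<theta>\<^sub>0<..<\<theta>\<^sub>1} q"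
      unfolding q_def
    proof (intro continuous_intros ballI)
      fix x assume "x \<in> {\<theta>\<^sub>0<..<\<theta>\<^sub>1}"
      then have "sin x > 0" using \<theta> by (intro sin_gt_zero) auto
      then show "(sin x)\<^sup>2 \<noteq> 0" by simp
    qed
  qed
  have cD: "continuous_on \<Omega> (D1 A A' B B')" "continuous_on \<Omega> (D2 A A' B B')"
    if "continuous_on UNIV A" "continuous_on UNIV A'" "continuous_on {\<theta>\<^sub>0<..<\<theta>\<^sub>1} B" "continuous_on {\<theta>\<^sub>0<..<\<theta>\<^sub>1} B'"
    for A A' B B'
    unfolding D1_def D2_def by (intro continuous_intros cT that)+
  have ca: "continuous_on UNIV a0" "continuous_on UNIV a0'" "continuous_on UNIV a1" "continuous_on UNIV a1'"
    unfolding a0_def a0'_def a1_def a1'_def f_def f1_def by (intro continuous_intros)+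
  have cb: "continuous_on {\<theta>\<^sub>0<..<\<theta>\<^sub>1} b0" "continuous_on {\<theta>\<^sub>0<..<\<theta>\<^sub>1} b0'"
    "continuous_on {\<theta>\<^sub>0<..<\<theta>\<^sub>1} b1" "continuous_on {\<theta>\<^sub>0<..<\<theta>\<^sub>1} b1'"
    "continuous_on {\<theta>\<^sub>0<..<\<theta>\<^sub>1} e0" "continuous_on {\<theta>\<^sub>0<..<\<theta>\<^sub>1} e0'"
    "continuous_on {\<theta>\<^sub>0<..<\<theta>\<^sub>1} e1" "continuous_on {\<theta>\<^sub>0<..<\<theta>\<^sub>1} e1'"
    unfolding b0_def b0'_def b1_def b1'_def e0_def e0'_def e1_def e1'_def
    by (intro continuous_intros cs)+
  have "C2_on \<Omega> v"
    unfolding C2_on_def forall_2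
  proof (intro conjI ballI)
    fix p assume p: "p \<in> \<Omega>"
    show "v differentiable at p" by (rule dv(1) [OF p p])
    show "partial 1 v differentiable at p" by (rule ddv1(1) [OF p p])
    show "partial 2 v differentiable at p" by (rule ddv2(1) [OF p p])
  next
    have cong: "continuous_on \<Omega> g" if "continuous_on \<Omega> h" "\<And>p. p \<in> \<Omega> \<Longrightarrow> g p = h p" for g h :: "plane \<Rightarrow> real"
      using continuous_on_cong [of \<Omega> \<Omega> g h] that by auto
    show "continuous_on \<Omega> (partial 1 (partial 1 v))" "continuous_on \<Omega> (partial 2 (partial 1 v))"
      by (rule cong [OF _ ddv1(2)] cong [OF _ ddv1(3)]; (assumption | intro continuous_on_diff cD ca cb))+
    show "continuous_on \<Omega> (partial 1 (partial 2 v))" "continuous_on \<Omega> (partial 2 (partial 2 v))"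
      by (rule cong [OF _ ddv2(2)] cong [OF _ ddv2(3)]; (assumption | intro continuous_on_add cD ca cb))+
  qed
  moreover have "continuous_on (closure \<Omega>) v"
  proof -
    have cl: "x \<in> half_plane \<and> polar_angle x \<in> {\<theta>\<^sub>0..\<theta>\<^sub>1} \<and> log_radius x \<in> {0..pi / c}" if "x \<in> closure \<Omega>" for x
      using that \<theta> unfolding \<Omega>_def closure_polar_sector [OF \<open>0 < c\<close> \<theta>] by (auto simp: polar_point_coordinates)
    \<comment> \<open>On the boundary either the radial sine is zero, its argument being 0 or k pi,
      or \<phi> is zero; so the cut-off does not break continuity.\<close>
    have "v p = T f \<phi> p" if "p \<in> closure \<Omega>" for p
    proof (cases "p \<in> \<Omega>")
      case False
      then have "log_radius p \<in> {0, pi / c} \<or> polar_angle p \<in> {\<theta>\<^sub>0, \<theta>\<^sub>1}"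
        using cl [OF that] in_polar_sector_iff [OF \<theta>(1,3), of p c] by (auto simp: \<Omega>_def)
      moreover have "\<omega> * (pi / c) = real k * pi" using \<open>0 < c\<close> by (simp add: \<omega>_def)
      ultimately have "T f \<phi> p = 0" using \<phi>0 by (auto simp: T_def f_def)
      with False show ?thesis by (simp add: v_def)
    qed (simp add: v_def)
    moreover have "continuous_on (closure \<Omega>) (T f \<phi>)"
    proof -
      have "continuous_on (closure \<Omega>) log_radius" "continuous_on (closure \<Omega>) polar_angle"
        using cl by (auto intro: continuous_on_subset continuous_on_log_radius continuous_on_polar_angle)
      then show ?thesis
        unfolding T_def f_def using cl
        by (intro continuous_intros continuous_on_compose2 [OF c\<phi>]) auto
    qed
    ultimately show ?thesis using continuous_on_cong [of "closure \<Omega>" "closure \<Omega>" v "T f \<phi>"] by auto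
  qed
  moreover have "- hyp_laplacian v p = \<mu> * v p" if p: "p \<in> \<Omega>" for p
  proof -
    define x where "x = log_radius p"
    define y where "y = polar_angle p"
    have y: "sin y > 0"
      using \<Omega>(2) [OF p] \<theta> by (intro sin_gt_zero) (auto simp: y_def)
    have "p = polar_point x y" using polar_point_surj(1) [OF \<Omega>(1) [OF p]] by (simp add: x_def y_def)
    then have p2: "p $ 2 = exp x * sin y" by (simp add: polar_point_def)
    have "partial 1 (partial 1 v) p + partial 2 (partial 2 v) p
        = (D1 a1 a1' b0 b0' p - D1 a0 a0' e1 e1' p) + (D2 a1 a1' b1 b1' p + D2 a0 a0' e0 e0' p)"
      using ddv1(2) [OF p p] ddv2(3) [OF p p] by simp
    \<comment> \<open>A polynomial identity with sin y and cos y as independent variables, which is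
      why the sum of their squares is left standing; the last summand is zero.\<close>
    also have "\<dots> = (exp (- x))\<^sup>2 * ((sin y)\<^sup>2 + (cos y)\<^sup>2) * (- \<omega>\<^sup>2 * f x * \<phi> y - f x * q y * \<phi> y)
        + (exp (- x))\<^sup>2 * f1 x * \<phi> y * ((sin y)\<^sup>2 + (cos y)\<^sup>2 - ((sin y)\<^sup>2 + (cos y)\<^sup>2))"
      unfolding D1_def D2_def T_def x_def [symmetric] y_def [symmetric]
        a0_def a0'_def a1_def a1'_def b0_def b0'_def b1_def b1'_def e0_def e0'_def e1_def e1'_def
      by algebra
    also have "\<dots> = (exp (- x))\<^sup>2 * (- (\<mu> / (sin y)\<^sup>2) * (f x * \<phi> y))"
      by (simp add: q_def algebra_simps)
    finally have "hyp_laplacian v p = (exp x * sin y)\<^sup>2 * ((exp (- x))\<^sup>2 * (- (\<mu> / (sin y)\<^sup>2) * (f x * \<phi> y)))"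
      unfolding hyp_laplacian_eq [OF \<Omega>(1) [OF p]] p2 by (rule arg_cong)
    also have "\<dots> = (exp x * exp (- x))\<^sup>2 * ((sin y)\<^sup>2 / (sin y)\<^sup>2) * (- \<mu> * (f x * \<phi> y))"
      by (simp add: power_mult_distrib algebra_simps)
    also have "\<dots> = - \<mu> * (f x * \<phi> y)"
      using y by (simp flip: exp_add)
    finally show ?thesis using p by (simp add: v_def T_def x_def y_def)
  qed
  moreover have "\<forall>p. p \<notin> \<Omega> \<longrightarrow> v p = 0" by (simp add: v_def)
  ultimately have "v \<in> dirichlet_eigenspace \<Omega> \<mu>" by (auto simp: dirichlet_eigenspace_def)
  then show ?thesis unfolding v_def T_def f_def \<omega>_def \<Omega>_def .
qed

text \<open>On the ray of fixed angle, subtract from \<open>u\<close> the multiple of sin (c t) with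
  the same first coefficient. The remainder is orthogonal to every sine, hence zero. The factor 2 c
  / pi is the reciprocal of the integral of the squared sine.\<close>

lemma eigenfunction_first_mode:
  assumes "0 < c" and \<theta>: "0 < \<theta>\<^sub>0" "\<theta>\<^sub>0 < \<theta>\<^sub>1" "\<theta>\<^sub>1 < pi"
    and u: "u \<in> dirichlet_eigenspace (polar_sector c \<theta>\<^sub>0 \<theta>\<^sub>1) \<mu>"
    and coeff: "\<And>k \<theta>. k \<noteq> 1 \<Longrightarrow> \<theta> \<in> {\<theta>\<^sub>0..\<theta>\<^sub>1} \<Longrightarrow>
      integral {0..pi / c} (\<lambda>t. u (polar_point t \<theta>) * sin (real k * c * t)) = 0"
    and p: "p \<in> polar_sector c \<theta>\<^sub>0 \<theta>\<^sub>1"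
  shows "u p = 2 * c / pi * integral {0..pi / c} (\<lambda>t. u (polar_point t (polar_angle p)) * sin (c * t))
    * sin (c * log_radius p)"
proof -
  define \<theta> where "\<theta> = polar_angle p"
  have p': "p \<in> half_plane" "log_radius p \<in> {0<..<pi / c}" "\<theta> \<in> {\<theta>\<^sub>0<..<\<theta>\<^sub>1}"
    using p in_polar_sector_iff [OF \<theta>(1,3)] by (auto simp: \<theta>_def)
  define F where "F = integral {0..pi / c} (\<lambda>t. u (polar_point t \<theta>) * sin (c * t))"
  define g where "g = (\<lambda>t. u (polar_point t \<theta>) - 2 * c / pi * F * sin (c * t))"
  have cu: "continuous_on {0..pi / c} (\<lambda>t. u (polar_point t \<theta>))"
  proof -
    have 1: "continuous_on (closure (polar_sector c \<theta>\<^sub>0 \<theta>\<^sub>1)) u"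
      using u by (simp add: dirichlet_eigenspace_def)
    have 2: "continuous_on {0..pi / c} (\<lambda>t. polar_point t \<theta>)"
    proof -
      have "continuous_on {0..pi / c} (\<lambda>t. (t, \<theta>))" by (intro continuous_intros)
      from continuous_on_compose2 [OF continuous_on_polar_point [of UNIV] this] show ?thesis by simp
    qed
    have "(\<lambda>t. polar_point t \<theta>) ` {0..pi / c} \<subseteq> closure (polar_sector c \<theta>\<^sub>0 \<theta>\<^sub>1)"
      unfolding closure_polar_sector [OF \<open>0 < c\<close> \<theta>] using p'(3) by auto
    then show ?thesis by (rule continuous_on_compose2 [OF 1 2])
  qed
  have "g (log_radius p) = 0"
  proof (rule sine_system_complete [OF \<open>0 < c\<close> _ _ p'(2)])
    show "continuous_on {0..pi / c} g" unfolding g_def by (intro continuous_intros cu)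
    fix k :: nat
    have "integral {0..pi / c} (\<lambda>t. g t * sin (real k * c * t))
        = integral {0..pi / c} (\<lambda>t. u (polar_point t \<theta>) * sin (real k * c * t)
            - 2 * c / pi * F * (sin (c * t) * sin (real k * c * t)))"
      by (simp add: g_def algebra_simps)
    also have "\<dots> = integral {0..pi / c} (\<lambda>t. u (polar_point t \<theta>) * sin (real k * c * t))
        - integral {0..pi / c} (\<lambda>t. 2 * c / pi * F * (sin (c * t) * sin (real k * c * t)))"
      by (intro integral_diff integrable_continuous_real continuous_intros cu)
    also have "\<dots> = 0"
    proof (cases "k = 1")
      case True
      then show ?thesis
        using sine_square_integral [OF \<open>0 < c\<close>] \<open>0 < c\<close> by (simp add: F_def [symmetric])
    next
      case False
      then show ?thesis
        using sine_orthogonal [OF \<open>0 < c\<close> False] coeff [OF False] p'(3) by simp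
    qed
    finally show "integral {0..pi / c} (\<lambda>t. g t * sin (real k * c * t)) = 0" .
  qed
  moreover have "polar_point (log_radius p) \<theta> = p" using polar_point_surj(1) [OF p'(1)] by (simp add: \<theta>_def)
  ultimately show ?thesis by (simp add: g_def F_def \<theta>_def)
qed

section \<open>Multiplicities read off from a description of the eigenspace\<close>

lemma dirichlet_multiplicity_eq_0:
  assumes "\<And>u. u \<in> dirichlet_eigenspace \<Omega> \<mu> \<Longrightarrow> u = (\<lambda>_. 0)"
  shows "dirichlet_multiplicity \<Omega> \<mu> = 0"
proof -
  have "card B = 0" if "B \<subseteq> dirichlet_eigenspace \<Omega> \<mu>" "fun_space.independent B" for B
  proof -
    have "B \<subseteq> {0}" using that(1) assms by (auto simp: zero_fun_def)
    moreover have "0 \<notin> B" using that(2) fun_space.dependent_zero by blast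
    ultimately have "B = {}" by blast
    then show ?thesis by simp
  qed
  then have "dirichlet_multiplicity \<Omega> \<mu> \<le> 0"
    unfolding dirichlet_multiplicity_def by (intro SUP_least) (auto simp: zero_enat_def)
  then show ?thesis by simp
qed

lemma dirichlet_multiplicity_le_1:
  assumes "\<And>u. u \<in> dirichlet_eigenspace \<Omega> \<mu> \<Longrightarrow> \<exists>M. u = (\<lambda>p. M * v p)"
  shows "dirichlet_multiplicity \<Omega> \<mu> \<le> 1"
proof -
  have "card B \<le> 1" if B: "B \<subseteq> dirichlet_eigenspace \<Omega> \<mu>" "fun_space.independent B" for B
  proof -
    have "B \<subseteq> fun_space.span {v}"
    proof
      fix u assume "u \<in> B"
      then obtain M where "u = (\<lambda>p. M * v p)" using B(1) assms by blast
      then show "u \<in> fun_space.span {v}"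
        by (simp add: fun_space.span_scale fun_space.span_base)
    qed
    then show ?thesis using fun_space.independent_span_bound [of "{v}" B] B(2) by simp
  qed
  then show ?thesis
    unfolding dirichlet_multiplicity_def by (intro SUP_least) (auto simp: one_enat_def)
qed

lemma dirichlet_multiplicity_ge_1:
  assumes "u \<in> dirichlet_eigenspace \<Omega> \<mu>" "u p \<noteq> 0"
  shows "1 \<le> dirichlet_multiplicity \<Omega> \<mu>"
proof -
  have "u \<noteq> 0" using assms(2) by auto
  then have "fun_space.independent {u}"
    by (simp add: fun_space.independent_insert fun_space.independent_empty)
  then show ?thesis
    unfolding dirichlet_multiplicity_def using assms(1)
    by (intro SUP_upper2 [of "{u}"]) (auto simp: one_enat_def)
qed

section \<open>The spectral gap\<close>

text \<open>Position 2 is decided by two counts: at most one eigenvalue below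
  \<open>\<mu>\<^sub>2\<close> and at least two up to it. The eigenspace of
  \<open>\<mu>\<^sub>2\<close> may have any positive dimension.\<close>

lemma first_two_eigenvalues:
  assumes simple: "\<And>u. u \<in> dirichlet_eigenspace \<Omega> \<mu>\<^sub>1 \<Longrightarrow> \<exists>M. u = (\<lambda>p. M * v p)"
    and none: "\<And>\<mu> u. \<mu> < \<mu>\<^sub>2 \<Longrightarrow> \<mu> \<noteq> \<mu>\<^sub>1 \<Longrightarrow> u \<in> dirichlet_eigenspace \<Omega> \<mu> \<Longrightarrow> u = (\<lambda>_. 0)"
    and "\<mu>\<^sub>1 < \<mu>\<^sub>2"
    and u1: "u\<^sub>1 \<in> dirichlet_eigenspace \<Omega> \<mu>\<^sub>1" "u\<^sub>1 p\<^sub>1 \<noteq> 0"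
    and u2: "u\<^sub>2 \<in> dirichlet_eigenspace \<Omega> \<mu>\<^sub>2" "u\<^sub>2 p\<^sub>2 \<noteq> 0"
  shows "is_dirichlet_eigenvalue \<Omega> 1 \<mu>\<^sub>1" "is_dirichlet_eigenvalue \<Omega> 2 \<mu>\<^sub>2"
proof -
  let ?m = "dirichlet_multiplicity \<Omega>"
  have m0: "?m \<mu> = 0" if "\<mu> < \<mu>\<^sub>2" "\<mu> \<noteq> \<mu>\<^sub>1" for \<mu>
    by (rule dirichlet_multiplicity_eq_0) (rule none [OF that])
  have m1: "?m \<mu>\<^sub>1 \<le> 1" by (rule dirichlet_multiplicity_le_1) (rule simple)
  have g1: "1 \<le> ?m \<mu>\<^sub>1" by (rule dirichlet_multiplicity_ge_1 [OF u1])
  have g2: "1 \<le> ?m \<mu>\<^sub>2" by (rule dirichlet_multiplicity_ge_1 [OF u2])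
  have "dirichlet_count \<Omega> {..<\<mu>\<^sub>1} \<le> 0"
    unfolding dirichlet_count_def
  proof (rule SUP_least)
    fix F assume "F \<in> {F. finite F \<and> F \<subseteq> {..<\<mu>\<^sub>1}}"
    then have "?m \<mu> = 0" if "\<mu> \<in> F" for \<mu> using that \<open>\<mu>\<^sub>1 < \<mu>\<^sub>2\<close> by (intro m0) auto
    then show "(\<Sum>\<mu>\<in>F. ?m \<mu>) \<le> 0" by simp
  qed
  moreover have "?m \<mu>\<^sub>1 \<le> dirichlet_count \<Omega> {..\<mu>\<^sub>1}"
    unfolding dirichlet_count_def by (rule SUP_upper2 [of "{\<mu>\<^sub>1}"]) auto
  ultimately show "is_dirichlet_eigenvalue \<Omega> 1 \<mu>\<^sub>1"
    using g1 order_trans unfolding is_dirichlet_eigenvalue_def one_enat_def [symmetric] by fastforce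
  have "dirichlet_count \<Omega> {..<\<mu>\<^sub>2} \<le> 1"
    unfolding dirichlet_count_def
  proof (rule SUP_least)
    fix F assume F: "F \<in> {F. finite F \<and> F \<subseteq> {..<\<mu>\<^sub>2}}"
    then have "(\<Sum>\<mu>\<in>F. ?m \<mu>) \<le> (\<Sum>\<mu>\<in>F. if \<mu> = \<mu>\<^sub>1 then 1 else 0)"
      using m0 m1 by (intro sum_mono) auto
    also have "\<dots> \<le> 1" using F by (simp add: sum.delta)
    finally show "(\<Sum>\<mu>\<in>F. ?m \<mu>) \<le> 1" .
  qed
  also have "(1 :: enat) < enat 2" by (simp add: one_enat_def)
  finally have "dirichlet_count \<Omega> {..<\<mu>\<^sub>2} < enat 2" .
  moreover have "?m \<mu>\<^sub>1 + ?m \<mu>\<^sub>2 \<le> dirichlet_count \<Omega> {..\<mu>\<^sub>2}"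
    unfolding dirichlet_count_def
    using \<open>\<mu>\<^sub>1 < \<mu>\<^sub>2\<close> by (intro SUP_upper2 [of "{\<mu>\<^sub>1, \<mu>\<^sub>2}"]) auto
  moreover have "enat 2 \<le> ?m \<mu>\<^sub>1 + ?m \<mu>\<^sub>2"
    using add_mono [OF g1 g2] by (simp add: one_enat_def numeral_2_eq_2)
  ultimately show "is_dirichlet_eigenvalue \<Omega> 2 \<mu>\<^sub>2"
    unfolding is_dirichlet_eigenvalue_def by (meson order_trans)
qed

text \<open>Origin of the constants: the angular width is at most 2 m, so
  \<open>32 * c\<^sup>2 * m\<^sup>2 \<le> pi\<^sup>2\<close> gives
  \<open>8 * c\<^sup>2 \<le> \<kappa>\<^sup>2\<close>, and the separation constants c^2 and 4 c^2
  add at most half of \<kappa>^2; both ground levels are then at most 3/2 \<kappa>^2. The bound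
  15/16 keeps the weight below 16/15, so potentials stay below 8/5 \<kappa>^2, within the comparison
  bound 2 \<kappa>^2. The same two bounds turn the smallness condition for the ground states into pi
  / 10 \<le> 1/2.\<close>

lemma polar_sector_spectral_gap:
  assumes "0 < c" and \<theta>: "0 < \<theta>\<^sub>0" "\<theta>\<^sub>0 < pi / 2" "pi / 2 < \<theta>\<^sub>1" "\<theta>\<^sub>1 < pi"
    and m: "m = pi / 2 - min \<theta>\<^sub>0 (pi - \<theta>\<^sub>1)"
    and small: "15 / 16 \<le> (cos m)\<^sup>2" "32 * c\<^sup>2 * m\<^sup>2 \<le> pi\<^sup>2"
  shows "\<exists>\<mu>\<^sub>1 \<mu>\<^sub>2. is_dirichlet_eigenvalue (polar_sector c \<theta>\<^sub>0 \<theta>\<^sub>1) 1 \<mu>\<^sub>1 \<and>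
    is_dirichlet_eigenvalue (polar_sector c \<theta>\<^sub>0 \<theta>\<^sub>1) 2 \<mu>\<^sub>2 \<and> 3 * c\<^sup>2 * (cos m)\<^sup>2 \<le> \<mu>\<^sub>2 - \<mu>\<^sub>1"
proof -
  define \<Omega> where "\<Omega> = polar_sector c \<theta>\<^sub>0 \<theta>\<^sub>1"
  define \<kappa> where "\<kappa> = pi / (\<theta>\<^sub>1 - \<theta>\<^sub>0)"
  define C where "C = (cos m)\<^sup>2"
  define w :: "real \<Rightarrow> real" where "w = (\<lambda>\<theta>. 1 / (sin \<theta>)\<^sup>2)"
  define A where "A = (\<lambda>k :: nat. (real k * c)\<^sup>2)"
  have \<theta>': "\<theta>\<^sub>0 < \<theta>\<^sub>1" using \<theta> by linarith
  have m0: "0 < m" "m < pi / 2" using \<theta> by (auto simp: m min_def)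
  have cm: "0 < cos m" using m0 by (intro cos_gt_zero) auto
  have C: "15 / 16 \<le> C" "0 < C" using small(1) by (auto simp: C_def)
  have w: "1 \<le> w t" "w t \<le> 1 / C" if "t \<in> {\<theta>\<^sub>0..\<theta>\<^sub>1}" for t
  proof -
    have "\<bar>t - pi / 2\<bar> \<le> m" using that by (auto simp: m abs_if)
    then have "cos m \<le> cos \<bar>t - pi / 2\<bar>"
      using m0 by (intro cos_monotone_0_pi_le) auto
    also have "\<dots> = sin t" by (simp add: cos_diff)
    finally have "cos m \<le> sin t" .
    then have "(cos m)\<^sup>2 \<le> (sin t)\<^sup>2" using cm by (intro power_mono) auto
    moreover have "(sin t)\<^sup>2 \<le> 1" by (simp add: abs_square_le_1)
    ultimately show "1 \<le> w t" "w t \<le> 1 / C" using C by (auto simp: w_def C_def divide_simps)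
  qed
  have cw: "continuous_on {\<theta>\<^sub>0..\<theta>\<^sub>1} w"
    unfolding w_def
  proof (intro continuous_intros ballI)
    fix x assume "x \<in> {\<theta>\<^sub>0..\<theta>\<^sub>1}"
    then have "sin x > 0" using \<theta> by (intro sin_gt_zero) auto
    then show "(sin x)\<^sup>2 \<noteq> 0" by simp
  qed
  have \<kappa>0: "0 < \<kappa>" using \<theta>' by (simp add: \<kappa>_def)
  have \<kappa>: "8 * c\<^sup>2 \<le> \<kappa>\<^sup>2"
  proof -
    have d: "\<theta>\<^sub>1 - \<theta>\<^sub>0 \<le> 2 * m" using \<theta> by (auto simp: m min_def)
    have "8 * c\<^sup>2 * (\<theta>\<^sub>1 - \<theta>\<^sub>0)\<^sup>2 \<le> 8 * c\<^sup>2 * (2 * m)\<^sup>2"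
      using d \<theta>' by (intro mult_left_mono power_mono) auto
    also have "\<dots> \<le> pi\<^sup>2" using small(2) by (simp add: power_mult_distrib)
    finally show ?thesis using \<theta>' by (simp add: \<kappa>_def power_divide field_simps)
  qed
  have A: "0 \<le> A k" "A 1 = c\<^sup>2" "A 2 = 4 * c\<^sup>2" for k by (auto simp: A_def power_mult_distrib)
  have ground: "\<exists>\<mu> \<phi>. \<mu> \<le> \<kappa>\<^sup>2 + A k \<and> dirichlet_solution \<theta>\<^sub>0 \<theta>\<^sub>1 (\<lambda>t. \<mu> * w t - A k) \<phi> \<and>
      (\<forall>t\<in>{\<theta>\<^sub>0<..<\<theta>\<^sub>1}. 0 < \<phi> t)" if "A k \<le> 4 * c\<^sup>2" for k
  proof (rule dirichlet_ground_state_exists [OF \<theta>' cw C(2) A(1) _ \<kappa>_def])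
    have "(\<kappa>\<^sup>2 + A k) * (1 / C - 1) \<le> (3 / 2 * \<kappa>\<^sup>2) * (1 / 15)"
    proof (intro mult_mono)
      show "1 / C - 1 \<le> 1 / 15" "0 \<le> 1 / C - 1"
        using C by (auto simp: field_simps C_def abs_square_le_1)
    qed (use that \<kappa> in auto)
    then have "(\<kappa>\<^sup>2 + A k) * (1 / C - 1) * ((\<theta>\<^sub>1 - \<theta>\<^sub>0) / \<kappa>) \<le> (3 / 2 * \<kappa>\<^sup>2) * (1 / 15) * ((\<theta>\<^sub>1 - \<theta>\<^sub>0) / \<kappa>)"
      using \<theta>' \<kappa>0 by (intro mult_right_mono) auto
    also have "\<dots> = pi / 10" using \<theta>' by (simp add: \<kappa>_def power2_eq_square)
    also have "\<dots> \<le> 1 / 2" using pi_less_4 by simp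
    finally show "(\<kappa>\<^sup>2 + A k) * (1 / C - 1) * (\<theta>\<^sub>1 - \<theta>\<^sub>0) / \<kappa> \<le> 1 / 2" by simp
  qed (use w in auto)
  obtain \<mu>\<^sub>1 \<phi>\<^sub>1 where \<phi>1: "\<mu>\<^sub>1 \<le> \<kappa>\<^sup>2 + A 1" "dirichlet_solution \<theta>\<^sub>0 \<theta>\<^sub>1 (\<lambda>t. \<mu>\<^sub>1 * w t - A 1) \<phi>\<^sub>1"
    "\<forall>t\<in>{\<theta>\<^sub>0<..<\<theta>\<^sub>1}. 0 < \<phi>\<^sub>1 t"
    using ground [of 1] A by auto
  obtain \<mu>\<^sub>2 \<phi>\<^sub>2 where \<phi>2: "\<mu>\<^sub>2 \<le> \<kappa>\<^sup>2 + A 2" "dirichlet_solution \<theta>\<^sub>0 \<theta>\<^sub>1 (\<lambda>t. \<mu>\<^sub>2 * w t - A 2) \<phi>\<^sub>2"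
    "\<forall>t\<in>{\<theta>\<^sub>0<..<\<theta>\<^sub>1}. 0 < \<phi>\<^sub>2 t"
    using ground [of 2] A by auto
  have q: "\<forall>t\<in>{\<theta>\<^sub>0<..<\<theta>\<^sub>1}. \<mu> * w t - A k \<le> 2 * (pi / (\<theta>\<^sub>1 - \<theta>\<^sub>0))\<^sup>2" if "\<mu> \<le> \<mu>\<^sub>2" for \<mu> k
  proof
    fix t assume t: "t \<in> {\<theta>\<^sub>0<..<\<theta>\<^sub>1}"
    have "\<mu> * w t \<le> (3 / 2 * \<kappa>\<^sup>2) * w t"
      using that \<phi>2(1) A(3) \<kappa> w(1) [of t] t by (intro mult_right_mono) auto
    also have "\<dots> \<le> (3 / 2 * \<kappa>\<^sup>2) * (16 / 15)"
    proof (intro mult_left_mono)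
      have "1 / C \<le> 16 / 15" using C by (simp add: field_simps)
      then show "w t \<le> 16 / 15" using w(2) [of t] t by auto
    qed auto
    also have "\<dots> \<le> 2 * \<kappa>\<^sup>2" by simp
    finally show "\<mu> * w t - A k \<le> 2 * (pi / (\<theta>\<^sub>1 - \<theta>\<^sub>0))\<^sup>2" using A(1) [of k] by (simp add: \<kappa>_def)
  qed
  \<comment> \<open>Otherwise (\<mu>2 - \<mu>1) times the weight is below 3 c^2, the difference of
    the two separation constants, at every angle. The potential of \<open>\<phi>\<^sub>2\<close>
    then lies strictly below that of \<open>\<phi>\<^sub>1\<close>, and comparison forces the
    positive function \<open>\<phi>\<^sub>2\<close> to vanish.\<close>
  have gap: "3 * c\<^sup>2 * C \<le> \<mu>\<^sub>2 - \<mu>\<^sub>1"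
  proof (rule ccontr)
    assume "\<not> 3 * c\<^sup>2 * C \<le> \<mu>\<^sub>2 - \<mu>\<^sub>1"
    then have lt: "(\<mu>\<^sub>2 - \<mu>\<^sub>1) / C < 3 * c\<^sup>2" using C by (simp add: field_simps)
    have "\<forall>t\<in>{\<theta>\<^sub>0<..<\<theta>\<^sub>1}. \<mu>\<^sub>2 * w t - A 2 < \<mu>\<^sub>1 * w t - A 1"
    proof
      fix t assume t: "t \<in> {\<theta>\<^sub>0<..<\<theta>\<^sub>1}"
      have "(\<mu>\<^sub>2 - \<mu>\<^sub>1) * w t < 3 * c\<^sup>2"
      proof (cases "0 \<le> \<mu>\<^sub>2 - \<mu>\<^sub>1")
        case True
        have "(\<mu>\<^sub>2 - \<mu>\<^sub>1) * w t \<le> (\<mu>\<^sub>2 - \<mu>\<^sub>1) * (1 / C)"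
          using True w(2) [of t] t by (intro mult_left_mono) auto
        with lt show ?thesis by simp
      next
        case False
        then have "(\<mu>\<^sub>2 - \<mu>\<^sub>1) * w t \<le> 0" using w(1) [of t] t by (intro mult_nonpos_nonneg) auto
        moreover have "0 < 3 * c\<^sup>2" using \<open>0 < c\<close> by simp
        ultimately show ?thesis by linarith
      qed
      then show "\<mu>\<^sub>2 * w t - A 2 < \<mu>\<^sub>1 * w t - A 1" unfolding A(2,3) by (simp add: algebra_simps)
    qed
    from dirichlet_comparison_less [OF \<theta>' \<phi>2(2) \<phi>1(2,3) q [OF order_refl] this, of "pi / 2"]
    show False using bspec [OF \<phi>2(3), of "pi / 2"] \<theta> by auto
  qed
  have gap_pos: "0 < 3 * c\<^sup>2 * C" using \<open>0 < c\<close> C by simp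
  define v where "v = (\<lambda>(k :: nat) \<phi> p. if p \<in> \<Omega>
      then sin (real k * c * log_radius p) * \<phi> (polar_angle p) else (0 :: real))"
  have v: "v k \<phi> \<in> dirichlet_eigenspace \<Omega> \<mu>"
    if "dirichlet_solution \<theta>\<^sub>0 \<theta>\<^sub>1 (\<lambda>t. \<mu> * w t - A k) \<phi>" for k \<mu> \<phi>
    unfolding v_def \<Omega>_def
    by (rule product_eigenfunction [OF \<open>0 < c\<close> \<theta>(1) \<theta>' \<theta>(4)]) (use that in \<open>simp add: w_def A_def\<close>)
  have v0: "v k \<phi> (polar_point (pi / c / (2 * real k)) (pi / 2)) \<noteq> 0"
    if "\<forall>t\<in>{\<theta>\<^sub>0<..<\<theta>\<^sub>1}. 0 < \<phi> t" "1 \<le> k" for k \<phi>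
  proof -
    define t where "t = pi / c / (2 * real k)"
    have "t < pi / c" "0 < t" "real k * c * t = pi / 2"
      using \<open>0 < c\<close> that(2) by (auto simp: t_def field_simps)
    moreover from this have "polar_point t (pi / 2) \<in> \<Omega>"
      using \<theta> by (simp add: \<Omega>_def in_polar_sector_iff polar_point_coordinates)
    moreover have "0 < \<phi> (pi / 2)" using bspec [OF that(1), of "pi / 2"] \<theta> by auto
    moreover from \<open>real k * c * t = pi / 2\<close> have "sin (real k * c * t) = 1"
      by (simp only: sin_pi_half)
    ultimately show ?thesis unfolding t_def [symmetric] by (simp add: v_def polar_point_coordinates)
  qed
  define F where "F = (\<lambda>u (k :: nat) \<theta>. integral {0..pi / c} (\<lambda>t. u (polar_point t \<theta>) * sin (real k * c * t)))"
  have F: "dirichlet_solution \<theta>\<^sub>0 \<theta>\<^sub>1 (\<lambda>t. \<mu> * w t - A k) (F u k)"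
    if "u \<in> dirichlet_eigenspace \<Omega> \<mu>" for u \<mu> k
    unfolding F_def w_def A_def
    by (rule eigenfunction_sine_coefficient [OF \<open>0 < c\<close> \<theta>(1) \<theta>' \<theta>(4)]) (use that in \<open>simp add: \<Omega>_def\<close>)
  \<comment> \<open>For \<open>k \<ge> 2\<close> the potential lies strictly below that of the
    positive function \<open>\<phi>\<^sub>2\<close>; for \<open>k = 0\<close> the integrand is zero.
    Below \<mu>2 only the first mode can survive.\<close>
  have F0: "F u k t = 0" if u: "u \<in> dirichlet_eigenspace \<Omega> \<mu>" and "\<mu> < \<mu>\<^sub>2" and k: "k \<noteq> 1" and t: "t \<in> {\<theta>\<^sub>0..\<theta>\<^sub>1}"
    for u \<mu> k t
  proof (cases "k = 0")
    case False
    with k have "2 \<le> k" by simp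
    then have "A 2 \<le> A k"
      using \<open>0 < c\<close> unfolding A_def by (intro power_mono mult_right_mono) auto
    moreover have "\<mu> * w t < \<mu>\<^sub>2 * w t" if "t \<in> {\<theta>\<^sub>0<..<\<theta>\<^sub>1}" for t
      using \<open>\<mu> < \<mu>\<^sub>2\<close> w(1) [of t] that by (intro mult_strict_right_mono) auto
    ultimately have "\<forall>t\<in>{\<theta>\<^sub>0<..<\<theta>\<^sub>1}. \<mu> * w t - A k < \<mu>\<^sub>2 * w t - A 2" by force
    from dirichlet_comparison_less [OF \<theta>' F [OF u] \<phi>2(2,3) q this t] \<open>\<mu> < \<mu>\<^sub>2\<close> show ?thesis by simp
  qed (simp add: F_def)
  have mode: "u p = 2 * c / pi * F u 1 (polar_angle p) * sin (c * log_radius p)"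
    if u: "u \<in> dirichlet_eigenspace \<Omega> \<mu>" and "\<mu> < \<mu>\<^sub>2" and p: "p \<in> \<Omega>" for u \<mu> p
    using eigenfunction_first_mode [OF \<open>0 < c\<close> \<theta>(1) \<theta>' \<theta>(4) u [unfolded \<Omega>_def] _ p [unfolded \<Omega>_def]]
      F0 [OF u \<open>\<mu> < \<mu>\<^sub>2\<close>] by (simp add: F_def)
  have angle: "polar_angle p \<in> {\<theta>\<^sub>0..\<theta>\<^sub>1}" if "p \<in> \<Omega>" for p
    using that in_polar_sector_iff [OF \<theta>(1,4)] by (auto simp: \<Omega>_def)
  \<comment> \<open>The first coefficient is compared with \<open>\<phi>\<^sub>1\<close>. Between
    \<mu>1 and \<mu>2 its potential exceeds that of the ground state, and the bound 2 \<kappa>^2 is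
    what excludes an excited angular state.\<close>
  have none: "u = (\<lambda>_. 0)" if u: "u \<in> dirichlet_eigenspace \<Omega> \<mu>" and \<mu>: "\<mu> < \<mu>\<^sub>2" "\<mu> \<noteq> \<mu>\<^sub>1" for u \<mu>
  proof -
    have F1: "F u 1 t = 0" if t: "t \<in> {\<theta>\<^sub>0..\<theta>\<^sub>1}" for t
    proof (cases "\<mu> < \<mu>\<^sub>1")
      case True
      have "\<forall>t\<in>{\<theta>\<^sub>0<..<\<theta>\<^sub>1}. \<mu> * w t - A 1 < \<mu>\<^sub>1 * w t - A 1"
      proof
        fix t assume "t \<in> {\<theta>\<^sub>0<..<\<theta>\<^sub>1}"
        then show "\<mu> * w t - A 1 < \<mu>\<^sub>1 * w t - A 1" using True w(1) [of t] by simp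
      qed
      from dirichlet_comparison_less [OF \<theta>' F [OF u] \<phi>1(2,3) q this t] \<mu> show ?thesis by simp
    next
      case False
      have "\<forall>t\<in>{\<theta>\<^sub>0<..<\<theta>\<^sub>1}. \<mu> * w t - A 1 > \<mu>\<^sub>1 * w t - A 1"
      proof
        fix t assume "t \<in> {\<theta>\<^sub>0<..<\<theta>\<^sub>1}"
        then show "\<mu> * w t - A 1 > \<mu>\<^sub>1 * w t - A 1" using False \<mu>(2) w(1) [of t] by simp
      qed
      from dirichlet_comparison_greater [OF \<theta>' F [OF u] \<phi>1(2,3) q this t] \<mu> show ?thesis by simp
    qed
    show ?thesis
    proof
      fix p
      show "u p = 0"
      proof (cases "p \<in> \<Omega>")
        case True
        then show ?thesis using mode [OF u \<mu>(1) True] F1 [OF angle [OF True]] by simp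
      next
        case False
        then show ?thesis using u by (simp add: dirichlet_eigenspace_def)
      qed
    qed
  qed
  have simple: "\<exists>M. u = (\<lambda>p. M * v 1 \<phi>\<^sub>1 p)" if u: "u \<in> dirichlet_eigenspace \<Omega> \<mu>\<^sub>1" for u
  proof -
    have less: "\<mu>\<^sub>1 < \<mu>\<^sub>2" using gap gap_pos by linarith
    obtain M where M: "\<forall>t\<in>{\<theta>\<^sub>0..\<theta>\<^sub>1}. F u 1 t = M * \<phi>\<^sub>1 t"
      using dirichlet_comparison_eq [OF \<theta>' F [OF u, of 1] \<phi>1(2,3) q] less by auto
    have "u p = 2 * c / pi * M * v 1 \<phi>\<^sub>1 p" for p
    proof (cases "p \<in> \<Omega>")
      case True
      then show ?thesis using mode [OF u less True] M angle [OF True] by (simp add: v_def)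
    next
      case False
      then show ?thesis using u by (simp add: dirichlet_eigenspace_def v_def)
    qed
    then show ?thesis by blast
  qed
  have "is_dirichlet_eigenvalue \<Omega> 1 \<mu>\<^sub>1" "is_dirichlet_eigenvalue \<Omega> 2 \<mu>\<^sub>2"
    using first_two_eigenvalues [of \<Omega> \<mu>\<^sub>1 "v 1 \<phi>\<^sub>1" \<mu>\<^sub>2, OF simple none _ v [OF \<phi>1(2)] v0 [OF \<phi>1(3)]
        v [OF \<phi>2(2)] v0 [OF \<phi>2(3)]] gap gap_pos by simp_all
  with gap show ?thesis by (auto simp: \<Omega>_def C_def)
qed

theorem mainTheorem3:
  fixes c :: real
  assumes "c > pi"
  shows "\<exists>\<epsilon>>0. \<forall>\<theta>\<^sub>0 \<theta>\<^sub>1 :: real.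
           0 < \<theta>\<^sub>0 \<and> \<theta>\<^sub>0 < pi / 2 \<and> pi / 2 < \<theta>\<^sub>1 \<and> \<theta>\<^sub>1 < pi \<and>
           pi / 2 - \<epsilon> < min \<theta>\<^sub>0 (pi - \<theta>\<^sub>1) \<and> min \<theta>\<^sub>0 (pi - \<theta>\<^sub>1) < pi / 2 \<longrightarrow>
           (\<exists>\<mu>\<^sub>1 \<mu>\<^sub>2.
              is_dirichlet_eigenvalue (polar_sector c \<theta>\<^sub>0 \<theta>\<^sub>1) 1 \<mu>\<^sub>1 \<and>
              is_dirichlet_eigenvalue (polar_sector c \<theta>\<^sub>0 \<theta>\<^sub>1) 2 \<mu>\<^sub>2 \<and>
              \<mu>\<^sub>1 < \<mu>\<^sub>2 \<and>
              \<mu>\<^sub>2 - \<mu>\<^sub>1 > 3 * pi\<^sup>2 / (hyp_diameter (polar_sector c \<theta>\<^sub>0 \<theta>\<^sub>1))\<^sup>2)"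
proof -
  have c: "0 < c" using assms pi_gt_zero by linarith
  define L where "L = pi / c"
  have L: "0 < L" "L < 1" using assms c by (auto simp: L_def field_simps)
  \<comment> \<open>The threshold for 1 / cos m below which the diameter estimate works; it depends
    on \<open>c\<close> through \<open>L\<close>.\<close>
  obtain d where d: "1 < d" "\<And>k. 1 < k \<Longrightarrow> k < d \<Longrightarrow> cosh (k * L) < k * cosh L"
    using cosh_scale_less [OF L] unfolding eventually_at_right_field by auto
  have "((\<lambda>m :: real. inverse (cos m)) \<longlongrightarrow> 1) (at_right 0)"
    by (auto intro!: tendsto_eq_intros)
  then have 1: "\<forall>\<^sub>F m in at_right 0. inverse (cos m) < d"
    using d(1) by (intro order_tendstoD(2)) auto
  have "((\<lambda>m. (cos m)\<^sup>2) \<longlongrightarrow> (cos (0 :: real))\<^sup>2) (at_right 0)"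
    by (intro tendsto_intros)
  then have 2: "\<forall>\<^sub>F m :: real in at_right 0. 15 / 16 < (cos m)\<^sup>2"
    by (intro order_tendstoD(1)) auto
  have "((\<lambda>m. 32 * c\<^sup>2 * m\<^sup>2) \<longlongrightarrow> 32 * c\<^sup>2 * 0\<^sup>2) (at_right 0)"
    by (intro tendsto_intros)
  then have 3: "\<forall>\<^sub>F m in at_right 0. 32 * c\<^sup>2 * m\<^sup>2 < pi\<^sup>2"
    by (intro order_tendstoD(2)) auto
  \<comment> \<open>One \<epsilon> for three demands that hold as m tends to 0 from the right: the
    diameter estimate, a nearly constant weight, and an angular interval short against 1 /
    c.\<close>
  obtain \<epsilon> where \<epsilon>: "\<epsilon> > 0"
    "\<And>m. 0 < m \<Longrightarrow> m < \<epsilon> \<Longrightarrow> inverse (cos m) < d \<and> 15 / 16 < (cos m)\<^sup>2 \<and> 32 * c\<^sup>2 * m\<^sup>2 < pi\<^sup>2"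
    using eventually_conj [OF 1 eventually_conj [OF 2 3]] unfolding eventually_at_right_field by auto
  show ?thesis
  proof (rule exI [of _ \<epsilon>], intro conjI allI impI)
    show "\<epsilon> > 0" by (rule \<epsilon>(1))
    fix \<theta>\<^sub>0 \<theta>\<^sub>1 :: real
    assume as: "0 < \<theta>\<^sub>0 \<and> \<theta>\<^sub>0 < pi / 2 \<and> pi / 2 < \<theta>\<^sub>1 \<and> \<theta>\<^sub>1 < pi \<and>
           pi / 2 - \<epsilon> < min \<theta>\<^sub>0 (pi - \<theta>\<^sub>1) \<and> min \<theta>\<^sub>0 (pi - \<theta>\<^sub>1) < pi / 2"
    define m where "m = pi / 2 - min \<theta>\<^sub>0 (pi - \<theta>\<^sub>1)"
    define D where "D = hyp_diameter (polar_sector c \<theta>\<^sub>0 \<theta>\<^sub>1)"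
    have m: "0 < m" "m < \<epsilon>" "m < pi / 2" using as by (auto simp: m_def)
    note sm = \<epsilon>(2) [OF m(1,2)]
    have cm: "0 < cos m" using m by (intro cos_gt_zero) auto
    have cm1: "cos m < 1" using cos_monotone_0_pi [of 0 m] m pi_gt_zero by simp
    define k where "k = inverse (cos m)"
    have k: "1 < k" "k < d" using sm cm cm1 by (auto simp: k_def one_less_inverse)
    obtain \<theta> where \<theta>: "\<theta> \<in> {\<theta>\<^sub>0, \<theta>\<^sub>1}" "sin \<theta> = cos m"
    proof (cases "\<theta>\<^sub>0 \<le> pi - \<theta>\<^sub>1")
      case True
      then show ?thesis using that [of \<theta>\<^sub>0] by (simp add: m_def min_def cos_diff)
    next
      case False
      then show ?thesis using that [of \<theta>\<^sub>1] by (simp add: m_def min_def cos_diff)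
    qed
    have "arcosh (cosh L / sin \<theta>) \<le> D"
      unfolding D_def L_def using as \<theta>(1) c by (intro cosh_le_polar_sector_diameter) auto
    then have "arcosh (k * cosh L) \<le> D" by (simp add: \<theta>(2) k_def field_simps)
    moreover have "arcosh (cosh (k * L)) < arcosh (k * cosh L)"
      using d(2) [OF k] cosh_real_ge_1 [of "k * L"] by (intro arcosh_real_strict_mono) auto
    moreover have "arcosh (cosh (k * L)) = k * L" using k L by (intro arcosh_cosh_real) auto
    ultimately have D: "k * L < D" by simp
    have kL: "0 < k * L" using k L by simp
    have "(k * L)\<^sup>2 < D\<^sup>2" using D kL by (intro power_strict_mono) auto
    \<comment> \<open>Inserting \<open>L = pi / c\<close> and \<open>k = 1 / cos m\<close> into the
      right-hand side reproduces exactly the lower bound for the gap, so the strictness of the final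
      inequality comes from the diameter alone.\<close>
    then have "3 * pi\<^sup>2 / D\<^sup>2 < 3 * pi\<^sup>2 / (k * L)\<^sup>2"
      using kL by (intro divide_strict_left_mono mult_pos_pos) auto
    also have "\<dots> = 3 * c\<^sup>2 * (cos m)\<^sup>2"
      using cm c by (simp add: k_def L_def power_mult_distrib power_divide power_inverse field_simps)
    finally have lt: "3 * pi\<^sup>2 / D\<^sup>2 < 3 * c\<^sup>2 * (cos m)\<^sup>2" .
    obtain \<mu>\<^sub>1 \<mu>\<^sub>2 where \<mu>: "is_dirichlet_eigenvalue (polar_sector c \<theta>\<^sub>0 \<theta>\<^sub>1) 1 \<mu>\<^sub>1"
      "is_dirichlet_eigenvalue (polar_sector c \<theta>\<^sub>0 \<theta>\<^sub>1) 2 \<mu>\<^sub>2" "3 * c\<^sup>2 * (cos m)\<^sup>2 \<le> \<mu>\<^sub>2 - \<mu>\<^sub>1"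
      using polar_sector_spectral_gap [OF c _ _ _ _ m_def] as sm by (auto simp: less_imp_le)
    moreover have "0 \<le> 3 * pi\<^sup>2 / D\<^sup>2" by simp
    ultimately have "\<mu>\<^sub>1 < \<mu>\<^sub>2" "3 * pi\<^sup>2 / D\<^sup>2 < \<mu>\<^sub>2 - \<mu>\<^sub>1" using lt by linarith+
    with \<mu> show "\<exists>\<mu>\<^sub>1 \<mu>\<^sub>2.
              is_dirichlet_eigenvalue (polar_sector c \<theta>\<^sub>0 \<theta>\<^sub>1) 1 \<mu>\<^sub>1 \<and>
              is_dirichlet_eigenvalue (polar_sector c \<theta>\<^sub>0 \<theta>\<^sub>1) 2 \<mu>\<^sub>2 \<and>
              \<mu>\<^sub>1 < \<mu>\<^sub>2 \<and>
              \<mu>\<^sub>2 - \<mu>\<^sub>1 > 3 * pi\<^sup>2 / (hyp_diameter (polar_sector c \<theta>\<^sub>0 \<theta>\<^sub>1))\<^sup>2"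
      unfolding D_def by blast
  qed
qed

end
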